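(* Let $D$ be the quaternion division algebra over $\mathbb{Q}_2$ and let $\Lambda$ be a skew-hermitian $\mathcal{O}_D$-lattice with a decomposition $\Lambda=\Lambda_1\perp\cdots\perp\Lambda_m$ into components $\Lambda_r$ of rank $1$ or $2$ whose scales satisfy $\mathbf{s}(\Lambda_{r+1})\subseteq \mathbf{s}(\Lambda_r)$. Let $s$ be the number of (indecomposable) rank-$2$ components in this decomposition; let $A\subseteq \mathbb{Q}_2^*/\mathbb{Q}_2^{*2}$ be the set of square classes $N(a)\mathbb{Q}_2^{*2}$, where $\Lambda_r=\langle a\rangle$ runs over the rank-$1$ components; and let $\mu$ be the minimal difference $\nu(a')-\nu(a)$ between the valuations of the scales of two consecutive rank-$1$ components $\langle a\rangle,\langle a'\rangle$. Then: (i) if $|A|>1$, then $H(\Lambda)=\mathbb{Q}_2^*$; (ii) if $s=0$ and $A=\{-\Delta\mathbb{Q}_2^{*2}\}$, then $H(\Lambda)=\mathbb{Z}_2^*\mathbb{Q}_2^{*2}$; (iii) if $s=0$, $A=\{-u\mathbb{Q}_2^{*2}\}$ and $0\le\mu<\nu(8)$, then $H(\Lambda)=\mathbb{Q}_2^*$; (iv) if $s=0$, $A=\{-u\mathbb{Q}_2^{*2}\}$ and $\mu\ge\nu(8)$, then $H(\Lambda)=N(\mathbb{Q}_2(a)^* )$, where $a$ is the value $h(x,x)$ for a generator $x$ of any rank-$1$ component; (v) if $s=0$, $A=\{\pi\mathbb{Q}_2^{*2}\}$ for a prime element $\pi$ of $\mathbb{Q}_2$, and $0\le\mu\le\nu(16)$,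 then $H(\Lambda)=\mathbb{Q}_2^*$; (vi) if $s=0$, $A=\{\pi\mathbb{Q}_2^{*2}\}$ for a prime $\pi$, and $\mu>\nu(16)$, then $H(\Lambda)=N(\mathbb{Q}_2(a)^* )$ with $a$ as in (iv); (vii) if $s\neq 0$, then $H(\Lambda)=\mathbb{Q}_2^*$. Here $\Delta$ is a unit of minimal quadratic defect (e.g. $\Delta=5$) and $u$ is a unit of non-minimal quadratic defect (i.e. $u\in -\mathbb{Z}_2^{*2}\cup -5\mathbb{Z}_2^{*2}$).
   Context: $D$ has canonical involution $q\mapsto\bar q$, reduced norm $N$; $|q|:=|N(q)|_{\mathbb{Q}_2}$ and $\nu(q):=\nu_2(N(q))$ (so $\nu(2)=2$, $\nu(8)=6$, $\nu(16)=8$); $\mathcal{O}_D=\{q\in D:|q|\le1\}$ is the maximal order. A skew-hermitian space is a free $D$-module $V$ of finite rank with a nondegenerate form $h:V\times V\to D$, $D$-linear in the first variable, with $h(x,y)=-\overline{h(y,x)}$. An $\mathcal{O}_D$-lattice is a finitely generated $\mathcal{O}_D$-submodule of $V$ spanning $V$; its scale $\mathbf{s}(\cdot)$ is the ideal generated by the values of $h$ on it. For a pure quaternion $a$, $\langle a\rangle$ denotes a rank-one lattice $\mathcal{O}_Dx$ with $h(x,x)=a$. $\mathcal{U}^+_k$ is the group of $D$-linear isometries of $h$ (here $k=\mathbb{Q}_2$), $\mathcal{U}^+_k(\Lambda)$ the stabilizer of $\Lambda$, and $\theta:\mathcal{U}^+_k\to k^*/k^{*2}$ the spinor norm; for $s\in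 V$, $\sigma\in D^*$ with $\sigma-\bar\sigma=h(s,s)$, the simple rotation $(s;\sigma)(x)=x-h(x,s)\sigma^{-1}s$ lies in $\mathcal{U}^+_k$ and $\theta((s;\sigma))=N(\sigma)k^{*2}$. $H(\Lambda)$ is the subgroup of $k^*$ containing $k^{*2}$ with $H(\Lambda)/k^{*2}=\theta(\mathcal{U}^+_k(\Lambda))$. *)

theory Defs
  imports "HOL-Library.Extended_Real"
begin

text \<open>We do not construct Q_2; instead the base field is any field of characteristic 0
with a discrete valuation val (defined on nonzero elements) such that val 2 = 1,
the residue field has two elements and the field is complete.  Such a field is
(uniquely up to isomorphism) Q_2.\<close>

definition is_Q2 :: "('k::field_char_0 \<Rightarrow> int) \<Rightarrow> bool" where
  "is_Q2 val \<longleftrightarrow>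
     (\<forall>x y. x \<noteq> 0 \<longrightarrow> y \<noteq> 0 \<longrightarrow> val (x * y) = val x + val y) \<and>
     (\<forall>x y. x \<noteq> 0 \<longrightarrow> y \<noteq> 0 \<longrightarrow> x + y \<noteq> 0 \<longrightarrow> val (x + y) \<ge> min (val x) (val y)) \<and>
     val 2 = 1 \<and>
     (\<forall>x. x \<noteq> 0 \<longrightarrow> x \<noteq> 1 \<longrightarrow> val x \<ge> 0 \<longrightarrow> val x \<ge> 1 \<or> val (x - 1) \<ge> 1) \<and>
     (\<forall>f :: nat \<Rightarrow> 'k.
        (\<forall>M. \<exists>N. \<forall>p\<ge>N. \<forall>q\<ge>N. f p = f q \<or> val (f p - f q) \<ge> M) \<longrightarrow>
        (\<exists>l. \<forall>M. \<exists>N. \<forall>p\<ge>N. f p = l \<or> val (f p - l) \<ge> M))"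

definition sqc :: "'k::field \<Rightarrow> 'k set" where
  "sqc c = {c * x^2 | x. x \<noteq> 0}"

definition kunit :: "('k::field \<Rightarrow> int) \<Rightarrow> 'k \<Rightarrow> bool" where
  "kunit val u \<longleftrightarrow> u \<noteq> 0 \<and> val u = 0"

datatype 'k quat = Quat 'k 'k 'k 'k

fun qadd :: "'k::field quat \<Rightarrow> 'k quat \<Rightarrow> 'k quat" where
  "qadd (Quat a b c d) (Quat a' b' c' d') = Quat (a+a') (b+b') (c+c') (d+d')"

fun qneg :: "'k::field quat \<Rightarrow> 'k quat" where
  "qneg (Quat a b c d) = Quat (-a) (-b) (-c) (-d)"

definition qsub :: "'k::field quat \<Rightarrow> 'k quat \<Rightarrow> 'k quat" where
  "qsub p q = qadd p (qneg q)"

fun qmul :: "'k::field quat \<Rightarrow> 'k quat \<Rightarrow> 'k quat" where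
  "qmul (Quat a1 b1 c1 d1) (Quat a2 b2 c2 d2) =
     Quat (a1*a2 - b1*b2 - c1*c2 - d1*d2)
          (a1*b2 + b1*a2 + c1*d2 - d1*c2)
          (a1*c2 - b1*d2 + c1*a2 + d1*b2)
          (a1*d2 + b1*c2 - c1*b2 + d1*a2)"

fun qconj :: "'k::field quat \<Rightarrow> 'k quat" where
  "qconj (Quat a b c d) = Quat a (-b) (-c) (-d)"

fun qnorm :: "'k::field quat \<Rightarrow> 'k" where
  "qnorm (Quat a b c d) = a^2 + b^2 + c^2 + d^2"

definition qof :: "'k::field \<Rightarrow> 'k quat" where
  "qof c = Quat c 0 0 0"

definition qzero :: "'k::field quat" where
  "qzero = Quat 0 0 0 0"

definition qinv :: "'k::field quat \<Rightarrow> 'k quat" where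
  "qinv q = qmul (qof (inverse (qnorm q))) (qconj q)"

definition qnu :: "('k::field \<Rightarrow> int) \<Rightarrow> 'k quat \<Rightarrow> int" where
  "qnu val q = val (qnorm q)"

definition OD :: "('k::field \<Rightarrow> int) \<Rightarrow> 'k quat set" where
  "OD val = {q. q = qzero \<or> val (qnorm q) \<ge> 0}"

definition qsum :: "'a list \<Rightarrow> ('a \<Rightarrow> 'k::field quat) \<Rightarrow> 'k quat" where
  "qsum xs f = foldr (\<lambda>x acc. qadd (f x) acc) xs qzero"

type_synonym 'k vec = "nat \<Rightarrow> 'k quat"

definition inV :: "nat \<Rightarrow> 'k::field vec \<Rightarrow> bool" where
  "inV n x \<longleftrightarrow> (\<forall>i\<ge>n. x i = qzero)"

definition vzero :: "'k::field vec" where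
  "vzero = (\<lambda>_. qzero)"

definition vadd :: "'k::field vec \<Rightarrow> 'k vec \<Rightarrow> 'k vec" where
  "vadd x y = (\<lambda>i. qadd (x i) (y i))"

definition smul :: "'k::field quat \<Rightarrow> 'k vec \<Rightarrow> 'k vec" where
  "smul c x = (\<lambda>i. qmul c (x i))"

definition vsum :: "'k::field vec list \<Rightarrow> 'k vec" where
  "vsum xs = foldr vadd xs vzero"

definition hform :: "nat \<Rightarrow> (nat \<Rightarrow> nat \<Rightarrow> 'k::field quat) \<Rightarrow> 'k vec \<Rightarrow> 'k vec \<Rightarrow> 'k quat" where
  "hform n Hm x y = qsum [0..<n] (\<lambda>i. qsum [0..<n] (\<lambda>j. qmul (qmul (x i) (Hm i j)) (qconj (y j))))"

definition skew_herm :: "nat \<Rightarrow> (nat \<Rightarrow> nat \<Rightarrow> 'k::field quat) \<Rightarrow> bool" where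
  "skew_herm n Hm \<longleftrightarrow> (\<forall>i<n. \<forall>j<n. Hm j i = qneg (qconj (Hm i j)))"

definition nondeg :: "nat \<Rightarrow> (nat \<Rightarrow> nat \<Rightarrow> 'k::field quat) \<Rightarrow> bool" where
  "nondeg n Hm \<longleftrightarrow> (\<forall>x. inV n x \<longrightarrow> (\<forall>y. inV n y \<longrightarrow> hform n Hm x y = qzero) \<longrightarrow> x = vzero)"

definition lcomb :: "'k::field quat list \<Rightarrow> 'k vec list \<Rightarrow> 'k vec" where
  "lcomb cs gs = vsum (map (\<lambda>(c,g). smul c g) (zip cs gs))"

definition ospan :: "('k::field \<Rightarrow> int) \<Rightarrow> 'k vec list \<Rightarrow> 'k vec set" where
  "ospan val gs = {lcomb cs gs | cs. length cs = length gs \<and> set cs \<subseteq> OD val}"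

definition dspan :: "'k::field vec list \<Rightarrow> 'k vec set" where
  "dspan gs = {lcomb cs gs | cs. length cs = length gs}"

definition dindep :: "'k::field vec list \<Rightarrow> bool" where
  "dindep gs \<longleftrightarrow> (\<forall>cs. length cs = length gs \<longrightarrow> lcomb cs gs = vzero \<longrightarrow> set cs \<subseteq> {qzero})"

definition is_lattice :: "('k::field \<Rightarrow> int) \<Rightarrow> nat \<Rightarrow> 'k vec set \<Rightarrow> bool" where
  "is_lattice val n L \<longleftrightarrow>
     (\<exists>gs. (\<forall>g\<in>set gs. inV n g) \<and> L = ospan val gs \<and> dspan gs = {x. inV n x})"

definition free_rank :: "('k::field \<Rightarrow> int) \<Rightarrow> 'k vec set \<Rightarrow> nat \<Rightarrow> bool" where
  "free_rank val L t \<longleftrightarrow> (\<exists>bs. length bs = t \<and> dindep bs \<and> L = ospan val bs)"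

definition gen :: "('k::field \<Rightarrow> int) \<Rightarrow> 'k vec set \<Rightarrow> 'k vec \<Rightarrow> bool" where
  "gen val L x \<longleftrightarrow> x \<noteq> vzero \<and> L = ospan val [x]"

definition orth_decomp :: "nat \<Rightarrow> (nat \<Rightarrow> nat \<Rightarrow> 'k::field quat) \<Rightarrow> 'k vec set \<Rightarrow> 'k vec set list \<Rightarrow> bool" where
  "orth_decomp n Hm L Ls \<longleftrightarrow>
     L = {vsum xs | xs. length xs = length Ls \<and> (\<forall>r<length Ls. xs!r \<in> Ls!r)} \<and>
     (\<forall>xs. length xs = length Ls \<longrightarrow> (\<forall>r<length Ls. xs!r \<in> Ls!r) \<longrightarrow> vsum xs = vzero
        \<longrightarrow> (\<forall>r<length Ls. xs!r = vzero)) \<and>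
     (\<forall>r<length Ls. \<forall>r'<length Ls. r \<noteq> r' \<longrightarrow>
        (\<forall>x\<in>Ls!r. \<forall>y\<in>Ls!r'. hform n Hm x y = qzero))"

definition indecomp :: "('k::field \<Rightarrow> int) \<Rightarrow> nat \<Rightarrow> (nat \<Rightarrow> nat \<Rightarrow> 'k quat) \<Rightarrow> 'k vec set \<Rightarrow> bool" where
  "indecomp val n Hm L \<longleftrightarrow>
     \<not> (\<exists>L1 L2. free_rank val L1 1 \<and> free_rank val L2 1 \<and> orth_decomp n Hm L [L1, L2])"

text \<open>scale: the O_D-ideal generated by the values of h, i.e. finite sums of values\<close>
definition scale :: "nat \<Rightarrow> (nat \<Rightarrow> nat \<Rightarrow> 'k::field quat) \<Rightarrow> 'k vec set \<Rightarrow> 'k quat set" where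
  "scale n Hm L = {qsum ps (\<lambda>(x,y). hform n Hm x y) | ps. set ps \<subseteq> L \<times> L}"

definition scount :: "('k::field \<Rightarrow> int) \<Rightarrow> 'k vec set list \<Rightarrow> nat" where
  "scount val Ls = card {r. r < length Ls \<and> free_rank val (Ls!r) 2}"

definition Aset :: "('k::field \<Rightarrow> int) \<Rightarrow> nat \<Rightarrow> (nat \<Rightarrow> nat \<Rightarrow> 'k quat) \<Rightarrow> 'k vec set list \<Rightarrow> 'k set set" where
  "Aset val n Hm Ls = {sqc (qnorm (hform n Hm x x)) | r x. r < length Ls \<and> gen val (Ls!r) x}"

definition consec :: "('k::field \<Rightarrow> int) \<Rightarrow> 'k vec set list \<Rightarrow> nat \<Rightarrow> nat \<Rightarrow> bool" where
  "consec val Ls r r' \<longleftrightarrow> r < r' \<and> r' < length Ls \<and>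
     free_rank val (Ls!r) 1 \<and> free_rank val (Ls!r') 1 \<and>
     (\<forall>t. r < t \<longrightarrow> t < r' \<longrightarrow> \<not> free_rank val (Ls!t) 1)"

definition mu :: "('k::field \<Rightarrow> int) \<Rightarrow> nat \<Rightarrow> (nat \<Rightarrow> nat \<Rightarrow> 'k quat) \<Rightarrow> 'k vec set list \<Rightarrow> ereal" where
  "mu val n Hm Ls =
     (INF d \<in> {qnu val (hform n Hm x' x') - qnu val (hform n Hm x x) | r r' x x'.
                 consec val Ls r r' \<and> gen val (Ls!r) x \<and> gen val (Ls!r') x'}.
        ereal (real_of_int d))"

definition rot :: "nat \<Rightarrow> (nat \<Rightarrow> nat \<Rightarrow> 'k::field quat) \<Rightarrow> 'k vec \<Rightarrow> 'k quat \<Rightarrow> 'k vec \<Rightarrow> 'k vec" where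
  "rot n Hm s \<sigma> x = (\<lambda>i. qsub (x i) (qmul (qmul (hform n Hm x s) (qinv \<sigma>)) (s i)))"

definition valid_rot :: "nat \<Rightarrow> (nat \<Rightarrow> nat \<Rightarrow> 'k::field quat) \<Rightarrow> 'k vec \<times> 'k quat \<Rightarrow> bool" where
  "valid_rot n Hm p \<longleftrightarrow> (case p of (s, \<sigma>) \<Rightarrow>
      inV n s \<and> \<sigma> \<noteq> qzero \<and> qsub \<sigma> (qconj \<sigma>) = hform n Hm s s)"

definition comp_rots :: "nat \<Rightarrow> (nat \<Rightarrow> nat \<Rightarrow> 'k::field quat) \<Rightarrow> ('k vec \<times> 'k quat) list \<Rightarrow> 'k vec \<Rightarrow> 'k vec" where
  "comp_rots n Hm rs = foldr (\<lambda>(s, \<sigma>) f. rot n Hm s \<sigma> \<circ> f) rs id"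

text \<open>H(L): nonzero c whose square class is the spinor norm of an element of the
stabilizer of L, the element written as a product of simple rotations\<close>
definition Hgrp :: "nat \<Rightarrow> (nat \<Rightarrow> nat \<Rightarrow> 'k::field quat) \<Rightarrow> 'k vec set \<Rightarrow> 'k set" where
  "Hgrp n Hm L = {c. c \<noteq> 0 \<and> (\<exists>rs. (\<forall>p\<in>set rs. valid_rot n Hm p) \<and>
       comp_rots n Hm rs ` L = L \<and>
       c \<in> sqc (prod_list (map (\<lambda>(s, \<sigma>). qnorm \<sigma>) rs)))}"

definition normgrp :: "'k::field quat \<Rightarrow> 'k set" where
  "normgrp a = {qnorm (qadd (qof x) (qmul (qof y) a)) | x y. qadd (qof x) (qmul (qof y) a) \<noteq> qzero}"

end

theory Submission
imports "HOL-Library.Function_Algebras" "Jordan_Normal_Form.Determinant" "HOL-Algebra.Algebraic_Closure_Type" Defs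
begin

text \<open>
A simple rotation \<open>(s; \<sigma>)\<close> with \<open>s\<close> in the lattice preserves it as soon as \<open>\<nu>(\<sigma>)\<close> is at most the
valuation of every \<open>h x s\<close>. When this holds for all \<open>\<sigma> = r + h s s / 2\<close>, the group \<open>H\<close> contains the norm group of
\<open>k(h s s)\<close>, and two different norm groups generate \<open>k\<^sup>*\<close>. A second class is found among the vectors
\<open>x + c x'\<close> built from two close rank-one components, or inside an indecomposable binary component, by
looking at the parities of the coordinates of the pure quaternions \<open>h s s\<close>.

For the upper bounds, an isometry preserving an orthogonal sum of rank-one lattices is reduced to the identity one
generator at a time. If it maps \<open>g\<close> to \<open>l g + \<dots>\<close>, first twist along \<open>g\<close> by a \<open>\<eta>\<close> of
reduced norm one that brings \<open>l \<eta>\<close> away from \<open>1\<close>; then a single rotation moves the image back to \<open>g\<close> and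
preserves the lattice, because the later components lie deep enough. The norms of all rotations used lie in the
claimed group.

Both parts need that the spinor norm depends on the isometry only. If a product of rotations is the identity,
composing it with a generic isometry writes the identity as a product of transvections \<open>x \<mapsto> x + f(x) t\<close>
along the same vectors, and comparing determinants over an algebraic closure (by \<open>det (1 + A B) = det (1 + B A)\<close>) shows
that the product of the norms of the \<open>\<sigma>\<close> is a square.
\<close>


section \<open>The field $\mathbb{Q}_2$\<close>

text \<open>Membership in \<open>Hgrp\<close> is witnessed by some word of rotations, so an upper
  bound for it must compare two words of the same isometry. A word equal to the identity gives no
  determinant by itself, because one minus the word vanishes. After composition with an isometry
  \<psi> for which no tail of the word has a fixed vector, every \<open>1 - g\<close> that occurs is
  invertible, so the vector \<open>s\<close> of the next rotation can be written as
  \<open>t - g t\<close>. The factor \<open>1 + f t\<close> is then a scalar times the inverse of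
  \<sigma>: its numerator equals its own conjugate because \<open>g\<close> preserves the form.

  The thresholds come from the divisibility of \<open>r\<^sup>2 + g\<close>, where \<open>g\<close>
  is the norm of a pure quaternion and \<open>v = val g\<close>: the valuation is at most
  \<open>v + 2\<close> in general, \<open>v + 1\<close> if the unit part of \<open>g\<close> is 1
  modulo 4 and \<open>v\<close> is even, and \<open>v\<close> if \<open>v\<close> is odd. Up to the
  stated gaps, scaling the two generators suitably produces a vector whose norm lies in another
  square class. Beyond them, the interaction of the components changes norms only by factors
  \<open>1 + 4 * t\<close> or \<open>1 + 8 * t\<close> with integral \<open>t\<close>, and these are
  norms from \<open>k(a)\<close> already.\<close>

locale Q2_field =
  fixes val :: "'k::field_char_0 \<Rightarrow> int"
  assumes is_Q2: "is_Q2 val"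
begin

text \<open>\<open>val 0\<close> is arbitrary, so inequalities between valuations are replaced by
  divisibility by a power of two, which zero always satisfies.\<close>

definition dv :: "int \<Rightarrow> 'k \<Rightarrow> bool" where
  "dv m x \<longleftrightarrow> x = 0 \<or> m \<le> val x"

lemma val_mult: "x \<noteq> 0 \<Longrightarrow> y \<noteq> 0 \<Longrightarrow> val (x * y) = val x + val y"
  using is_Q2 unfolding is_Q2_def by blast

lemma val_add: "x \<noteq> 0 \<Longrightarrow> y \<noteq> 0 \<Longrightarrow> x + y \<noteq> 0 \<Longrightarrow> min (val x) (val y) \<le> val (x + y)"
  using is_Q2 unfolding is_Q2_def by blast

lemma val_2 [simp]: "val 2 = 1"
  using is_Q2 unfolding is_Q2_def by blast

lemma residue: "dv 0 x \<Longrightarrow> dv 1 x \<or> dv 1 (x - 1)"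
  using is_Q2 unfolding is_Q2_def dv_def by (cases "x = 0 \<or> x = 1") (auto simp: zero_le_one)

lemma complete:
  fixes f :: "nat \<Rightarrow> 'k"
  assumes "\<And>M. \<exists>N. \<forall>p\<ge>N. \<forall>q\<ge>N. dv M (f p - f q)"
  shows "\<exists>l. \<forall>M. \<exists>N. \<forall>p\<ge>N. dv M (f p - l)"
proof -
  note c = is_Q2[unfolded is_Q2_def, THEN conjunct2, THEN conjunct2, THEN conjunct2, THEN conjunct2,
    THEN spec[of _ f], THEN mp]
  have "\<forall>M. \<exists>N. \<forall>p\<ge>N. \<forall>q\<ge>N. f p = f q \<or> M \<le> val (f p - f q)"
    using assms unfolding dv_def right_minus_eq by (rule allI)
  from c[OF this] show ?thesis unfolding dv_def right_minus_eq .
qed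

lemma val_1 [simp]: "val 1 = 0"
  using val_mult[of 1 1] by auto

lemma val_minus [simp]: "val (- x) = val x"
proof (cases "x = 0")
  case False
  have "val (-1) = 0" using val_mult[of "-1" "-1"] by auto
  then show ?thesis using val_mult[of "-1" x] False by simp
qed simp

lemma val_power: "x \<noteq> 0 \<Longrightarrow> val (x ^ n) = int n * val x"
  by (induction n) (auto simp: val_mult algebra_simps)

lemma val_inverse: "x \<noteq> 0 \<Longrightarrow> val (inverse x) = - val x"
  using val_mult[of x "inverse x"] by simp

lemma val_divide: "x \<noteq> 0 \<Longrightarrow> y \<noteq> 0 \<Longrightarrow> val (x / y) = val x - val y"
  by (simp add: divide_inverse val_mult val_inverse)

lemma val_4 [simp]: "val 4 = 2" using val_power[of 2 2] by simp
lemma val_8 [simp]: "val 8 = 3" using val_power[of 2 3] by simp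

lemma dv_0 [simp]: "dv m 0" by (simp add: dv_def)

lemma dv_minus [simp]: "dv m (- x) = dv m x" by (simp add: dv_def)

lemma dv_add: "dv m x \<Longrightarrow> dv m y \<Longrightarrow> dv m (x + y)"
  using val_add[of x y] by (force simp: dv_def)

lemma dv_diff: "dv m x \<Longrightarrow> dv m y \<Longrightarrow> dv m (x - y)"
  using dv_add[of m x "- y"] by simp

lemma dv_mono: "dv m x \<Longrightarrow> n \<le> m \<Longrightarrow> dv n x"
  by (auto simp: dv_def)

lemma dv_mult: "dv m x \<Longrightarrow> dv n y \<Longrightarrow> dv (m + n) (x * y)"
  by (cases "x = 0 \<or> y = 0") (auto simp: dv_def val_mult)

lemma dv_mult0: "dv 0 x \<Longrightarrow> dv 0 y \<Longrightarrow> dv 0 (x * y)"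
  using dv_mult[of 0 x 0 y] by simp

lemma dv_multL: "dv m x \<Longrightarrow> dv 0 y \<Longrightarrow> dv m (x * y)"
  using dv_mult[of m x 0 y] by simp

lemma dv_multR: "dv m y \<Longrightarrow> dv 0 x \<Longrightarrow> dv m (x * y)"
  using dv_mult[of 0 x m y] by simp

lemma dv_1 [simp]: "dv 0 1" by (simp add: dv_def)

lemma not_dv1_1 [simp]: "\<not> dv 1 1" by (simp add: dv_def)

lemma dv_of_nat [simp]: "dv 0 (of_nat n)"
  by (induction n) (auto intro: dv_add)

lemma dv_numeral [simp]: "dv 0 (numeral n)"
  using dv_of_nat[of "numeral n"] by simp

lemma dv_power0: "dv 0 x \<Longrightarrow> dv 0 (x ^ n)"
  by (induction n) (auto intro: dv_mult0)

lemma dv_scale: "c \<noteq> 0 \<Longrightarrow> dv m (c * x) \<longleftrightarrow> dv (m - val c) x"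
  by (cases "x = 0") (auto simp: dv_def val_mult)

lemma dv_scaleR: "c \<noteq> 0 \<Longrightarrow> dv m (x * c) \<longleftrightarrow> dv (m - val c) x"
  by (cases "x = 0") (auto simp: dv_def val_mult)

lemma dv_2 [simp]: "dv m (2 * x) \<longleftrightarrow> dv (m - 1) x" by (simp add: dv_scale)
lemma dv_4 [simp]: "dv m (4 * x) \<longleftrightarrow> dv (m - 2) x" by (simp add: dv_scale)
lemma dv_8 [simp]: "dv m (8 * x) \<longleftrightarrow> dv (m - 3) x" by (simp add: dv_scale)

lemma dv_square: "dv (2 * m) (x\<^sup>2) \<longleftrightarrow> dv m x"
  by (cases "x = 0") (auto simp: dv_def val_power)

lemma val_eq_dv: "x \<noteq> 0 \<Longrightarrow> val x = m \<longleftrightarrow> dv m x \<and> \<not> dv (m + 1) x"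
  by (auto simp: dv_def)

lemma dv_0_cases:
  assumes "dv 0 x"
  obtains t where "x = 2 * t" "dv 0 t" | t where "x = 1 + 2 * t" "dv 0 t"
proof -
  have 1: "x = 2 * (x / 2)" and 2: "x = 1 + 2 * ((x - 1) / 2)" by (simp_all add: field_simps)
  have "dv 1 x \<Longrightarrow> dv 0 (x / 2)" "dv 1 (x - 1) \<Longrightarrow> dv 0 ((x - 1) / 2)"
    by (cases "x = 0"; cases "x = 1"; simp add: dv_def val_divide)+
  then show thesis using that(1)[OF 1] that(2)[OF 2] residue[OF assms] by blast
qed

lemma odd_unit: "dv 0 t \<Longrightarrow> 1 + 2 * t \<noteq> 0 \<and> val (1 + 2 * t) = 0"
proof -
  assume t: "dv 0 t"
  have a: "dv 0 (1 + 2 * t)" using t by (auto intro!: dv_add dv_mono[OF t])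
  have b: "\<not> dv 1 (1 + 2 * t)" using dv_diff[of 1 "1 + 2 * t" "2 * t"] t by auto
  then have "1 + 2 * t \<noteq> 0" by auto
  then show ?thesis using a b val_eq_dv[of "1 + 2*t" 0] by simp
qed

lemma unit_odd:
  assumes "x \<noteq> 0" "val x = 0" obtains t where "x = 1 + 2 * t" "dv 0 t"
proof -
  have "dv 0 x" "\<not> dv 1 x" using assms by (auto simp: dv_def)
  show thesis using dv_0_cases[OF \<open>dv 0 x\<close>] that \<open>\<not> dv 1 x\<close> by (metis dv_2 diff_self)
qed

lemma power_int_2_val: "val (2 powi n) = n" "(2 powi n :: 'k) \<noteq> 0"
proof -
  show "val (2 powi n) = n"
  proof (cases "n \<ge> 0")
    case True then show ?thesis by (simp add: power_int_def val_power)
  next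
    case False
    then have "2 powi n = inverse (2 ^ nat (- n) :: 'k)" by (simp add: power_int_def power_one_over inverse_eq_divide)
    then have "val (2 powi n) = - val (2 ^ nat (- n))" by (simp only:) (simp add: val_inverse del: inverse_eq_divide)
    then show ?thesis using False by (simp add: val_power)
  qed
qed simp

lemma unit_part:
  assumes "x \<noteq> 0"
  obtains t where "x = 2 powi (val x) * (1 + 2 * t)" "dv 0 t"
proof -
  define y where "y = x / 2 powi (val x)"
  have "y \<noteq> 0" "val y = 0" using assms power_int_2_val[of "val x"] by (auto simp: y_def val_divide)
  then obtain t where "y = 1 + 2 * t" "dv 0 t" by (elim unit_odd)
  moreover have "x = 2 powi (val x) * y" using power_int_2_val(2)[of "val x"] by (simp add: y_def)
  ultimately show thesis using that by metis
qed

text \<open>\<open>t\<^sup>2 + t = 2 c\<close> is solved by iterating the contraction \<open>t \<mapsto> 2 c - t\<^sup>2\<close> on the even integers.\<close>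

lemma hensel_iter:
  assumes c: "dv 0 c"
  shows "\<exists>t. dv 1 t \<and> t\<^sup>2 + t = 2 * c"
proof -
  define f where "f = rec_nat 0 (\<lambda>_ t. 2 * c - t\<^sup>2)"
  have f0: "f 0 = 0" and fS: "\<And>n. f (Suc n) = 2 * c - (f n)\<^sup>2" by (simp_all add: f_def)
  have ev: "dv 1 (f n)" for n
  proof (induction n)
    case (Suc n)
    have "dv 1 ((f n)\<^sup>2)" using dv_mult[OF Suc Suc] by (auto simp: power2_eq_square intro: dv_mono)
    then show ?case unfolding fS using c by (intro dv_diff) auto
  qed (simp add: f0)
  have step: "dv (1 + int n) (f (Suc n) - f n)" for n
  proof (induction n)
    case 0 show ?case using ev[of 1] by (simp add: f0)
  next
    case (Suc n)
    have "f (Suc (Suc n)) - f (Suc n) = - ((f (Suc n) - f n) * (f (Suc n) + f n))"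
      by (subst fS[of "Suc n"], subst (2) fS[of n]) (simp add: algebra_simps power2_eq_square)
    then show ?case using dv_mult[OF Suc dv_add[OF ev[of "Suc n"] ev[of n]]] by (simp add: add.commute del: minus_diff_eq)
  qed
  have diff: "dv (1 + int n) (f (n + m) - f n)" for n m
  proof (induction m)
    case (Suc m)
    have "f (n + Suc m) - f n = (f (Suc (n + m)) - f (n + m)) + (f (n + m) - f n)" by simp
    moreover have "dv (1 + int n) (f (Suc (n + m)) - f (n + m))"
      using step[of "n + m"] by (rule dv_mono) simp
    ultimately show ?case using dv_add Suc by metis
  qed simp
  have diff': "dv (1 + int N) (f p - f q)" if "p \<ge> N" "q \<ge> N" for N p q
  proof -
    have "dv (1 + int N) ((f (N + (p - N)) - f N) - (f (N + (q - N)) - f N))"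
      by (intro dv_diff diff)
    then show ?thesis using that by simp
  qed
  have "\<exists>l. \<forall>M. \<exists>N. \<forall>p\<ge>N. dv M (f p - l)"
  proof (rule complete)
    fix M :: int
    show "\<exists>N. \<forall>p\<ge>N. \<forall>q\<ge>N. dv M (f p - f q)"
      using diff'[of "nat M"] by (intro exI[of _ "nat M"]) (force intro: dv_mono)
  qed
  then obtain l where l: "\<And>M. \<exists>N. \<forall>p\<ge>N. dv M (f p - l)" by blast
  have l1: "dv 1 l"
  proof -
    obtain p where "dv 1 (f p - l)" using l[of 1] by auto
    then show ?thesis using dv_diff[of 1 "f p" "f p - l"] ev by simp
  qed
  have "dv M (l\<^sup>2 + l - 2 * c)" for M
  proof -
    obtain N where N: "\<forall>p\<ge>N. dv (max M 0) (f p - l)" using l[of "max M 0"] by blast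
    let ?p = "Suc N"
    have a: "dv (max M 0) (f ?p - l)" "dv (max M 0) (f N - l)" using N by auto
    have b: "dv 0 (f N + l)" using dv_add[OF ev l1, of N] by (rule dv_mono) simp
    have "l\<^sup>2 + l - 2 * c = - (f N - l) * (f N + l) - (f ?p - l)"
      by (simp add: fS algebra_simps power2_eq_square)
    moreover have "dv (max M 0) (- (f N - l) * (f N + l) - (f ?p - l))"
      using dv_diff[OF dv_multL[OF _ b, of _ "- (f N - l)"] a(1)] a(2) by (simp only: dv_minus)
    ultimately have "dv (max M 0) (l\<^sup>2 + l - 2 * c)" by metis
    then show ?thesis by (rule dv_mono) simp
  qed
  then have "l\<^sup>2 + l - 2 * c = 0"
    unfolding dv_def by (metis less_add_one linorder_not_le)
  then show ?thesis using l1 by auto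
qed

text \<open>Looking for a root of the form \<open>1 + 2 * t\<close> turns the equation into
  \<open>t\<^sup>2 + t = 2 * c\<close>. Completeness of the field enters the development only
  through this local square theorem.\<close>

lemma square_1_mod_8:
  assumes "dv 3 (x - 1)" obtains y where "x = y\<^sup>2" "y \<noteq> 0" "val y = 0"
proof -
  define c where "c = (x - 1) / 8"
  have "8 * c = x - 1" by (simp add: c_def)
  then have x: "x = 1 + 8 * c" by simp
  have "dv 0 c" using assms dv_8[of 3 c] by (simp add: x)
  then obtain t where t: "dv 1 t" "t\<^sup>2 + t = 2 * c" using hensel_iter by blast
  have "x = 1 + 4 * (t\<^sup>2 + t)" unfolding t x by simp
  also have "\<dots> = (1 + 2 * t)\<^sup>2" by (simp add: algebra_simps power2_eq_square)
  finally show thesis using that odd_unit[of t] dv_mono[OF t(1)] by simp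
qed

end


section \<open>Sums of squares modulo powers of two, and square classes\<close>

context Q2_field
begin

lemma dv_r [simp]: "dv m (x * 2) \<longleftrightarrow> dv (m - 1) x" "dv m (x * 4) \<longleftrightarrow> dv (m - 2) x" "dv m (x * 8) \<longleftrightarrow> dv (m - 3) x"
  by (simp_all add: mult.commute[of x])

lemma odd_square: "dv 0 t \<Longrightarrow> dv 3 ((1 + 2 * t)\<^sup>2 - 1)"
proof -
  assume t: "dv 0 t"
  have "dv 1 (t * (1 + t))"
    using t
  proof (cases rule: dv_0_cases)
    case (1 s) then have "dv 1 t" by simp
    then show ?thesis using dv_multL[OF _ dv_add[OF dv_1 t]] by blast
  next
    case (2 s)
    then have "1 + t = 2 * (1 + s)" by simp
    then have "dv 1 (1 + t)" using 2 dv_add[of 0 1 s] by (simp only: dv_2) simp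
    then show ?thesis using dv_multR t by blast
  qed
  moreover have "(1 + 2 * t)\<^sup>2 - 1 = 4 * (t * (1 + t))" by (simp add: algebra_simps power2_eq_square)
  ultimately show ?thesis by simp
qed

lemma unit_square: "x \<noteq> 0 \<Longrightarrow> val x = 0 \<Longrightarrow> dv 3 (x\<^sup>2 - 1)"
  using odd_square unit_odd by metis

lemma odd_not_dv: "dv 0 x \<Longrightarrow> \<not> dv 1 x \<Longrightarrow> x \<noteq> 0 \<and> val x = 0"
  by (auto simp: dv_def)

lemma parity_square:
  assumes "dv 0 x"
  shows "dv 2 (x\<^sup>2 - (if dv 1 x then 0 else 1))"
  using dv_square[of 1 x] unit_square[of x] odd_not_dv[OF assms] dv_mono[of 3 _ 2] by auto

lemma val_3 [simp]: "val 3 = 0" using odd_unit[of 1] by simp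
lemma val_5 [simp]: "val 5 = 0" using odd_unit[of 2] by simp
lemma val_7 [simp]: "val 7 = 0" using odd_unit[of 3] by simp
lemma val_6 [simp]: "val 6 = 1" using val_mult[of 2 3] by simp
lemma val_10 [simp]: "val 10 = 1" using val_mult[of 2 5] by simp
lemma val_14 [simp]: "val 14 = 1" using val_mult[of 2 7] by simp

lemma dv_num: "dv m 1 \<longleftrightarrow> m \<le> 0" "dv m 2 \<longleftrightarrow> m \<le> 1" "dv m 3 \<longleftrightarrow> m \<le> 0" "dv m 4 \<longleftrightarrow> m \<le> 2" "dv m 8 \<longleftrightarrow> m \<le> 3"
  by (simp_all add: dv_def)

text \<open>Squares are 0 or 1 modulo 4 according to parity, so modulo 4 a sum of squares counts its
  odd terms. Sums of three squares are treated by putting zero into the fourth slot.\<close>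

lemma parity_sum:
  assumes "dv 0 a" "dv 0 b" "dv 0 c" "dv 0 d"
  shows "dv 2 (a\<^sup>2 + b\<^sup>2 + c\<^sup>2 + d\<^sup>2 - of_nat (length (filter (\<lambda>x. \<not> dv 1 x) [a, b, c, d])))"
proof -
  have "dv 2 ((a\<^sup>2 - (if dv 1 a then 0 else 1)) + (b\<^sup>2 - (if dv 1 b then 0 else 1))
     + (c\<^sup>2 - (if dv 1 c then 0 else 1)) + (d\<^sup>2 - (if dv 1 d then 0 else 1)))"
    by (intro dv_add parity_square assms)
  then show ?thesis by (simp split: if_splits add: algebra_simps)
qed

text \<open>Modulo 4 the number of odd terms is 0 or 4, and four odd squares add up to 4 modulo 8.
  This is the anisotropy of the quaternion norm in quantitative form.\<close>

lemma four_squares_even: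
  assumes i: "dv 0 a" "dv 0 b" "dv 0 c" "dv 0 d" and N: "dv 3 (a\<^sup>2 + b\<^sup>2 + c\<^sup>2 + d\<^sup>2)"
  shows "dv 1 a \<and> dv 1 b \<and> dv 1 c \<and> dv 1 d"
proof (rule ccontr)
  assume n: "\<not> ?thesis"
  define l where "l = length (filter (\<lambda>x. \<not> dv 1 x) [a, b, c, d])"
  have l: "l \<in> {1,2,3,4}" using n by (auto simp: l_def)
  have "dv 2 (of_nat l)"
    using dv_diff[OF dv_mono[OF N, of 2] parity_sum[OF i, folded l_def]] by simp
  then have "l = 4" using l by (auto simp: dv_num)
  then have "\<not> dv 1 a" "\<not> dv 1 b" "\<not> dv 1 c" "\<not> dv 1 d" by (auto simp: l_def split: if_splits)
  then have "dv 3 ((a\<^sup>2 - 1) + (b\<^sup>2 - 1) + (c\<^sup>2 - 1) + (d\<^sup>2 - 1))"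
    using i by (intro dv_add unit_square) (auto dest!: odd_not_dv)
  then have "dv 3 (a\<^sup>2 + b\<^sup>2 + c\<^sup>2 + d\<^sup>2 - 4)" by (simp add: algebra_simps)
  from dv_diff[OF N this] show False by (simp add: dv_num)
qed

lemma common_val:
  assumes "a \<noteq> 0 \<or> b \<noteq> 0 \<or> c \<noteq> 0 \<or> d \<noteq> 0"
  obtains e where "dv e a" "dv e b" "dv e c" "dv e d" "\<not> (dv (e+1) a \<and> dv (e+1) b \<and> dv (e+1) c \<and> dv (e+1) d)"
proof -
  define S where "S = val ` ({a, b, c, d} - {0})"
  have S: "finite S" "S \<noteq> {}" using assms by (auto simp: S_def)
  have "dv (Min S) x" if "x \<in> {a,b,c,d}" for x
    using Min_le[OF S(1), of "val x"] that unfolding S_def dv_def by blast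
  moreover obtain x where "x \<in> {a,b,c,d}" "x \<noteq> 0" "val x = Min S" using Min_in[OF S] unfolding S_def by force
  then have "\<exists>x\<in>{a,b,c,d}. \<not> dv (Min S + 1) x" by (intro bexI[of _ x]) (auto simp only: dv_def)
  ultimately show thesis using that[of "Min S"] by blast
qed

lemma dv_powi_scale: "dv m (2 powi e * x) \<longleftrightarrow> dv (m - e) x"
  using power_int_2_val[of e] by (simp add: dv_scale)

lemma powi_sq: "((2::'k) powi e)\<^sup>2 = 2 powi (2 * e)"
  using power_int_add[of "2::'k" e e] by (simp only: power2_eq_square mult_2) simp

text \<open>After division by the largest common power of two \<open>four_squares_even\<close>
  applies: the valuation of a sum of four squares exceeds twice the least valuation of its terms by
  at most two.\<close>

lemma four_squares_bound:
  assumes "\<not> (dv (e+1) a \<and> dv (e+1) b \<and> dv (e+1) c \<and> dv (e+1) d)"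
  shows "\<not> dv (2*e+3) (a\<^sup>2 + b\<^sup>2 + c\<^sup>2 + d\<^sup>2)"
proof
  assume N: "dv (2*e+3) (a\<^sup>2 + b\<^sup>2 + c\<^sup>2 + d\<^sup>2)"
  have "a \<noteq> 0 \<or> b \<noteq> 0 \<or> c \<noteq> 0 \<or> d \<noteq> 0" using assms by auto
  then obtain f where f: "dv f a" "dv f b" "dv f c" "dv f d"
    "\<not> (dv (f+1) a \<and> dv (f+1) b \<and> dv (f+1) c \<and> dv (f+1) d)" by (rule common_val)
  have "f \<le> e" 
  proof (rule ccontr)
    assume "\<not> f \<le> e"
    then have "e + 1 \<le> f" by simp
    then show False using assms f(1-4)[THEN dv_mono] by blast
  qed
  define s where "s = (\<lambda>x::'k. x / 2 powi f)"
  have sd: "dv m x \<longleftrightarrow> dv (m - f) (s x)" for m x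
    using dv_powi_scale[of m f "s x"] by (simp add: s_def)
  have sq: "2 powi (2*f) * (s x)\<^sup>2 = x\<^sup>2" for x
    unfolding s_def power_divide powi_sq
    by (rule trans[OF times_divide_eq_right], rule nonzero_mult_div_cancel_left, rule power_int_2_val(2))
  have "dv (2*f+3) (a\<^sup>2 + b\<^sup>2 + c\<^sup>2 + d\<^sup>2)" using N by (rule dv_mono) (use \<open>f \<le> e\<close> in simp)
  also have "a\<^sup>2 + b\<^sup>2 + c\<^sup>2 + d\<^sup>2 = 2 powi (2*f) * ((s a)\<^sup>2 + (s b)\<^sup>2 + (s c)\<^sup>2 + (s d)\<^sup>2)"
    by (simp only: sq distrib_left)
  finally have "dv 3 ((s a)\<^sup>2 + (s b)\<^sup>2 + (s c)\<^sup>2 + (s d)\<^sup>2)" by (simp add: dv_powi_scale)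
  with four_squares_even[of "s a" "s b" "s c" "s d"] f show False
    using sd[of f a] sd[of f b] sd[of f c] sd[of f d] sd[of "f+1" a] sd[of "f+1" b] sd[of "f+1" c] sd[of "f+1" d] by simp
qed

lemma four_squares_0: "(a::'k)\<^sup>2 + b\<^sup>2 + c\<^sup>2 + d\<^sup>2 = 0 \<Longrightarrow> a = 0 \<and> b = 0 \<and> c = 0 \<and> d = 0"
proof (rule ccontr)
  assume S: "a\<^sup>2 + b\<^sup>2 + c\<^sup>2 + d\<^sup>2 = 0" and "\<not> (a = 0 \<and> b = 0 \<and> c = 0 \<and> d = 0)"
  then have "a \<noteq> 0 \<or> b \<noteq> 0 \<or> c \<noteq> 0 \<or> d \<noteq> 0" by blast
  then obtain e where "\<not> (dv (e+1) a \<and> dv (e+1) b \<and> dv (e+1) c \<and> dv (e+1) d)" by (rule common_val)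
  from four_squares_bound[OF this] show False unfolding S by simp
qed

lemma four_squares_dv: "dv (2*m) (a\<^sup>2 + b\<^sup>2 + c\<^sup>2 + d\<^sup>2) \<Longrightarrow> dv (m-1) a \<and> dv (m-1) b \<and> dv (m-1) c \<and> dv (m-1) d"
  proof -
  assume "dv (2*m) (a\<^sup>2 + b\<^sup>2 + c\<^sup>2 + d\<^sup>2)"
  then have "dv (2*(m-2)+3) (a\<^sup>2 + b\<^sup>2 + c\<^sup>2 + d\<^sup>2)" by (rule dv_mono) simp
  moreover have eq: "(m - 2) + 1 = m - 1" by simp
  ultimately show ?thesis using four_squares_bound[of "m - 2" a b c d, unfolded eq] by blast
qed

text \<open>One, two or three odd squares never add up to 0 modulo 4, so one factor of two less than
  for four squares already gives a contradiction.\<close>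

lemma three_squares_bound:
  assumes "\<not> (dv (e+1) a \<and> dv (e+1) b \<and> dv (e+1) c)"
  shows "\<not> dv (2*e+2) (a\<^sup>2 + b\<^sup>2 + c\<^sup>2)"
proof
  assume N: "dv (2*e+2) (a\<^sup>2 + b\<^sup>2 + c\<^sup>2)"
  have "a \<noteq> 0 \<or> b \<noteq> 0 \<or> c \<noteq> 0 \<or> (0::'k) \<noteq> 0" using assms by auto
  then obtain f where f: "dv f a" "dv f b" "dv f c"
    "\<not> (dv (f+1) a \<and> dv (f+1) b \<and> dv (f+1) c)" by (elim common_val) auto
  have "f \<le> e" 
  proof (rule ccontr)
    assume "\<not> f \<le> e"
    then have "e + 1 \<le> f" by simp
    then show False using assms f(1-3)[THEN dv_mono] by blast
  qed
  define s where "s = (\<lambda>x::'k. x / 2 powi f)"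
  have sd: "dv m x \<longleftrightarrow> dv (m - f) (s x)" for m x
    using dv_powi_scale[of m f "s x"] by (simp add: s_def)
  have sq: "2 powi (2*f) * (s x)\<^sup>2 = x\<^sup>2" for x
    unfolding s_def power_divide powi_sq
    by (rule trans[OF times_divide_eq_right], rule nonzero_mult_div_cancel_left, rule power_int_2_val(2))
  have "dv (2*f+2) (a\<^sup>2 + b\<^sup>2 + c\<^sup>2)" using N by (rule dv_mono) (use \<open>f \<le> e\<close> in simp)
  also have "a\<^sup>2 + b\<^sup>2 + c\<^sup>2 = 2 powi (2*f) * ((s a)\<^sup>2 + (s b)\<^sup>2 + (s c)\<^sup>2)"
    by (simp only: sq distrib_left)
  finally have 2: "dv 2 ((s a)\<^sup>2 + (s b)\<^sup>2 + (s c)\<^sup>2)" by (simp add: dv_powi_scale)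
  have ds: "dv 0 (s a)" "dv 0 (s b)" "dv 0 (s c)" "\<not> (dv 1 (s a) \<and> dv 1 (s b) \<and> dv 1 (s c))"
    using f sd[of f a] sd[of f b] sd[of f c] sd[of "f+1" a] sd[of "f+1" b] sd[of "f+1" c] by simp_all
  define l where "l = length (filter (\<lambda>x. \<not> dv 1 x) [s a, s b, s c, 0])"
  have l: "l \<in> {1,2,3}" using ds by (auto simp: l_def)
  have "dv 2 (of_nat l)"
    using dv_diff[OF 2 parity_sum[of "s a" "s b" "s c" 0, folded l_def, simplified]] ds by simp
  then show False using l by (auto simp: dv_num)
qed

lemma three_squares_dv: "dv (2*m) (a\<^sup>2 + b\<^sup>2 + c\<^sup>2) \<Longrightarrow> dv m a \<and> dv m b \<and> dv m c"
proof (rule ccontr)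
  assume N: "dv (2*m) (a\<^sup>2 + b\<^sup>2 + c\<^sup>2)" and n: "\<not> (dv m a \<and> dv m b \<and> dv m c)"
  have eq: "(m - 1) + 1 = m" "2 * (m - 1) + 2 = 2 * m" by simp_all
  show False using three_squares_bound[of "m - 1" a b c, unfolded eq] N n by blast
qed

text \<open>These are the norms of nonzero pure quaternions. Since \<open>- g\<close> is then not a
  square, \<open>x\<^sup>2 + g * y\<^sup>2\<close> is the norm form of a quadratic field.\<close>

definition sum3 :: "'k \<Rightarrow> bool" where
  "sum3 g \<longleftrightarrow> (\<exists>a b c. g = a\<^sup>2 + b\<^sup>2 + c\<^sup>2 \<and> g \<noteq> 0)"

lemma sum3_not_neg_square: "sum3 g \<Longrightarrow> g \<noteq> - (y\<^sup>2)"
proof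
  assume "sum3 g" "g = - (y\<^sup>2)"
  then obtain a b c where "- (y\<^sup>2) = a\<^sup>2 + b\<^sup>2 + c\<^sup>2" "a\<^sup>2 + b\<^sup>2 + c\<^sup>2 \<noteq> 0"
    unfolding sum3_def by metis
  then have "a\<^sup>2 + b\<^sup>2 + c\<^sup>2 + y\<^sup>2 = 0" by (metis add.left_inverse)
  from four_squares_0[OF this] show False using \<open>a\<^sup>2 + b\<^sup>2 + c\<^sup>2 \<noteq> 0\<close> by simp
qed

text \<open>The three squares making up \<open>g\<close> have a least valuation of at most half of
  \<open>val g\<close>, and \<open>r\<^sup>2\<close> is a fourth square. With \<open>g\<close> the
  norm of half of \<open>h s s\<close> this limits the valuation of every \<sigma> belonging to
  \<open>s\<close>. The two following lemmas improve the exponent for odd \<open>val g\<close> and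
  for unit part 1 modulo 4.\<close>

lemma sum3_bound: assumes "sum3 g" shows "\<not> dv (val g + 3) (r\<^sup>2 + g)"
proof
  assume N: "dv (val g + 3) (r\<^sup>2 + g)"
  obtain a b c where g: "g = a\<^sup>2 + b\<^sup>2 + c\<^sup>2" "g \<noteq> 0" using assms by (auto simp: sum3_def)
  then have "a \<noteq> 0 \<or> b \<noteq> 0 \<or> c \<noteq> 0 \<or> (0::'k) \<noteq> 0" by auto
  then obtain f where f: "dv f a" "dv f b" "dv f c"
    "\<not> (dv (f+1) a \<and> dv (f+1) b \<and> dv (f+1) c)" by (elim common_val) auto
  have "dv (2 * f) g" unfolding g using f by (intro dv_add) (auto simp: dv_square)
  then have "2 * f \<le> val g" using g by (simp add: dv_def)
  then have "dv (2*f+3) (r\<^sup>2 + g)" using N by (intro dv_mono[OF N]) simp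
  then have "dv (2*f+3) (a\<^sup>2 + b\<^sup>2 + c\<^sup>2 + r\<^sup>2)" by (simp add: g algebra_simps)
  then show False using four_squares_bound[of f a b c r] f by blast
qed

lemma sum3_bound_odd: assumes "g \<noteq> 0" "odd (val g)" shows "\<not> dv (val g + 1) (r\<^sup>2 + g)"
proof
  assume N: "dv (val g + 1) (r\<^sup>2 + g)"
  have "dv (val g) (r\<^sup>2)" using dv_diff[OF dv_mono[OF N, of "val g"], of g] by (simp add: dv_def)
  moreover have "\<not> dv (val g + 1) (r\<^sup>2)" using dv_diff[OF N, of "r\<^sup>2"] assms by (auto simp: dv_def)
  ultimately have "r \<noteq> 0" "val g = val (r\<^sup>2)" by (auto simp: dv_def)
  then show False using assms by (simp add: val_power)
qed

lemma sum3_bound_1mod4: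
  assumes g: "g = 2 powi (2*e) * u" "dv 2 (u - 1)"
  shows "\<not> dv (2*e+2) (r\<^sup>2 + g)"
proof
  assume N: "dv (2*e+2) (r\<^sup>2 + g)"
  define s where "s = r / 2 powi e"
  have "r\<^sup>2 + g = 2 powi (2*e) * (s\<^sup>2 + u)"
    by (simp add: g s_def power_divide powi_sq distrib_left)
  then have 2: "dv 2 (s\<^sup>2 + u)" using N by (simp add: dv_powi_scale)
  have "dv 2 ((s\<^sup>2 + u) - (u - 1))" by (rule dv_diff[OF 2 g(2)])
  then have 3: "dv 2 (s\<^sup>2 + 1)" by simp
  have "dv 0 (s\<^sup>2 + 1 - 1)" using dv_mono[OF 3, of 0] by (intro dv_diff) auto
  then have "dv 0 s" using dv_square[of 0 s] by simp
  from parity_square[OF this] 3 show False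
    using dv_diff[of 2 "s\<^sup>2 + 1" "s\<^sup>2"] dv_diff[of 2 "s\<^sup>2 + 1" "s\<^sup>2 - 1"] by (auto simp: dv_num split: if_splits)
qed

lemma unit_class:
  assumes "dv 0 t"
  obtains r y where "r \<in> {1,3,5,7}" "1 + 2 * t = r * y\<^sup>2" "y \<noteq> 0"
proof -
  have "\<exists>r\<in>{1,3,5,7}. dv 3 (1 + 2 * t - r)"
    using assms
  proof (cases rule: dv_0_cases)
    case (1 s)
    from 1(2) show ?thesis
    proof (cases rule: dv_0_cases)
      case (1 s') then show ?thesis using \<open>t = 2 * s\<close> by (intro bexI[of _ 1]) auto
    next
      case (2 s') then show ?thesis using \<open>t = 2 * s\<close> by (intro bexI[of _ 5]) (auto simp: algebra_simps)
    qed
  next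
    case (2 s)
    from 2(2) show ?thesis
    proof (cases rule: dv_0_cases)
      case (1 s') then show ?thesis using \<open>t = 1 + 2 * s\<close> by (intro bexI[of _ 3]) (auto simp: algebra_simps)
    next
      case (2 s') then show ?thesis using \<open>t = 1 + 2 * s\<close> by (intro bexI[of _ 7]) (auto simp: algebra_simps)
    qed
  qed
  then obtain r where r: "r \<in> {1,3,5,7}" "dv 3 (1 + 2 * t - r)" by blast
  then have r0: "r \<noteq> 0" "val r = 0" by auto
  have "(1 + 2 * t) / r - 1 = (1 + 2 * t - r) / r" using r0 by (simp add: field_simps)
  then have "dv 3 ((1 + 2 * t) / r - 1)"
    using r dv_scale[of "r" 3 "(1 + 2 * t - r) / r"] r0 by simp
  then obtain y where "(1 + 2 * t) / r = y\<^sup>2" "y \<noteq> 0" by (rule square_1_mod_8)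
  then have "1 + 2 * t = r * y\<^sup>2" using r0 by (simp add: field_simps)
  then show thesis using that r \<open>y \<noteq> 0\<close> by blast
qed

lemma square_class:
  fixes c :: 'k
  assumes "c \<noteq> 0"
  obtains r y where "r \<in> {1,3,5,7,2,6,10,14}" "c = r * y\<^sup>2" "y \<noteq> 0"
proof -
  obtain t where t: "c = 2 powi (val c) * (1 + 2 * t)" "dv 0 t" using unit_part[OF assms] .
  obtain r y where r: "r \<in> {1,3,5,7}" "1 + 2 * t = r * y\<^sup>2" "y \<noteq> 0" using unit_class[OF t(2)] .
  define m where "m = val c div 2"
  show thesis
  proof (cases "even (val c)")
    case True
    then have "c = r * (2 powi m * y)\<^sup>2"
      by (subst t) (simp add: r power_mult_distrib powi_sq m_def)
    then show thesis using that[of r "2 powi m * y"] r by auto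
  next
    case False
    then have "(2::'k) powi (val c) = 2 * 2 powi (2 * m)" by (simp add: m_def power_int_add flip: power_int_add_1')
    then have "c = (2 * r) * (2 powi m * y)\<^sup>2"
      by (subst t) (simp add: r power_mult_distrib powi_sq)
    then show thesis using that[of "2 * r" "2 powi m * y"] r by auto
  qed
qed

lemma neg1_class: obtains y where "(7::'k) = - (y\<^sup>2)" "y \<noteq> 0"
proof -
  have "dv 3 ((-7) - 1)" using dv_minus[of 3 8] by (simp add: dv_num)
  then show thesis using square_1_mod_8[of "-7"] that by (metis minus_minus)
qed

text \<open>Norm groups of quadratic fields have index two, so two different ones generate the whole
  group. This is checked on the eight representatives of the square classes.\<close>

lemma two_norm_groups:
  assumes mult: "\<And>x y. P x \<Longrightarrow> P y \<Longrightarrow> P (x * y)"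
    and sq: "\<And>x y. P x \<Longrightarrow> y \<noteq> 0 \<Longrightarrow> P (x * y\<^sup>2)"
    and c: "sum3 c1" "sum3 c2" "\<And>y. c1 * c2 \<noteq> y\<^sup>2"
    and P1: "\<And>x y. x\<^sup>2 + c1 * y\<^sup>2 \<noteq> 0 \<Longrightarrow> P (x\<^sup>2 + c1 * y\<^sup>2)"
    and P2: "\<And>x y. x\<^sup>2 + c2 * y\<^sup>2 \<noteq> 0 \<Longrightarrow> P (x\<^sup>2 + c2 * y\<^sup>2)"
    and z: "z \<noteq> 0"
  shows "P z"
proof -
  have P: "P 1" using P1[of 1 0] by simp
  \<comment> \<open>Numbers whose quotient is 1 modulo 8 have the same square class, so a
    represented value such as 11 or 15 may be exchanged for 3 or 7.\<close>
  have cong: "P r" if "P x" "dv (3 + val r) (x - r)" "r \<noteq> 0" for x r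
  proof -
    have "x / r - 1 = (x - r) / r" using that by (simp add: field_simps)
    then have "dv 3 (x / r - 1)" using dv_scale[of r "3 + val r" "(x - r) / r"] that by simp
    then obtain y where y: "x / r = y\<^sup>2" "y \<noteq> 0" by (rule square_1_mod_8)
    then have "x * (inverse y)\<^sup>2 = r" using that by (simp add: field_simps)
    then show ?thesis using sq[OF that(1), of "inverse y"] y by simp
  qed
  have cl: "P r" if "P x" "P y" "dv (3 + val r) (x * y - r)" "r \<noteq> 0" for x y r
    using cong[OF mult] that by blast
  have cl4: "P r" if "P x" "P y" "dv (3 + val r) (x * y / 4 - r)" "r \<noteq> 0" for x y r
    using cong[OF sq[OF mult[of x y], of "1/2"]] that by (simp add: power_divide)
  have n: "dv m 16 \<longleftrightarrow> m \<le> 4" "dv m 32 \<longleftrightarrow> m \<le> 5" "dv m 48 \<longleftrightarrow> m \<le> 4" "dv m 56 \<longleftrightarrow> m \<le> 3"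
    "dv m 64 \<longleftrightarrow> m \<le> 6" "dv m 96 \<longleftrightarrow> m \<le> 5" for m
    using dv_8[of m 2] dv_8[of m 4] dv_8[of m 6] dv_8[of m 7] dv_8[of m 8] dv_8[of m 12] dv_4[of "m - 3" 3]
    by (auto simp: dv_num dv_def)
  have form: "P (x\<^sup>2 + r * y\<^sup>2)" if "c = r * w\<^sup>2" "w \<noteq> 0" "\<And>x y. x\<^sup>2 + c * y\<^sup>2 \<noteq> 0 \<Longrightarrow> P (x\<^sup>2 + c * y\<^sup>2)"
     "x\<^sup>2 + r * y\<^sup>2 \<noteq> 0" for x y r c w
    using that(3)[of x "y / w"] that by (simp add: power_divide)
  \<comment> \<open>For each class \<open>r\<close> two values of
    \<open>x\<^sup>2 + r * y\<^sup>2\<close> are listed that generate its norm group modulo squares.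
    The class 7 is absent because 7 is minus a square.\<close>
  define gens where "gens (r::'k) \<longleftrightarrow> (r = 1 \<and> P 2 \<and> P 5) \<or> (r = 2 \<and> P 2 \<and> P 3) \<or> (r = 3 \<and> P 3 \<and> P 7)
     \<or> (r = 5 \<and> P 5 \<and> P 6) \<or> (r = 6 \<and> P 6 \<and> P 7) \<or> (r = 10 \<and> P 10 \<and> P 3) \<or> (r = 14 \<and> P 14 \<and> P 7)" for r
  have gen: "gens r" if r: "r \<in> {1,3,5,7,2,6,10,14}" "c = r * w\<^sup>2" "w \<noteq> 0" and s: "sum3 c"
    and Pc: "\<And>x y. x\<^sup>2 + c * y\<^sup>2 \<noteq> 0 \<Longrightarrow> P (x\<^sup>2 + c * y\<^sup>2)" for r c w
  proof -
    have 7: "r \<noteq> 7"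
    proof
      assume "r = 7"
      obtain y :: 'k where "7 = - (y\<^sup>2)" using neg1_class .
      then have "c = - ((y * w)\<^sup>2)" by (subst r(2), subst \<open>r = 7\<close>) (simp only: power_mult_distrib mult_minus_left)
      then show False using sum3_not_neg_square[OF s] by blast
    qed
    note f = form[OF r(2,3) Pc]
    consider "r = 1" | "r = 2" | "r = 3" | "r = 5" | "r = 6" | "r = 10" | "r = 14" using r(1) 7 by blast
    then show ?thesis
    proof cases
      case 1 then show ?thesis using f[of 1 1] f[of 1 2] by (simp add: gens_def)
    next
      case 2 then show ?thesis using f[of 1 1] f[of 0 1] by (simp add: gens_def)
    next
      case 3 then show ?thesis using f[of 0 1] f[of 2 1] by (simp add: gens_def)
    next
      case 4 then show ?thesis using f[of 0 1] f[of 1 1] by (simp add: gens_def)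
    next
      case 5 then show ?thesis using f[of 0 1] f[of 1 1] by (simp add: gens_def)
    next
      case 6 then show ?thesis using f[of 0 1] f[of 1 1] cong[of 11 3] by (simp add: gens_def dv_num)
    next
      case 7 then show ?thesis using f[of 0 1] f[of 1 1] cong[of 15 7] by (simp add: gens_def dv_num)
    qed
  qed
  obtain r1 w1 where r1: "r1 \<in> {1,3,5,7,2,6,10,14}" "c1 = r1 * w1\<^sup>2" "w1 \<noteq> 0"
    using square_class c(1) by (metis sum3_def)
  obtain r2 w2 where r2: "r2 \<in> {1,3,5,7,2,6,10,14}" "c2 = r2 * w2\<^sup>2" "w2 \<noteq> 0"
    using square_class c(2) by (metis sum3_def)
  have "r1 \<noteq> r2" using c(3)[of "r1 * w1 * w2"] r1 r2 by (auto simp: power_mult_distrib power2_eq_square)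
  have h3_5: "P 3 \<Longrightarrow> P 5 \<Longrightarrow> P 7" by (rule cl[of 3 5]) (simp_all add: dv_num n)
  have h3_7: "P 3 \<Longrightarrow> P 7 \<Longrightarrow> P 5" by (rule cl[of 3 7]) (simp_all add: dv_num n)
  have h5_7: "P 5 \<Longrightarrow> P 7 \<Longrightarrow> P 3" by (rule cl[of 5 7]) (simp_all add: dv_num n)
  have h2_3: "P 2 \<Longrightarrow> P 3 \<Longrightarrow> P 6" by (rule cl[of 2 3]) (simp_all add: dv_num n)
  have h2_5: "P 2 \<Longrightarrow> P 5 \<Longrightarrow> P 10" by (rule cl[of 2 5]) (simp_all add: dv_num n)
  have h2_7: "P 2 \<Longrightarrow> P 7 \<Longrightarrow> P 14" by (rule cl[of 2 7]) (simp_all add: dv_num n)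
  have h6_3: "P 6 \<Longrightarrow> P 3 \<Longrightarrow> P 2" by (rule cl[of 6 3]) (simp_all add: dv_num n)
  have h6_5: "P 6 \<Longrightarrow> P 5 \<Longrightarrow> P 14" by (rule cl[of 6 5]) (simp_all add: dv_num n)
  have h6_7: "P 6 \<Longrightarrow> P 7 \<Longrightarrow> P 10" by (rule cl[of 6 7]) (simp_all add: dv_num n)
  have h10_3: "P 10 \<Longrightarrow> P 3 \<Longrightarrow> P 14" by (rule cl[of 10 3]) (simp_all add: dv_num n)
  have h10_5: "P 10 \<Longrightarrow> P 5 \<Longrightarrow> P 2" by (rule cl[of 10 5]) (simp_all add: dv_num n)
  have h10_7: "P 10 \<Longrightarrow> P 7 \<Longrightarrow> P 6" by (rule cl[of 10 7]) (simp_all add: dv_num n)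
  have h14_3: "P 14 \<Longrightarrow> P 3 \<Longrightarrow> P 10" by (rule cl[of 14 3]) (simp_all add: dv_num n)
  have h14_5: "P 14 \<Longrightarrow> P 5 \<Longrightarrow> P 6" by (rule cl[of 14 5]) (simp_all add: dv_num n)
  have h14_7: "P 14 \<Longrightarrow> P 7 \<Longrightarrow> P 2" by (rule cl[of 14 7]) (simp_all add: dv_num n)
  have h2_6: "P 2 \<Longrightarrow> P 6 \<Longrightarrow> P 3" by (rule cl4[of 2 6]) (simp_all add: dv_num n)
  have h2_10: "P 2 \<Longrightarrow> P 10 \<Longrightarrow> P 5" by (rule cl4[of 2 10]) (simp_all add: dv_num n)
  have h2_14: "P 2 \<Longrightarrow> P 14 \<Longrightarrow> P 7" by (rule cl4[of 2 14]) (simp_all add: dv_num n)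
  have h6_10: "P 6 \<Longrightarrow> P 10 \<Longrightarrow> P 7" by (rule cl4[of 6 10]) (simp_all add: dv_num n)
  have h6_14: "P 6 \<Longrightarrow> P 14 \<Longrightarrow> P 5" by (rule cl4[of 6 14]) (simp_all add: dv_num n)
  have h10_14: "P 10 \<Longrightarrow> P 14 \<Longrightarrow> P 3" by (rule cl4[of 10 14]) (simp_all add: dv_num n)
  note h = h3_5 h3_7 h5_7 h2_3 h2_5 h2_7 h6_3 h6_5 h6_7 h10_3 h10_5 h10_7 h14_3 h14_5 h14_7 h2_6 h2_10 h2_14 h6_10 h6_14 h10_14
  have "gens r1" "gens r2" using gen[OF r1 c(1) P1] gen[OF r2 c(2) P2] by auto
  then have all: "P 3 \<and> P 5 \<and> P 7 \<and> P 2 \<and> P 6 \<and> P 10 \<and> P 14"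
    using \<open>r1 \<noteq> r2\<close> unfolding gens_def by (elim disjE conjE; metis h)
  obtain r y where "r \<in> {1,3,5,7,2,6,10,14}" "z = r * y\<^sup>2" "y \<noteq> 0" using square_class[OF z] .
  then show ?thesis using all P sq by auto
qed

end


section \<open>Quaternions\<close>

instantiation quat :: (field) ring_1
begin

definition "0 = (qzero :: 'a quat)"
definition "1 = (qof 1 :: 'a quat)"
definition "p + q = qadd p (q :: 'a quat)"
definition "- p = qneg (p :: 'a quat)"
definition "p - q = qsub p (q :: 'a quat)"
definition "p * q = qmul p (q :: 'a quat)"

lemmas quat_ring_defs = zero_quat_def one_quat_def plus_quat_def uminus_quat_def minus_quat_def
  times_quat_def qzero_def qof_def qsub_def

instance
proof
  fix a b c :: "'a quat"
  show "a + b + c = a + (b + c)" "a + b = b + a" "0 + a = a" "- a + a = 0" "a - b = a + - b"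
    "1 * a = a" "a * 1 = a" "0 \<noteq> (1 :: 'a quat)"
    by (cases a; cases b; cases c; simp add: quat_ring_defs)+
  show "a * b * c = a * (b * c)" "(a + b) * c = a * c + b * c" "a * (b + c) = a * b + a * c"
    by (cases a; cases b; cases c; simp add: quat_ring_defs algebra_simps)+
qed

end

lemma quat_folds:
  "qzero = (0 :: 'a::field quat)" "qof 1 = (1 :: 'a quat)" "qadd p q = p + (q :: 'a quat)"
  "qneg p = - (p :: 'a quat)" "qsub p q = p - (q :: 'a quat)" "qmul p q = p * (q :: 'a quat)"
  by (simp_all only: zero_quat_def one_quat_def plus_quat_def uminus_quat_def minus_quat_def times_quat_def)

lemma Quat_ops:
  "Quat a b c d + Quat a' b' c' d' = Quat (a+a') (b+b') (c+c') (d+d')"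
  "Quat a b c d - Quat a' b' c' d' = Quat (a-a') (b-b') (c-c') (d-d')"
  "- Quat a b c d = Quat (-a) (-b) (-c) (-d)"
  "Quat a b c d * Quat a' b' c' d' =
     Quat (a*a' - b*b' - c*c' - d*d') (a*b' + b*a' + c*d' - d*c')
          (a*c' - b*d' + c*a' + d*b') (a*d' + b*c' - c*b' + d*a')"
  "(0 :: 'a::field quat) = Quat 0 0 0 0" "(1 :: 'a quat) = Quat 1 0 0 0"
  for a :: "'a::field"
  by (simp_all add: quat_ring_defs)

lemma qconj_simps [simp]:
  "qconj (x + y) = qconj x + qconj y" "qconj (x - y) = qconj x - qconj y" "qconj (- x) = - qconj x"
  "qconj 0 = (0 :: 'a quat)" "qconj 1 = (1 :: 'a quat)" "qconj (qconj x) = x" "qconj (qof a) = qof a"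
  for x :: "'a::field quat"
  by (cases x; cases y; simp add: Quat_ops qof_def)+

lemma qconj_mult: "qconj (x * y) = qconj y * qconj x" for x :: "'a::field quat"
  by (cases x; cases y; simp add: Quat_ops algebra_simps)

lemma qnorm_simps [simp]:
  "qnorm (- x) = qnorm x" "qnorm 0 = (0 :: 'a)" "qnorm 1 = (1 :: 'a)" "qnorm (qconj x) = qnorm x"
  "qnorm (qof a) = a\<^sup>2" for x :: "'a::field quat"
  by (cases x; simp add: Quat_ops qof_def)+

lemma qnorm_mult: "qnorm (x * y) = qnorm x * qnorm y" for x :: "'a::field quat"
  by (cases x; cases y; simp add: Quat_ops power2_eq_square algebra_simps)

lemma qof_simps: "qof (a + b) = qof a + qof b" "qof (a - b) = qof a - qof b" "qof (- a) = - qof a"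
  "qof (a * b) = qof a * qof b" "qof 0 = 0" "qof 1 = 1"
  by (simp_all add: Quat_ops qof_def)

lemma qof_inject [simp]: "qof a = qof b \<longleftrightarrow> a = b" by (simp add: qof_def)

lemma qof_eq_0 [simp]: "qof a = 0 \<longleftrightarrow> a = 0" by (simp add: Quat_ops qof_def)

lemma qof_commute: "x * qof a = qof a * x" for x :: "'a::field quat"
  by (cases x; simp add: Quat_ops qof_def algebra_simps)

lemma qof_mult_Quat: "qof s * Quat a b c d = Quat (s*a) (s*b) (s*c) (s*d)"
  by (simp add: Quat_ops qof_def)

lemma qconj_mult_self: "x * qconj x = qof (qnorm x)" "qconj x * x = qof (qnorm x)" for x :: "'a::field quat"
  by (cases x; simp add: Quat_ops qof_def power2_eq_square algebra_simps)+

fun qre :: "'a quat \<Rightarrow> 'a" where "qre (Quat a b c d) = a"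

lemma qre_qof_mult [simp]: "qre (qof s * x) = s * qre x"
  by (cases x; simp add: Quat_ops qof_def)

lemma qnorm_add: "qnorm (x + y) = qnorm x + qnorm y + 2 * qre (x * qconj y)" for x :: "'a::field quat"
  by (cases x; cases y; simp add: Quat_ops power2_eq_square algebra_simps)

lemma qnorm_qof_add: "qnorm (qof r + x) = r\<^sup>2 + 2 * r * qre x + qnorm x"
  by (cases x; simp add: Quat_ops qof_def power2_eq_square algebra_simps)

definition pure :: "'a::field quat \<Rightarrow> bool" where "pure x \<longleftrightarrow> qconj x = - x"

lemma pure_iff: "pure x \<longleftrightarrow> qre x = 0" for x :: "'a::field_char_0 quat"
  by (cases x) (auto simp: pure_def Quat_ops)

lemma pureE:
  assumes "pure (x :: 'a::field_char_0 quat)" obtains p q r where "x = Quat 0 p q r"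
  using assms by (cases x) (auto simp: pure_iff)

lemma pure_conj: "pure a \<Longrightarrow> pure (c * a * qconj c)"
  by (simp add: pure_def qconj_mult mult.assoc)

lemma pure_add: "pure a \<Longrightarrow> pure b \<Longrightarrow> pure (a + b)" by (simp add: pure_def)
lemma pure_diff: "pure a \<Longrightarrow> pure b \<Longrightarrow> pure (a - b)" by (simp add: pure_def)

lemma hermitian_scalar: "x = qconj x \<Longrightarrow> x = qof (qre x)" for x :: "'a::field_char_0 quat"
  by (cases x) (auto simp: qof_def)

section \<open>The division algebra and its valuation\<close>

context Q2_field
begin

lemma qnorm_eq_0 [simp]: "qnorm x = 0 \<longleftrightarrow> x = (0 :: 'k quat)"
  by (cases x) (auto simp: Quat_ops dest: four_squares_0)

lemma quat_mult_eq_0 [simp]: "x * y = 0 \<longleftrightarrow> x = 0 \<or> y = (0 :: 'k quat)"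
  using qnorm_eq_0[of "x * y"] by (simp add: qnorm_mult del: qnorm_eq_0) simp

lemma qinv_def': "qinv x = qof (inverse (qnorm x)) * qconj x"
  by (simp add: qinv_def quat_folds)

lemma qinv_0 [simp]: "qinv (0 :: 'k quat) = 0"
  unfolding qinv_def' by simp

lemma qinv_left: "x \<noteq> 0 \<Longrightarrow> qinv x * x = (1 :: 'k quat)"
  by (simp add: qinv_def' mult.assoc qconj_mult_self flip: qof_simps)

lemma qinv_right: "x \<noteq> 0 \<Longrightarrow> x * qinv x = (1 :: 'k quat)"
  unfolding qinv_def' mult.assoc[symmetric] qof_commute
  by (simp add: mult.assoc qconj_mult_self flip: qof_simps)

lemma qinv_cancel [simp]:
  "x \<noteq> 0 \<Longrightarrow> qinv x * (x * y) = y" "x \<noteq> 0 \<Longrightarrow> x * (qinv x * y) = (y :: 'k quat)"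
  by (simp_all add: qinv_left qinv_right flip: mult.assoc)

lemma qinv_eq_0 [simp]: "qinv x = 0 \<longleftrightarrow> x = (0 :: 'k quat)"
  using qinv_left[of x] by fastforce

lemma qinv_unique: "x * y = 1 \<Longrightarrow> qinv x = (y :: 'k quat)"
  by (metis mult.right_neutral mult_zero_left qinv_cancel(1) zero_neq_one)

lemma qinv_minus: "qinv (- x) = - qinv (x :: 'k quat)"
  by (cases "x = 0") (auto intro: qinv_unique simp: qinv_right)

lemma qconj_eq_0 [simp]: "qconj x = 0 \<longleftrightarrow> x = (0 :: 'k quat)"
  by (metis qconj_simps(4,6))

lemma qnorm_qinv: "qnorm (qinv x) = inverse (qnorm (x :: 'k quat))"
proof (cases "x = 0")
  case False
  have "qnorm (x * qinv x) = 1" using False by (simp add: qinv_right)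
  then show ?thesis using False by (simp add: qnorm_mult field_simps)
qed simp

text \<open>Membership in the \<open>m\<close>-th power of the maximal ideal of the maximal order,
  zero included; negative \<open>m\<close> gives fractional ideals.\<close>

definition qdv :: "int \<Rightarrow> 'k quat \<Rightarrow> bool" where
  "qdv m x \<longleftrightarrow> dv m (qnorm x)"

lemma OD_iff: "x \<in> OD val \<longleftrightarrow> qdv 0 x"
  by (simp add: OD_def qdv_def dv_def quat_folds)

lemma qdv_0 [simp]: "qdv m 0" by (simp add: qdv_def)

lemma qdv_iff: "x \<noteq> 0 \<Longrightarrow> qdv m x \<longleftrightarrow> m \<le> qnu val x"
  by (simp add: qdv_def dv_def qnu_def)

lemma qdv_minus [simp]: "qdv m (- x) = qdv m x" by (simp add: qdv_def)
lemma qdv_qconj [simp]: "qdv m (qconj x) = qdv m x" by (simp add: qdv_def)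

lemma qdv_mult: "qdv m x \<Longrightarrow> qdv n y \<Longrightarrow> qdv (m + n) (x * y)"
  by (simp add: qdv_def qnorm_mult dv_mult)

lemma qdv_mono: "qdv m x \<Longrightarrow> n \<le> m \<Longrightarrow> qdv n x"
  unfolding qdv_def by (rule dv_mono)

lemma qdv_re: "qdv (2 * m) x \<Longrightarrow> dv (m - 1) (qre x)"
  by (cases x) (auto simp: qdv_def dest: four_squares_dv)

text \<open>The norm of a sum has the cross term twice the real part of \<open>x * qconj y\<close>.
  Four squares lose at most one factor of two in passing from the norm to a coordinate, and the
  factor 2 restores it.\<close>

lemma qdv_add: assumes "qdv m x" "qdv m y" shows "qdv m (x + y)"
proof -
  have "qdv (2 * m) (x * qconj y)" using qdv_mult[of m x m "qconj y"] assms by simp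
  then have "dv m (2 * qre (x * qconj y))" using qdv_re by simp
  then show ?thesis using assms unfolding qdv_def qnorm_add by (intro dv_add)
qed

lemma qdv_diff: "qdv m x \<Longrightarrow> qdv m y \<Longrightarrow> qdv m (x - y)"
  using qdv_add[of m x "- y"] by simp

lemma qdv_sum: "(\<And>i. i \<in> A \<Longrightarrow> qdv m (f i)) \<Longrightarrow> qdv m (sum f A)"
  by (induction A rule: infinite_finite_induct) (auto intro: qdv_add)

lemma qdv_mult0: "qdv 0 x \<Longrightarrow> qdv 0 y \<Longrightarrow> qdv 0 (x * y)"
  using qdv_mult[of 0 x 0 y] by simp

lemma qdv_1 [simp]: "qdv 0 1" by (simp add: qdv_def)

lemma qdv_qinv: "x \<noteq> 0 \<Longrightarrow> qdv m (y * qinv x) \<longleftrightarrow> qdv (m + qnu val x) y"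
  by (cases "y = 0") (simp_all add: qdv_def qnorm_mult qnorm_qinv dv_def val_mult val_inverse qnu_def le_diff_eq)

lemma qdv_qinvL: "x \<noteq> 0 \<Longrightarrow> qdv m (qinv x * y) \<longleftrightarrow> qdv (m + qnu val x) y"
  by (cases "y = 0") (simp_all add: qdv_def qnorm_mult qnorm_qinv dv_def val_mult val_inverse qnu_def le_diff_eq)

lemma qnu_mult: "x \<noteq> 0 \<Longrightarrow> y \<noteq> 0 \<Longrightarrow> qnu val (x * y) = qnu val x + qnu val y"
  by (simp add: qnu_def qnorm_mult val_mult)

lemma qnu_minus [simp]: "qnu val (- x) = qnu val x" "qnu val (qconj x) = qnu val x"
  by (simp_all add: qnu_def)

lemma pure_dv: "qdv (2 * m) (Quat 0 p q r) \<Longrightarrow> dv m p \<and> dv m q \<and> dv m r"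
  using three_squares_dv[of m p q r] by (simp add: qdv_def)

lemma pure_sum3: "pure a \<Longrightarrow> a \<noteq> 0 \<Longrightarrow> sum3 (qnorm a)"
proof (erule pureE)
  fix p q r assume "a \<noteq> 0" "a = Quat 0 p q r"
  then show "sum3 (qnorm a)" using four_squares_0[of p q r 0] by (auto simp: sum3_def Quat_ops)
qed

lemma not_qdv_iff: "\<not> qdv (m + 1) x \<longleftrightarrow> x \<noteq> 0 \<and> qnu val x \<le> m"
  by (cases "x = 0") (auto simp: qdv_iff)

end


section \<open>Skew-hermitian spaces and simple rotations\<close>

text \<open>With these rules active, the simplifier turns eta-expanded vector equations into pointwise ones.\<close>

lemmas vec_apply = plus_fun_apply zero_fun_apply minus_apply uminus_apply
declare vec_apply [simp del]

lemma vec_folds: "vzero = (0 :: 'k::field vec)" "vadd x y = x + (y :: 'k vec)" "vsum xs = sum_list (xs :: 'k vec list)"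
proof -
  show *: "vzero = (0 :: 'k::field vec)" "vadd x y = x + y" for x y :: "'k vec"
    by (auto simp: vzero_def vadd_def quat_folds fun_eq_iff vec_apply)
  show "vsum xs = sum_list xs"
    by (induction xs) (simp_all add: vsum_def *)
qed

lemma smul_apply: "smul c x i = c * x i" for x :: "'k::field vec"
  by (simp add: smul_def quat_folds)

lemma smul_simps:
  "smul c (x + y) = smul c x + smul c y" "smul c (x - y) = smul c x - smul c y"
  "smul (c + d) x = smul c x + smul d x" "smul (c - d) x = smul c x - smul d x"
  "smul (- c) x = - smul c x" "smul c (- x) = - smul c x"
  "smul 1 x = x" "smul 0 x = 0" "smul c 0 = 0"
  for x :: "'k::field vec"
  by (auto simp: fun_eq_iff smul_apply vec_apply algebra_simps)

lemma smul_smul: "smul c (smul d x) = smul (c * d) x" for x :: "'k::field vec"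
  by (auto simp: fun_eq_iff smul_apply mult.assoc)

lemma smul_sum: "smul c (sum f A) = (\<Sum>i\<in>A. smul c (f i))" for f :: "_ \<Rightarrow> 'k::field vec"
  by (induction A rule: infinite_finite_induct)
    (simp_all add: smul_simps)

lemma sum_smul: "smul (sum f A) x = (\<Sum>i\<in>A. smul (f i) x)" for x :: "'k::field vec"
  by (induction A rule: infinite_finite_induct)
    (simp_all add: smul_simps)

lemma sum_vec_apply: "sum f A i = (\<Sum>j\<in>A. f j i)" for f :: "_ \<Rightarrow> 'k::field vec"
  by (induction A rule: infinite_finite_induct) (simp_all add: vec_apply)

lemma inV_simps [simp]:
  "inV n (0 :: 'k::field vec)" "inV n x \<Longrightarrow> inV n y \<Longrightarrow> inV n (x + y)"
  "inV n x \<Longrightarrow> inV n y \<Longrightarrow> inV n (x - y)" "inV n x \<Longrightarrow> inV n (smul c x)" "inV n x \<Longrightarrow> inV n (- x)"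
  for x y :: "'k::field vec"
  by (simp_all add: inV_def quat_folds smul_apply vec_apply)

lemma inV_sum: "(\<And>i. i \<in> A \<Longrightarrow> inV n (f i)) \<Longrightarrow> inV n (sum f A)"
  by (induction A rule: infinite_finite_induct) auto

lemma qsum_upt: "qsum [0..<n] f = (\<Sum>i<n. f i)" for f :: "nat \<Rightarrow> 'k::field quat"
proof -
  have "qsum xs f = sum_list (map f xs)" for xs
    by (induction xs) (simp_all add: qsum_def quat_folds)
  then show ?thesis by (simp add: interv_sum_list_conv_sum_set_nat lessThan_atLeast0)
qed

lemma qconj_sum: "qconj (sum f A) = (\<Sum>i\<in>A. qconj (f i))" for f :: "_ \<Rightarrow> 'k::field quat"
  by (induction A rule: infinite_finite_induct) simp_all

lemma hform_eq: "hform n Hm x y = (\<Sum>i<n. \<Sum>j<n. x i * Hm i j * qconj (y j))" for x :: "'k::field vec"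
  by (simp add: hform_def qsum_upt quat_folds)

lemma hform_linear:
  "hform n Hm (x + x') y = hform n Hm x y + hform n Hm x' y"
  "hform n Hm (x - x') y = hform n Hm x y - hform n Hm x' y"
  "hform n Hm x (y + y') = hform n Hm x y + hform n Hm x y'"
  "hform n Hm x (y - y') = hform n Hm x y - hform n Hm x y'"
  "hform n Hm (smul c x) y = c * hform n Hm x y"
  "hform n Hm x (smul c y) = hform n Hm x y * qconj c"
  "hform n Hm 0 y = 0" "hform n Hm x 0 = 0"
  for x y :: "'k::field vec"
  by (simp_all add: hform_eq smul_apply vec_apply algebra_simps sum.distrib sum_subtractf sum_distrib_left sum_distrib_right qconj_mult)

lemma hform_sum:
  "hform n Hm (sum f A) y = (\<Sum>i\<in>A. hform n Hm (f i) y)"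
  "hform n Hm x (sum g A) = (\<Sum>i\<in>A. hform n Hm x (g i))"
  for x y :: "'k::field vec"
  by (induction A rule: infinite_finite_induct) (simp_all add: hform_linear)

definition uvec :: "nat \<Rightarrow> 'k::field vec" where "uvec i = (\<lambda>j. if j = i then 1 else 0)"

lemma inV_uvec [simp]: "i < n \<Longrightarrow> inV n (uvec i)"
  by (auto simp: inV_def uvec_def quat_folds)

lemma uvec_expand: "inV n x \<Longrightarrow> x = (\<Sum>i<n. smul (x i) (uvec i))"
  by (rule ext) (simp add: sum_vec_apply smul_apply uvec_def inV_def quat_folds if_distrib cong: if_cong)

definition spin :: "('k::field vec \<times> 'k quat) list \<Rightarrow> 'k" where
  "spin rs = prod_list (map (\<lambda>(s, \<sigma>). qnorm \<sigma>) rs)"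

lemma spin_simps [simp]: "spin [] = 1" "spin ((s, \<sigma>) # rs) = qnorm \<sigma> * spin rs" "spin (rs @ rs') = spin rs * spin rs'"
  by (simp_all add: spin_def)

text \<open>The inverse of the rotation with parameter \<sigma> is the rotation along the same
  vector with parameter \<open>- qconj \<sigma>\<close>, which has the same norm.\<close>

definition inv_word :: "('k::field vec \<times> 'k quat) list \<Rightarrow> ('k vec \<times> 'k quat) list" where
  "inv_word rs = rev (map (\<lambda>(s, \<sigma>). (s, - qconj \<sigma>)) rs)"

lemma spin_inv_word [simp]: "spin (inv_word rs) = spin rs"
  by (induction rs) (auto simp: inv_word_def)

lemma comp_rots_simps [simp]:
  "comp_rots n Hm [] x = x" "comp_rots n Hm ((s, \<sigma>) # rs) x = rot n Hm s \<sigma> (comp_rots n Hm rs x)"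
  by (simp_all add: comp_rots_def)

lemma comp_rots_append [simp]: "comp_rots n Hm (rs @ rs') x = comp_rots n Hm rs (comp_rots n Hm rs' x)"
  by (induction rs) auto

section \<open>Isometries and simple rotations of a skew-hermitian space\<close>

locale skew_space = Q2_field val for val :: "'k::field_char_0 \<Rightarrow> int" +
  fixes n :: nat and Hm :: "nat \<Rightarrow> nat \<Rightarrow> 'k quat"
  assumes skew: "skew_herm n Hm" and nondeg: "nondeg n Hm"
begin

abbreviation h :: "'k vec \<Rightarrow> 'k vec \<Rightarrow> 'k quat" where "h \<equiv> hform n Hm"
abbreviation V :: "'k vec \<Rightarrow> bool" where "V \<equiv> inV n"

lemma h_skew: "h y x = - qconj (h x y)"
proof -
  have "- qconj (x i * Hm i j * qconj (y j)) = y j * Hm j i * qconj (x i)" if "i < n" "j < n" for i j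
  proof -
    have "Hm j i = - qconj (Hm i j)"
      using skew that unfolding skew_herm_def quat_folds by blast
    then show ?thesis by (simp add: qconj_mult mult.assoc)
  qed
  then have "- qconj (h x y) = (\<Sum>i<n. \<Sum>j<n. y j * Hm j i * qconj (x i))"
    unfolding hform_eq qconj_sum sum_negf[symmetric] by (intro sum.cong) auto
  also have "\<dots> = h y x" unfolding hform_eq by (rule sum.swap)
  finally show ?thesis by simp
qed

lemma h_qconj: "qconj (h x y) = - h y x" using h_skew[of y x] by simp

lemma pure_h [simp]: "pure (h x x)" by (simp add: pure_def h_qconj)

lemma h_zero_sym: "h x y = 0 \<Longrightarrow> h y x = 0" using h_skew[of y x] by simp

lemma nondeg': "V x \<Longrightarrow> (\<And>y. V y \<Longrightarrow> h x y = 0) \<Longrightarrow> x = 0"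
  using nondeg unfolding nondeg_def by (simp add: quat_folds vec_folds)

lemma rot_eq: "rot n Hm s \<sigma> x = x - smul (h x s * qinv \<sigma>) s"
  by (simp add: rot_def quat_folds fun_eq_iff smul_apply vec_apply)

lemma valid_rot_iff: "valid_rot n Hm (s, \<sigma>) \<longleftrightarrow> V s \<and> \<sigma> \<noteq> 0 \<and> \<sigma> - qconj \<sigma> = h s s"
  by (simp add: valid_rot_def quat_folds)

text \<open>The identities are imposed on all sequences, not only on those supported below
  \<open>n\<close>, because the formula for \<open>rot\<close> satisfies them everywhere; the last
  clause alone refers to the space.\<close>

definition isom :: "('k vec \<Rightarrow> 'k vec) \<Rightarrow> bool" where
  "isom f \<longleftrightarrow> (\<forall>x y. f (x + y) = f x + f y) \<and> (\<forall>c x. f (smul c x) = smul c (f x)) \<and>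
     (\<forall>x y. h (f x) (f y) = h x y) \<and> (\<forall>x. V x \<longrightarrow> V (f x))"

lemma isomD:
  assumes "isom f"
  shows "f (x + y) = f x + f y" "f (smul c x) = smul c (f x)" "h (f x) (f y) = h x y" "V x \<Longrightarrow> V (f x)"
    "f (x - y) = f x - f y" "f 0 = 0"
proof -
  show *: "f (x + y) = f x + f y" "f (smul c x) = smul c (f x)" "h (f x) (f y) = h x y" "V x \<Longrightarrow> V (f x)" for x y c
    using assms by (auto simp: isom_def)
  show "f (x - y) = f x - f y" using *(1)[of "x - y" y] by (simp add: algebra_simps)
  show "f 0 = 0" using *(2)[of 0 0] by (simp add: smul_simps)
qed

lemma isom_sum: "isom f \<Longrightarrow> f (sum g A) = (\<Sum>i\<in>A. f (g i))"
  by (induction A rule: infinite_finite_induct)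
    (simp_all add: isomD)

lemma isom_comp: "isom f \<Longrightarrow> isom g \<Longrightarrow> isom (\<lambda>x. f (g x))"
  by (simp add: isom_def)

lemma isom_inj: "isom f \<Longrightarrow> V x \<Longrightarrow> f x = 0 \<Longrightarrow> x = 0"
  by (rule nondeg') (metis isomD(3) hform_linear(7))+

lemma rot_isom:
  assumes "valid_rot n Hm (s, \<sigma>)"
  shows "isom (rot n Hm s \<sigma>)"
proof -
  have s: "V s" "\<sigma> \<noteq> 0" "h s s = \<sigma> - qconj \<sigma>" using assms by (auto simp: valid_rot_iff)
  have "h (rot n Hm s \<sigma> x) (rot n Hm s \<sigma> y) = h x y" for x y
  proof -
    have v: "qconj (h y s * qinv \<sigma>) = - (qconj (qinv \<sigma>) * h s y)" by (simp add: qconj_mult h_qconj)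
    \<comment> \<open>Here the condition on \<open>h s s\<close> enters: the quadratic term of
      \<open>h\<close> on the two images cancels the two linear ones.\<close>
    have "qinv \<sigma> * (\<sigma> - qconj \<sigma>) * qconj (qinv \<sigma>) = qconj (qinv \<sigma>) - qinv \<sigma>"
      using s by (simp add: right_diff_distrib left_diff_distrib qinv_left mult.assoc flip: qconj_mult)
    then have "h x s * (qinv \<sigma> * (\<sigma> - qconj \<sigma>) * qconj (qinv \<sigma>)) * h s y
      = h x s * (qconj (qinv \<sigma>) - qinv \<sigma>) * h s y" by simp
    then show ?thesis
      unfolding rot_eq hform_linear v s(3) by (simp add: algebra_simps)
  qed
  moreover have "rot n Hm s \<sigma> (x + y) = rot n Hm s \<sigma> x + rot n Hm s \<sigma> y"
    "rot n Hm s \<sigma> (smul c x) = smul c (rot n Hm s \<sigma> x)" "V x \<Longrightarrow> V (rot n Hm s \<sigma> x)" for x y c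
    using s unfolding rot_eq by (simp_all add: hform_linear smul_simps smul_smul algebra_simps)
  ultimately show ?thesis unfolding isom_def by blast
qed

lemma valid_rot_inverse: "valid_rot n Hm (s, \<sigma>) \<Longrightarrow> valid_rot n Hm (s, - qconj \<sigma>)"
  by (simp add: valid_rot_iff)

lemma rot_inverse:
  assumes "valid_rot n Hm (s, \<sigma>)"
  shows "rot n Hm s (- qconj \<sigma>) (rot n Hm s \<sigma> x) = x"
proof -
  have s: "V s" "\<sigma> \<noteq> 0" "h s s = \<sigma> - qconj \<sigma>" using assms by (auto simp: valid_rot_iff)
  have "qinv \<sigma> * (\<sigma> - qconj \<sigma>) * qinv (qconj \<sigma>) = qinv (qconj \<sigma>) - qinv \<sigma>"
    using s by (simp add: right_diff_distrib left_diff_distrib qinv_left qinv_right mult.assoc)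
  then have "h x s * (qinv \<sigma> * (\<sigma> - qconj \<sigma>) * qinv (qconj \<sigma>)) = h x s * (qinv (qconj \<sigma>) - qinv \<sigma>)"
    by simp
  then have "h x s * qinv \<sigma> + (h x s - h x s * qinv \<sigma> * h s s) * qinv (- qconj \<sigma>) = 0"
    by (simp add: qinv_minus s(3) algebra_simps)
  then have "smul (h x s * qinv \<sigma> + (h x s - h x s * qinv \<sigma> * h s s) * qinv (- qconj \<sigma>)) s = 0"
    by (simp add: smul_simps)
  then show ?thesis unfolding rot_eq hform_linear smul_simps by (simp add: algebra_simps)
qed

lemma rot_inverse':
  "valid_rot n Hm (s, \<sigma>) \<Longrightarrow> rot n Hm s \<sigma> (rot n Hm s (- qconj \<sigma>) x) = x"
  using rot_inverse[of s "- qconj \<sigma>" x] valid_rot_inverse[of s \<sigma>] by simp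

abbreviation valid_word :: "('k vec \<times> 'k quat) list \<Rightarrow> bool" where
  "valid_word rs \<equiv> \<forall>p\<in>set rs. valid_rot n Hm p"

lemma comp_rots_isom: "valid_word rs \<Longrightarrow> isom (comp_rots n Hm rs)"
proof (induction rs)
  case Nil then show ?case by (simp add: isom_def)
next
  case (Cons p rs)
  then show ?case using isom_comp[OF rot_isom, of "fst p" "snd p" "comp_rots n Hm rs"]
    by (cases p) (simp add: comp_rots_def o_def)
qed

lemma valid_inv_word: "valid_word rs \<Longrightarrow> valid_word (inv_word rs)"
  by (auto simp: inv_word_def dest: valid_rot_inverse)

lemma comp_inv_word:
  "valid_word rs \<Longrightarrow> comp_rots n Hm (inv_word rs) (comp_rots n Hm rs x) = x"
  by (induction rs arbitrary: x) (auto simp: inv_word_def rot_inverse)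

lemma spin_nonzero: "valid_word rs \<Longrightarrow> spin rs \<noteq> 0"
  by (induction rs) (auto simp: valid_rot_iff)

end


section \<open>The spinor norm is well defined\<close>

context skew_space
begin

text \<open>Gaussian elimination by induction on the dimension: a pivot \<open>p\<close> with
  nonzero last coordinate clears that coordinate in the other vectors. Scalars act from the left, so
  the multipliers \<open>r i\<close> are quotients taken in that order.\<close>

lemma linear_dependence:
  fixes v :: "nat \<Rightarrow> 'k vec"
  assumes "finite S" "m < card S" "\<And>i. i \<in> S \<Longrightarrow> inV m (v i)"
  shows "\<exists>c. (\<exists>i\<in>S. c i \<noteq> 0) \<and> (\<Sum>i\<in>S. smul (c i) (v i)) = 0"
  using assms
proof (induction m arbitrary: S v)
  case 0
  then obtain i where "i \<in> S" by fastforce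
  moreover have "v i = 0" if "i \<in> S" for i using 0(3)[OF that] by (auto simp: inV_def quat_folds fun_eq_iff vec_apply)
  ultimately show ?case by (intro exI[of _ "\<lambda>_. 1"]) (auto simp: smul_simps)
next
  case (Suc m)
  show ?case
  proof (cases "\<forall>i\<in>S. v i m = 0")
    case True
    have "inV m (v i)" if "i \<in> S" for i
      using Suc.prems(3)[OF that] True that unfolding inV_def quat_folds by (metis le_antisym not_less_eq_eq)
    then show ?thesis using Suc.IH[of S v] Suc.prems by simp
  next
    case False
    then obtain p where p: "p \<in> S" "v p m \<noteq> 0" by blast
    define r where "r i = v i m * qinv (v p m)" for i
    define w where "w i = v i - smul (r i) (v p)" for i
    have "inV m (w i)" if "i \<in> S - {p}" for i
    proof -
      have "w i m = 0" using p by (simp add: w_def r_def smul_apply vec_apply mult.assoc qinv_left)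
      moreover have "inV (Suc m) (w i)" using Suc.prems(3) that p(1) unfolding w_def by simp
      ultimately show ?thesis unfolding inV_def quat_folds by (metis le_antisym not_less_eq_eq)
    qed
    then obtain c where c: "\<exists>i\<in>S-{p}. c i \<noteq> 0" "(\<Sum>i\<in>S-{p}. smul (c i) (w i)) = 0"
      using Suc.IH[of "S - {p}" w] Suc.prems(1,2) p(1) by (metis Suc_lessE card_Diff_singleton diff_Suc_1 finite_Diff)
    define d where "d i = (if i = p then - (\<Sum>i\<in>S-{p}. c i * r i) else c i)" for i
    have "(\<Sum>i\<in>S. smul (d i) (v i)) = smul (d p) (v p) + (\<Sum>i\<in>S-{p}. smul (d i) (v i))"
      using Suc.prems(1) p(1) by (rule sum.remove)
    also have "(\<Sum>i\<in>S-{p}. smul (d i) (v i)) = (\<Sum>i\<in>S-{p}. smul (c i) (v i))"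
      by (intro sum.cong) (auto simp: d_def)
    also have "smul (d p) (v p) = - (\<Sum>i\<in>S-{p}. smul (c i * r i) (v p))"
      by (simp only: d_def if_True smul_simps sum_smul refl)
    also have "- (\<Sum>i\<in>S-{p}. smul (c i * r i) (v p)) + (\<Sum>i\<in>S-{p}. smul (c i) (v i))
      = (\<Sum>i\<in>S-{p}. smul (c i) (w i))"
      by (simp only: w_def smul_simps smul_smul sum_subtractf) simp
    finally have "(\<Sum>i\<in>S. smul (d i) (v i)) = 0" using c(2) by simp
    moreover have "\<exists>i\<in>S. d i \<noteq> 0" using c(1) by (auto simp: d_def)
    ultimately show ?thesis by blast
  qed
qed

text \<open>The \<open>n + 1\<close> vectors \<open>v\<close> and \<open>T (uvec i)\<close> are
  dependent, and injectivity forces the coefficient of \<open>v\<close> to be nonzero.\<close>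

lemma inj_imp_surj:
  assumes add: "\<And>x y. T (x + y) = T x + T y" and sm: "\<And>c x. T (smul c x) = smul c (T x)"
    and TV: "\<And>x. V x \<Longrightarrow> V (T x)" and inj: "\<And>x. V x \<Longrightarrow> T x = 0 \<Longrightarrow> x = 0" and v: "V v"
  obtains t where "V t" "T t = v"
proof -
  have T0: "T 0 = 0" using sm[of 0 0] by (simp only: smul_simps)
  have Tsum: "T (sum g A) = (\<Sum>i\<in>A. T (g i))" for g :: "nat \<Rightarrow> 'k vec" and A
    by (induction A rule: infinite_finite_induct) (simp_all add: add T0)
  define w where "w i = (if i = n then v else T (uvec i))" for i
  have "\<And>i. i \<in> {..n} \<Longrightarrow> V (w i)" using v TV by (auto simp: w_def)
  then obtain c where c: "\<exists>i\<in>{..n}. c i \<noteq> 0" "(\<Sum>i\<in>{..n}. smul (c i) (w i)) = 0"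
    using linear_dependence[of "{..n}" n w] by auto
  define x where "x = (\<Sum>i<n. smul (c i) (uvec i))"
  have x: "V x" unfolding x_def by (intro inV_sum) auto
  have xi: "x i = c i" if "i < n" for i
    using that by (simp add: x_def sum_vec_apply smul_apply uvec_def if_distrib cong: if_cong)
  have "(\<Sum>i\<in>{..n}. smul (c i) (w i)) = (\<Sum>i<n. smul (c i) (w i)) + smul (c n) (w n)"
    unfolding lessThan_Suc_atMost[symmetric] by (rule sum.lessThan_Suc)
  also have "(\<Sum>i<n. smul (c i) (w i)) = T x"
    unfolding x_def Tsum sm by (intro sum.cong) (auto simp: w_def)
  finally have Tx: "T x + smul (c n) v = 0" using c(2) by (simp add: w_def)
  show thesis
  proof (cases "c n = 0")
    case True
    then have "x = 0" using Tx inj[OF x] by (simp add: smul_simps)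
    then have "c i = 0" if "i < n" for i using xi[OF that] by (simp add: vec_apply)
    then show ?thesis using c(1) True by (metis atMost_iff le_neq_implies_less)
  next
    case False
    have "T (smul (- qinv (c n)) x) = smul (- qinv (c n)) (T x)" by (rule sm)
    also have "T x = smul (- c n) v" using Tx by (simp add: smul_simps eq_neg_iff_add_eq_0)
    finally have "T (smul (- qinv (c n)) x) = v" using False by (simp add: smul_smul qinv_left smul_simps)
    then show ?thesis using that[of "smul (- qinv (c n)) x"] x by simp
  qed
qed

text \<open>Left multiplication by a simple rotation along \<open>s\<close> cuts the fixed space down to its intersection
with the orthogonal complement of \<open>s\<close>, for all but one choice of \<open>\<sigma>\<close>.\<close>

lemma generic_rot_fix:
  assumes f: "isom f" and s: "V s"
  shows "\<exists>bad. \<forall>\<sigma> y. valid_rot n Hm (s, \<sigma>) \<longrightarrow> \<sigma> \<noteq> bad \<longrightarrow> V y \<longrightarrow> rot n Hm s \<sigma> (f y) = y \<longrightarrow> f y = y \<and> h y s = 0"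
proof (cases "\<exists>w. f w = w \<and> h s w \<noteq> 0")
  case True
  then obtain w where w: "f w = w" "h s w \<noteq> 0" by blast
  \<comment> \<open>Pairing \<open>f y - smul u s = y\<close> with the fixed vector \<open>w\<close>
    gives \<open>u * h s w = 0\<close>, hence \<open>u = 0\<close>, whatever \<sigma> is.\<close>
  have "f y = y \<and> h y s = 0" if y: "rot n Hm s \<sigma> (f y) = y" and \<sigma>: "valid_rot n Hm (s, \<sigma>)" for \<sigma> y
  proof -
    define u where "u = h (f y) s * qinv \<sigma>"
    have e: "f y - smul u s = y" using y by (simp add: rot_eq u_def)
    have "h y w = h (f y) w - u * h s w" by (subst e[symmetric]) (simp only: hform_linear)
    moreover have "h (f y) w = h y w" using isomD(3)[OF f, of y w] w by simp
    ultimately have "u * h s w = 0" by simp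
    then have "u = 0" using w by simp
    then show ?thesis using e \<sigma> by (auto simp: u_def smul_simps valid_rot_iff)
  qed
  then show ?thesis by blast
next
  case False
  \<comment> \<open>An unwanted fixed vector yields \<open>z\<close> with
    \<open>f z - z = s\<close>, and \<open>z\<close> determines \<sigma>. Two such \<open>z\<close>
    differ by a fixed vector of \<open>f\<close>, which is orthogonal to \<open>s\<close> in this
    case, so only one value of \<sigma> is bad.\<close>
  have key: "f y = y \<and> h y s = 0 \<or> (\<exists>z. V z \<and> s = f z - z \<and> \<sigma> = h (f z) s)"
    if y: "rot n Hm s \<sigma> (f y) = y" and \<sigma>: "valid_rot n Hm (s, \<sigma>)" and Vy: "V y" for \<sigma> y
  proof -
    define u where "u = h (f y) s * qinv \<sigma>"
    have \<sigma>0: "\<sigma> \<noteq> 0" using \<sigma> by (simp add: valid_rot_iff)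
    have e: "f y - smul u s = y" using y by (simp add: rot_eq u_def)
    have us: "u * \<sigma> = h (f y) s" using \<sigma>0 by (simp add: u_def mult.assoc qinv_left)
    show ?thesis
    proof (cases "u = 0")
      case True
      then show ?thesis using e us by (auto simp: smul_simps)
    next
      case u: False
      define z where "z = smul (qinv u) y"
      have "f z - z = smul (qinv u) (f y - y)" by (simp add: z_def isomD[OF f] smul_simps)
      also have "f y - y = smul u s" using e by (simp add: algebra_simps)
      finally have "f z - z = s" using u by (simp add: smul_smul qinv_left smul_simps)
      moreover have "h (f z) s = \<sigma>" using u us[symmetric] by (simp add: z_def isomD[OF f] hform_linear)
      ultimately show ?thesis using Vy by (intro disjI2 exI[of _ z]) (auto simp: z_def)
    qed
  qed
  show ?thesis
  proof (cases "\<exists>z. V z \<and> s = f z - z")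
    case True
    then obtain z1 where z1: "V z1" "s = f z1 - z1" by blast
    have "\<sigma> = h (f z1) s" if "V z" "s = f z - z" "\<sigma> = h (f z) s" for z \<sigma>
    proof -
      have "f (z - z1) = z - z1" using that z1 by (simp add: isomD[OF f] algebra_simps)
      then have "h s (z - z1) = 0" using False by blast
      then have "h (z - z1) s = 0" by (rule h_zero_sym)
      then have "h (f z) s - h (f z1) s = 0"
        using \<open>f (z - z1) = z - z1\<close> by (metis hform_linear(2) isomD(5)[OF f])
      then show ?thesis using that by simp
    qed
    then show ?thesis using key by blast
  next
    case False
    then show ?thesis using key by blast
  qed
qed

lemma generic_rot:
  assumes "finite B" "V s" obtains \<sigma> where "valid_rot n Hm (s, \<sigma>)" "\<sigma> \<notin> B"
proof -
  define F where "F r = qof r + qof (1/2) * h s s" for r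
  have "inj F" by (auto simp: inj_def F_def)
  then have "infinite (range F)" using infinite_UNIV_char_0 by (metis finite_imageD)
  then obtain r where r: "F r \<notin> insert 0 B"
    by (metis assms(1) finite.insertI finite_subset image_subset_iff)
  have "F r - qconj (F r) = (qof (1/2) + qof (1/2)) * h s s"
    by (simp add: F_def qconj_mult h_qconj qof_commute algebra_simps)
  also have "\<dots> = h s s" by (simp flip: qof_simps) (simp add: qof_simps)
  finally show thesis using that[of "F r"] r assms by (auto simp: valid_rot_iff)
qed

text \<open>Every member of the finite set \<Phi> excludes a single \<sigma>, and infinitely many
  \<sigma> belong to each vector, so one word works for all of \<Phi> at once.\<close>

lemma generic_word:
  assumes "finite \<Phi>" "\<And>f. f \<in> \<Phi> \<Longrightarrow> isom f" "\<And>s. s \<in> set ss \<Longrightarrow> V s"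
  shows "\<exists>rs. valid_word rs \<and> (\<forall>f\<in>\<Phi>. \<forall>y. V y \<longrightarrow> comp_rots n Hm rs (f y) = y \<longrightarrow> f y = y \<and> (\<forall>s\<in>set ss. h y s = 0))"
  using assms(3)
proof (induction ss)
  case Nil then show ?case by (intro exI[of _ "[]"]) simp
next
  case (Cons s ss)
  then obtain rs where rs: "valid_word rs"
    "\<And>f y. f \<in> \<Phi> \<Longrightarrow> V y \<Longrightarrow> comp_rots n Hm rs (f y) = y \<Longrightarrow> f y = y \<and> (\<forall>s\<in>set ss. h y s = 0)" by auto
  have s: "V s" using Cons by simp
  have "\<exists>bad. \<forall>\<sigma> y. valid_rot n Hm (s, \<sigma>) \<longrightarrow> \<sigma> \<noteq> bad \<longrightarrow> V y \<longrightarrow>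
      rot n Hm s \<sigma> (comp_rots n Hm rs (f y)) = y \<longrightarrow> comp_rots n Hm rs (f y) = y \<and> h y s = 0" if "f \<in> \<Phi>" for f
    using generic_rot_fix[OF isom_comp[OF comp_rots_isom[OF rs(1)] assms(2)[OF that]] s] .
  then obtain bad where bad: "\<And>f \<sigma> y. f \<in> \<Phi> \<Longrightarrow> valid_rot n Hm (s, \<sigma>) \<Longrightarrow> \<sigma> \<noteq> bad f \<Longrightarrow> V y \<Longrightarrow>
      rot n Hm s \<sigma> (comp_rots n Hm rs (f y)) = y \<Longrightarrow> comp_rots n Hm rs (f y) = y \<and> h y s = 0" by metis
  obtain \<sigma> where \<sigma>: "valid_rot n Hm (s, \<sigma>)" "\<sigma> \<notin> bad ` \<Phi>" using generic_rot[of "bad ` \<Phi>" s] assms(1) s by auto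
  show ?case
  proof (intro exI[of _ "(s, \<sigma>) # rs"] conjI ballI allI impI)
    fix f y assume fy: "f \<in> \<Phi>" "V y" "comp_rots n Hm ((s, \<sigma>) # rs) (f y) = y"
    then have "rot n Hm s \<sigma> (comp_rots n Hm rs (f y)) = y" by simp
    from bad[OF fy(1) \<sigma>(1) _ fy(2) this] \<sigma>(2) fy(1) have b: "comp_rots n Hm rs (f y) = y" "h y s = 0" by auto
    show "f y = y" using rs(2)[OF fy(1,2) b(1)] by blast
    show "h y t = 0" if "t \<in> set (s # ss)" for t using rs(2)[OF fy(1,2) b(1)] b(2) that by auto
  qed (use rs(1) \<sigma>(1) in auto)
qed

lemma generic_no_fix:
  assumes "finite \<Phi>" "\<And>f. f \<in> \<Phi> \<Longrightarrow> isom f"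
  obtains \<psi> where "isom \<psi>" "\<And>f y. f \<in> \<Phi> \<Longrightarrow> V y \<Longrightarrow> f (\<psi> y) = y \<Longrightarrow> y = 0"
proof -
  obtain rs where rs: "valid_word rs"
    "\<And>f y. f \<in> \<Phi> \<Longrightarrow> V y \<Longrightarrow> comp_rots n Hm rs (f y) = y \<Longrightarrow> (\<forall>s\<in>set (map uvec [0..<n]). h y s = 0)"
    using generic_word[OF assms, of "map uvec [0..<n]"] by fastforce
  let ?\<psi> = "comp_rots n Hm rs"
  have \<psi>: "isom ?\<psi>" using rs(1) by (rule comp_rots_isom)
  have "y = 0" if y: "f \<in> \<Phi>" "V y" "f (?\<psi> y) = y" for f y
  proof -
    have z: "V (?\<psi> y)" using y isomD(4)[OF \<psi>] by blast
    \<comment> \<open>Applying \<psi> to \<open>f (\<psi> y) = y\<close> moves the generic word to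
      the left of \<open>f\<close>: the vector \<open>\<psi> y\<close> is fixed by \<psi> after
      \<open>f\<close>.\<close>
    have "\<forall>s\<in>set (map uvec [0..<n]). h (?\<psi> y) s = 0" using rs(2)[OF y(1) z] y(3) by simp
    then have 0: "h (?\<psi> y) (uvec i) = 0" if "i < n" for i using that by simp
    have "?\<psi> y = 0"
    proof (rule nondeg'[OF z])
      fix w assume "V w"
      have "h (?\<psi> y) w = h (?\<psi> y) (\<Sum>i<n. smul (w i) (uvec i))" using uvec_expand[OF \<open>V w\<close>] by simp
      also have "\<dots> = 0" using 0 by (simp add: hform_sum hform_linear)
      finally show "h (?\<psi> y) w = 0" .
    qed
    then show ?thesis using isom_inj[OF \<psi> y(2)] by blast
  qed
  then show thesis using that \<psi> by blast
qed

text \<open>Products of transvections \<open>x \<mapsto> x + f(x) t\<close>, together with the product of the norms of \<open>1 + f(t)\<close>,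
i.e. with the reduced norm of the product.\<close>

inductive transv :: "('k vec \<Rightarrow> 'k vec) \<Rightarrow> 'k \<Rightarrow> bool" where
  transv_id: "transv (\<lambda>x. x) 1"
| transv_step: "transv G c \<Longrightarrow> (\<And>x y. f (x + y) = f x + f y) \<Longrightarrow> (\<And>d x. f (smul d x) = d * f x) \<Longrightarrow> V t \<Longrightarrow>
     transv (\<lambda>x. G (x + smul (f x) t)) (c * qnorm (1 + f t))"

text \<open>The relation says \<open>1 - w \<psi> = (1 - \<psi>) G\<close> for the isometry
  \<open>w\<close> of the word. It is built up one rotation at a time, so the absence of fixed
  vectors is required for every tail of the word, including the empty one.\<close>

lemma word_transv:
  assumes "valid_word rs" "isom \<psi>" "\<And>ws y. ws \<in> range (\<lambda>j. drop j rs) \<Longrightarrow> V y \<Longrightarrow> comp_rots n Hm ws (\<psi> y) = y \<Longrightarrow> y = 0"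
  shows "\<exists>G c y. transv G c \<and> spin rs * c = y\<^sup>2 \<and> (\<forall>x. V x \<longrightarrow> x - comp_rots n Hm rs (\<psi> x) = G x - \<psi> (G x))"
  using assms(1,3)
proof (induction rs)
  case Nil
  then show ?case by (intro exI[of _ "\<lambda>x. x"] exI[of _ 1]) (auto intro: transv_id)
next
  case (Cons p rs)
  obtain s \<sigma> where p: "p = (s, \<sigma>)" by (cases p)
  have v: "V s" "\<sigma> \<noteq> 0" "\<sigma> - qconj \<sigma> = h s s" "valid_word rs"
    using Cons.prems(1) by (auto simp: p valid_rot_iff)
  have nofix: "y = 0" if "ws \<in> range (\<lambda>j. drop j rs)" "V y" "comp_rots n Hm ws (\<psi> y) = y" for ws y
  proof -
    obtain j where "ws = drop (Suc j) (p # rs)" using \<open>ws \<in> _\<close> by auto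
    then show ?thesis using Cons.prems(2) that(2,3) by blast
  qed
  obtain G c y where G: "transv G c" "spin rs * c = y\<^sup>2"
    "\<And>x. V x \<Longrightarrow> x - comp_rots n Hm rs (\<psi> x) = G x - \<psi> (G x)"
    using Cons.IH[OF v(4)] nofix by blast
  define g where "g x = comp_rots n Hm rs (\<psi> x)" for x
  have g: "isom g" unfolding g_def using comp_rots_isom[OF v(4)] assms(2) by (rule isom_comp)
  \<comment> \<open>Solving for \<open>t\<close> makes the correction \<open>f x\<close> times
    \<open>s\<close> a value of \<open>1 - g\<close>, so that \<open>1 - g\<close> can be factored
    out on the left.\<close>
  obtain t where t: "V t" "t - g t = s"
  proof (rule inj_imp_surj[of "\<lambda>x. x - g x" s])
    show "x = 0" if "V x" "x - g x = 0" for x 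
      using nofix[of rs x] that range_eqI[of rs "\<lambda>j. drop j rs" 0] by (simp add: g_def)
  qed (use v g in \<open>auto simp: isomD smul_simps\<close>)
  define f where "f x = h (g x) s * qinv \<sigma>" for x
  define \<tau> where "\<tau> = \<sigma> + h (g t) s"
  \<comment> \<open>Since \<open>s + g t = t\<close> and \<open>g\<close> preserves
    \<open>h t t\<close>, the quaternion \<tau> is its own conjugate, i.e. a scalar. Its norm is
    therefore a square and \<open>1 + f t\<close> has the norm class of \<sigma>.\<close>
  have "\<tau> - qconj \<tau> = h s s + h (g t) s + h s (g t)"
    using v(3) by (simp add: \<tau>_def h_qconj algebra_simps)
  also have "\<dots> = h (s + g t) (s + g t) - h (g t) (g t)" by (simp add: hform_linear)
  also have "\<dots> = 0" using t isomD(3)[OF g, of t t] by (simp add: algebra_simps)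
  finally have "\<tau> = qof (qre \<tau>)" by (intro hermitian_scalar) simp
  then have N\<tau>: "qnorm \<tau> = (qre \<tau>)\<^sup>2" by (metis qnorm_simps(5))
  have "1 + f t = \<tau> * qinv \<sigma>" using v by (simp add: f_def \<tau>_def distrib_right qinv_right)
  then have N: "qnorm (1 + f t) = (qre \<tau>)\<^sup>2 / qnorm \<sigma>"
    by (simp add: qnorm_mult qnorm_qinv N\<tau> divide_inverse)
  have "transv (\<lambda>x. G (x + smul (f x) t)) (c * qnorm (1 + f t))"
    using G(1) t(1) by (intro transv_step) (simp_all add: f_def isomD[OF g] hform_linear distrib_right mult.assoc)
  moreover have "spin (p # rs) * (c * qnorm (1 + f t)) = (y * qre \<tau>)\<^sup>2"
    using G(2) v(2) by (simp add: p N power_mult_distrib)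
  moreover have "x - comp_rots n Hm (p # rs) (\<psi> x) = G (x + smul (f x) t) - \<psi> (G (x + smul (f x) t))" if x: "V x" for x
  proof -
    have "x - comp_rots n Hm (p # rs) (\<psi> x) = x - g x + smul (f x) s"
      by (simp add: p rot_eq f_def g_def)
    also have "smul (f x) s = smul (f x) t - g (smul (f x) t)"
      unfolding t(2)[symmetric] by (simp add: smul_simps isomD[OF g])
    also have "x - g x + (smul (f x) t - g (smul (f x) t)) = (x + smul (f x) t) - g (x + smul (f x) t)"
      by (simp add: isomD[OF g])
    finally show ?thesis using G(3)[of "x + smul (f x) t"] x t(1) by (simp add: g_def)
  qed
  ultimately show ?case by blast
qed

end


section \<open>Reduced norms as determinants over the algebraic closure\<close>

lemma det_2: "A \<in> carrier_mat 2 2 \<Longrightarrow> det A = A $$ (0,0) * A $$ (1,1) - A $$ (0,1) * A $$ (1,0)"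
  for A :: "'a::idom mat"
proof -
  assume A: "A \<in> carrier_mat 2 2"
  have 1: "A = four_block_mat (mat 1 1 (\<lambda>_. A $$ (0,0))) (mat 1 1 (\<lambda>_. A $$ (0,1)))
      (mat 1 1 (\<lambda>_. A $$ (1,0))) (mat 1 1 (\<lambda>_. A $$ (1,1)))"
    using A by (intro eq_matI) (auto simp: less_Suc_eq numeral_2_eq_2)
  have "det A = det (mat 1 1 (\<lambda>_. A $$ (0,0)) * mat 1 1 (\<lambda>_. A $$ (1,1))
      - mat 1 1 (\<lambda>_. A $$ (0,1)) * mat 1 1 (\<lambda>_. A $$ (1,0)))"
    by (subst 1, rule det_four_block_mat[of _ 1]) (auto simp: scalar_prod_def mult.commute intro!: eq_matI)
  also have "\<dots> = A $$ (0,0) * A $$ (1,1) - A $$ (0,1) * A $$ (1,0)"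
    by (subst det_single) (auto simp: scalar_prod_def)
  finally show ?thesis .
qed

text \<open>Both sides are the determinant of the block matrix with identities on the diagonal and
  \<open>- F\<close>, \<open>T\<close> off it, factored into block triangular matrices in two
  ways.\<close>

lemma det_sylvester:
  fixes F :: "'a::idom mat"
  assumes F: "F \<in> carrier_mat m k" and T: "T \<in> carrier_mat k m"
  shows "det (1\<^sub>m m + F * T) = det (1\<^sub>m k + T * F)"
proof -
  let ?M = "four_block_mat (1\<^sub>m m) (- F) T (1\<^sub>m k)"
  have c: "- F \<in> carrier_mat m k" "F * T \<in> carrier_mat m m" "T * F \<in> carrier_mat k k" using F T by auto
  have M1: "?M = four_block_mat (1\<^sub>m m) (0\<^sub>m m k) T (1\<^sub>m k) * four_block_mat (1\<^sub>m m) (- F) (0\<^sub>m k m) (1\<^sub>m k + T * F)"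
    using F T c by (subst mult_four_block_mat[of _ m m _ k _ k])
      (auto intro!: arg_cong2[where f = "four_block_mat _ _"] eq_matI simp: scalar_prod_def sum_negf)
  have M2: "?M = four_block_mat (1\<^sub>m m + F * T) (- F) (0\<^sub>m k m) (1\<^sub>m k) * four_block_mat (1\<^sub>m m) (0\<^sub>m m k) T (1\<^sub>m k)"
    using F T c by (subst mult_four_block_mat[of _ m m _ k _ k]) 
      (auto intro!: arg_cong2[where f = "\<lambda>a. four_block_mat a _ _"] eq_matI simp: scalar_prod_def sum_negf)
  have "det ?M = det (1\<^sub>m k + T * F)"
    unfolding M1 using F T c
    by (subst det_mult[of _ "m + k"])
      (auto simp: det_four_block_mat_upper_right_zero[of _ m _ k] det_four_block_mat_lower_left_zero[of _ m _ k])
  moreover have "det ?M = det (1\<^sub>m m + F * T)"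
    unfolding M2 using F T c
    by (subst det_mult[of _ "m + k"])
      (auto simp: det_four_block_mat_upper_right_zero[of _ m _ k] det_four_block_mat_lower_left_zero[of _ m _ k])
  ultimately show ?thesis by simp
qed

text \<open>A root of \<open>-1\<close> in the algebraic closure splits the quaternions into two by
  two matrices, whose determinant is the norm. Entries are returned as functions so that they can be
  placed into larger matrices.\<close>

lemma qnorm_det:
  obtains rep :: "'k::field quat \<Rightarrow> nat \<Rightarrow> nat \<Rightarrow> 'k alg_closure" where
    "\<And>x y a b. a < 2 \<Longrightarrow> b < 2 \<Longrightarrow> rep (x * y) a b = rep x a 0 * rep y 0 b + rep x a 1 * rep y 1 b"
    "\<And>x y a b. rep (x + y) a b = rep x a b + rep y a b"
    "\<And>a b. a < 2 \<Longrightarrow> b < 2 \<Longrightarrow> rep 1 a b = (if a = b then 1 else 0)"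
    "\<And>a b. rep 0 a b = 0"
    "\<And>x. rep x 0 0 * rep x 1 1 - rep x 0 1 * rep x 1 0 = to_ac (qnorm x)"
proof -
  obtain i :: "'k alg_closure" where i: "i\<^sup>2 = -1" using nth_root_exists[of 2 "-1"] by auto
  have i': "i * i = -1" "i * (i * z) = - z" for z using i by (simp_all add: power2_eq_square flip: mult.assoc)
  define rep where "rep = (\<lambda>x a b. case x of Quat p q r s \<Rightarrow>
     if a = (0::nat) then (if b = (0::nat) then to_ac p + to_ac q * i else to_ac r + to_ac s * i)
     else (if b = 0 then - to_ac r + to_ac s * i else to_ac p - to_ac q * i))"
  note hom = to_ac_add to_ac_diff to_ac_minus to_ac_mult to_ac_power to_ac_0 to_ac_1
  show thesis
  proof (rule that[of rep])
    show "rep (x * y) a b = rep x a 0 * rep y 0 b + rep x a 1 * rep y 1 b" if "a < 2" "b < 2" for x y a b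
      by (cases x; cases y) (simp add: rep_def Quat_ops hom algebra_simps i')
    show "rep (x + y) a b = rep x a b + rep y a b" for x y a b
      by (cases x; cases y) (simp add: rep_def Quat_ops hom algebra_simps)
    show "rep 1 a b = (if a = b then 1 else 0)" if "a < 2" "b < 2" for a b
      using that by (auto simp: rep_def Quat_ops hom less_2_cases_iff)
    show "rep 0 a b = 0" for a b by (simp add: rep_def Quat_ops hom)
    show "rep x 0 0 * rep x 1 1 - rep x 0 1 * rep x 1 0 = to_ac (qnorm x)" for x
      by (cases x) (simp add: rep_def hom algebra_simps power2_eq_square i')
  qed
qed


lemma sum_double: "(\<Sum>l<2 * n. g l) = (\<Sum>i<n. g (2 * i) + g (Suc (2 * i)))" for g :: "nat \<Rightarrow> 'a::comm_monoid_add"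
  by (induction n) (simp_all add: add.assoc)

context skew_space
begin

lemma transv_V: "transv G c \<Longrightarrow> V x \<Longrightarrow> V (G x)"
  by (induction arbitrary: x rule: transv.induct) auto

text \<open>A left-linear map becomes right multiplication of 2 by 2n matrices by a fixed matrix.
  The determinant of that matrix depends on the map alone, and for the product of transvections it
  equals \<open>c\<close>.\<close>

lemma transv_trivial:
  assumes G: "transv G c" and id: "\<And>x. V x \<Longrightarrow> G x = x"
  shows "c = 1"
proof -
  obtain rep :: "'k quat \<Rightarrow> nat \<Rightarrow> nat \<Rightarrow> 'k alg_closure" where
    rep_mult: "\<And>x y a b. a < 2 \<Longrightarrow> b < 2 \<Longrightarrow> rep (x * y) a b = rep x a 0 * rep y 0 b + rep x a 1 * rep y 1 b"
    and rep_add: "\<And>x y a b. rep (x + y) a b = rep x a b + rep y a b"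
    and rep_1: "\<And>a b. a < 2 \<Longrightarrow> b < 2 \<Longrightarrow> rep 1 a b = (if a = b then 1 else 0)"
    and rep_0: "\<And>a b. rep 0 a b = 0"
    and rep_det: "\<And>x. rep x 0 0 * rep x 1 1 - rep x 0 1 * rep x 1 0 = to_ac (qnorm x)"
    by (rule qnorm_det, rule that, assumption+)
  have rep_sum: "rep (sum f A) a b = (\<Sum>i\<in>A. rep (f i) a b)" for f :: "nat \<Rightarrow> 'k quat" and A a b
    by (induction A rule: infinite_finite_induct) (simp_all add: rep_0 rep_add)
  have s2: "(\<Sum>i\<in>{0..<2::nat}. g i) = g 0 + g 1" for g :: "nat \<Rightarrow> 'k alg_closure"
    by (simp add: numeral_2_eq_2)
  define R where "R x = mat 2 (2 * n) (\<lambda>(a, b). rep (x (b div 2)) a (b mod 2))" for x :: "'k vec"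
  have Rc: "R x \<in> carrier_mat 2 (2 * n)" for x by (simp add: R_def)
  have "\<exists>M\<in>carrier_mat (2 * n) (2 * n). det M = to_ac c \<and> (\<forall>x. V x \<longrightarrow> R (G x) = R x * M)"
    using G
  proof (induction rule: transv.induct)
    case transv_id
    then show ?case using right_mult_one_mat[OF Rc] by (intro bexI[of _ "1\<^sub>m (2 * n)"]) auto
  next
    case (transv_step G c f t)
    then obtain M where M: "M \<in> carrier_mat (2 * n) (2 * n)" "det M = to_ac c" "\<And>x. V x \<Longrightarrow> R (G x) = R x * M" by blast
    have f0: "f 0 = 0" using transv_step(2)[of 0 0] by simp
    have fsum: "f (sum g A) = (\<Sum>i\<in>A. f (g i))" for g :: "nat \<Rightarrow> 'k vec" and A
      by (induction A rule: infinite_finite_induct) (simp_all add: f0 transv_step(2))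
    have f_eq: "f x = (\<Sum>i<n. x i * f (uvec i))" if "V x" for x
      by (subst uvec_expand[OF that]) (simp add: fsum transv_step(3))
    define F where "F = mat (2 * n) 2 (\<lambda>(b, a). rep (f (uvec (b div 2))) (b mod 2) a)"
    have Fc: "F \<in> carrier_mat (2 * n) 2" by (simp add: F_def)
    have RF: "R x * F = mat 2 2 (\<lambda>(a, b). rep (f x) a b)" if "V x" for x
    proof (rule eq_matI)
      fix a b assume "a < dim_row (mat 2 2 (\<lambda>(a, b). rep (f x) a b))" "b < dim_col (mat 2 2 (\<lambda>(a, b). rep (f x) a b))"
      then have ab: "a < 2" "b < 2" by auto
      have "(R x * F) $$ (a, b) = (\<Sum>l<2 * n. rep (x (l div 2)) a (l mod 2) * rep (f (uvec (l div 2))) (l mod 2) b)"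
        using ab by (simp add: R_def F_def scalar_prod_def lessThan_atLeast0)
      also have "\<dots> = (\<Sum>i<n. rep (x i * f (uvec i)) a b)"
        by (simp add: sum_double rep_mult[OF ab])
      also have "\<dots> = rep (f x) a b" by (simp add: f_eq[OF that] rep_sum)
      finally show "(R x * F) $$ (a, b) = mat 2 2 (\<lambda>(a, b). rep (f x) a b) $$ (a, b)" using ab by simp
    qed (auto simp: R_def F_def)
    have RE: "R (x + smul (f x) t) = R x * (1\<^sub>m (2 * n) + F * R t)" if "V x" for x
    proof -
      have "R (x + smul (f x) t) = R x + (R x * F) * R t"
      proof (rule eq_matI)
        fix a b assume "a < dim_row (R x + (R x * F) * R t)" "b < dim_col (R x + (R x * F) * R t)"
        then have ab: "a < 2" "b < 2 * n" by (auto simp: R_def)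
        then have b: "b mod 2 < 2" by simp
        show "R (x + smul (f x) t) $$ (a, b) = (R x + (R x * F) * R t) $$ (a, b)"
          unfolding RF[OF that] using ab
          by (simp add: R_def scalar_prod_def rep_add rep_mult[OF ab(1) b] vec_apply smul_apply s2)
      qed (auto simp: R_def)
      also have "\<dots> = R x * (1\<^sub>m (2 * n) + F * R t)"
        using Rc[of x] Rc[of t] Fc by (simp add: mult_add_distrib_mat[of _ 2 "2 * n" _ "2 * n"] assoc_mult_mat[of _ 2 "2 * n" _ 2 _ "2 * n"])
      finally show ?thesis .
    qed
    \<comment> \<open>The large determinant of a transvection collapses to the two by two
      determinant of \<open>1 + f t\<close>, i.e. to its quaternion norm.\<close>
    have "det (1\<^sub>m (2 * n) + F * R t) = det (1\<^sub>m 2 + R t * F)" by (rule det_sylvester[OF Fc Rc])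
    also have "1\<^sub>m 2 + R t * F = mat 2 2 (\<lambda>(a, b). rep (1 + f t) a b)"
      unfolding RF[OF transv_step(4)] by (rule eq_matI) (auto simp: rep_add rep_1)
    also have "det \<dots> = to_ac (qnorm (1 + f t))" by (subst det_2) (auto simp: rep_det[symmetric])
    finally have "det ((1\<^sub>m (2 * n) + F * R t) * M) = to_ac (c * qnorm (1 + f t))"
      using M Fc Rc by (subst det_mult[of _ "2 * n"]) (auto simp: to_ac_mult)
    moreover have "R (G (x + smul (f x) t)) = R x * ((1\<^sub>m (2 * n) + F * R t) * M)" if "V x" for x
      using M(3)[of "x + smul (f x) t"] that transv_step(4) M(1) Fc Rc[of t] Rc[of x]
      by (simp add: RE assoc_mult_mat[of _ 2 "2 * n" _ "2 * n" _ "2 * n"])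
    ultimately show ?case using M(1) Fc Rc[of t]
      by (intro bexI[of _ "(1\<^sub>m (2 * n) + F * R t) * M"]) auto
  qed
  then obtain M where M: "M \<in> carrier_mat (2 * n) (2 * n)" "det M = to_ac c" "\<And>x. V x \<Longrightarrow> R (G x) = R x * M" by blast
  have "M = 1\<^sub>m (2 * n)"
  proof (rule eq_matI)
    fix r j assume "r < dim_row (1\<^sub>m (2 * n) :: 'k alg_closure mat)" "j < dim_col (1\<^sub>m (2 * n) :: 'k alg_closure mat)"
    then have rj: "r < 2 * n" "j < 2 * n" by auto
    define x :: "'k vec" where "x = uvec (r div 2)"
    have x: "V x" using rj by (simp add: x_def)
    have Rx: "R x $$ (r mod 2, l) = (if l = r then 1 else 0)" if "l < 2 * n" for l
    proof -
      have "l = r" if "l div 2 = r div 2" "l mod 2 = r mod 2" using that by (metis div_mult_mod_eq)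
      then show ?thesis using that by (auto simp: R_def x_def uvec_def rep_0 rep_1)
    qed
    have "R x $$ (r mod 2, j) = (R x * M) $$ (r mod 2, j)" using M(3)[OF x] id[OF x] by simp
    also have "\<dots> = (\<Sum>l<2 * n. R x $$ (r mod 2, l) * M $$ (l, j))"
      using rj M(1) Rc[of x] by (simp add: scalar_prod_def lessThan_atLeast0)
    also have "\<dots> = (\<Sum>l<2 * n. if l = r then M $$ (l, j) else 0)"
      by (intro sum.cong) (auto simp: Rx)
    also have "\<dots> = M $$ (r, j)" using rj by simp
    finally show "M $$ (r, j) = 1\<^sub>m (2 * n) $$ (r, j)" using rj by (auto simp: Rx split: if_splits)
  qed (use M in auto)
  then show ?thesis using M(2) by simp
qed

text \<open>If the word acts as the identity, \<open>word_transv\<close> reads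
  \<open>1 - \<psi> = (1 - \<psi>) G\<close>. As \<psi> has no fixed vectors, \<open>G\<close> is
  the identity and \<open>c = 1\<close>, so the product of the norms is a square.\<close>

theorem spinor_norm_trivial:
  assumes rs: "valid_word rs" and id: "\<And>x. V x \<Longrightarrow> comp_rots n Hm rs x = x"
  obtains y where "y \<noteq> 0" "spin rs = y\<^sup>2"
proof -
  have fin: "finite (range (\<lambda>j. drop j rs))"
    by (rule finite_subset[of _ "(\<lambda>j. drop j rs) ` {..length rs}"])
      (auto, metis (no_types) atMost_iff drop_all drop_eq_Nil2 image_eqI nat_le_linear)
  have "valid_word ws" if "ws \<in> range (\<lambda>j. drop j rs)" for ws using that rs by (auto dest: in_set_dropD)
  then have "\<And>f. f \<in> comp_rots n Hm ` range (\<lambda>j. drop j rs) \<Longrightarrow> isom f" using comp_rots_isom by blast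
  then obtain \<psi> where \<psi>: "isom \<psi>"
    "\<And>f y. f \<in> comp_rots n Hm ` range (\<lambda>j. drop j rs) \<Longrightarrow> V y \<Longrightarrow> f (\<psi> y) = y \<Longrightarrow> y = 0"
    using generic_no_fix[OF finite_imageI[OF fin]] by metis
  obtain G c y where G: "transv G c" "spin rs * c = y\<^sup>2"
    "\<And>x. V x \<Longrightarrow> x - comp_rots n Hm rs (\<psi> x) = G x - \<psi> (G x)"
    using word_transv[OF rs \<psi>(1)] \<psi>(2) by blast
  have "G x = x" if x: "V x" for x
  proof -
    have "x - \<psi> x = G x - \<psi> (G x)" using G(3)[OF x] id isomD(4)[OF \<psi>(1) x] by simp
    then have "\<psi> (x - G x) = x - G x" by (simp add: isomD[OF \<psi>(1)] algebra_simps)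
    \<comment> \<open>The empty tail is among the isometries \<psi> was chosen for; this is the
      statement that \<psi> itself fixes no nonzero vector.\<close>
    moreover have "comp_rots n Hm [] \<in> comp_rots n Hm ` range (\<lambda>j. drop j rs)"
      by (intro imageI range_eqI[of _ _ "length rs"]) simp
    ultimately have "x - G x = 0" using \<psi>(2)[of "comp_rots n Hm []" "x - G x"] x transv_V[OF G(1) x] by simp
    then show ?thesis by simp
  qed
  then have "c = 1" using transv_trivial[OF G(1)] by blast
  then show thesis using that[of y] G(2) spin_nonzero[OF rs] by auto
qed

end


section \<open>Lattices and spinor norms of their stabilizers\<close>

lemma lcomb_eq:
  "length cs = length gs \<Longrightarrow> lcomb cs gs = (\<Sum>i<length gs. smul (cs ! i) (gs ! i))" for gs :: "'k::field vec list"
proof -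
  assume "length cs = length gs"
  then have "map (\<lambda>(c, g). smul c g) (zip cs gs) = map (\<lambda>i. smul (cs ! i) (gs ! i)) [0..<length gs]"
    by (intro nth_equalityI) auto
  then show ?thesis
    by (simp add: lcomb_def vec_folds interv_sum_list_conv_sum_set_nat lessThan_atLeast0)
qed

lemma list_choice: "(\<exists>cs. Q cs \<and> length cs = m \<and> P cs) \<longleftrightarrow> (\<exists>c. Q (map c [0..<m]) \<and> P (map c [0..<m]))"
  by (metis diff_zero length_map length_upt map_nth)

lemma dspan_iff: "x \<in> dspan gs \<longleftrightarrow> (\<exists>c. x = (\<Sum>i<length gs. smul (c i) (gs ! i)))" for gs :: "'k::field vec list"
proof
  assume "x \<in> dspan gs"
  then obtain cs where "length cs = length gs" "x = lcomb cs gs" by (auto simp: dspan_def)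
  then show "\<exists>c. x = (\<Sum>i<length gs. smul (c i) (gs ! i))" by (auto simp: lcomb_eq)
next
  assume "\<exists>c. x = (\<Sum>i<length gs. smul (c i) (gs ! i))"
  then obtain c where "x = (\<Sum>i<length gs. smul (c i) (gs ! i))" by blast
  then have "x = lcomb (map c [0..<length gs]) gs" by (simp add: lcomb_eq)
  then show "x \<in> dspan gs" unfolding dspan_def by force
qed

context skew_space
begin

lemma ospan_iff: "x \<in> ospan val gs \<longleftrightarrow> (\<exists>c. (\<forall>i<length gs. qdv 0 (c i)) \<and> x = (\<Sum>i<length gs. smul (c i) (gs ! i)))"
proof
  assume "x \<in> ospan val gs"
  then obtain cs where cs: "length cs = length gs" "x = lcomb cs gs" "set cs \<subseteq> OD val" by (auto simp: ospan_def)
  then have "\<forall>i<length gs. qdv 0 (cs ! i)" by (metis OD_iff nth_mem subsetD)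
  then show "\<exists>c. (\<forall>i<length gs. qdv 0 (c i)) \<and> x = (\<Sum>i<length gs. smul (c i) (gs ! i))" using cs by (auto simp: lcomb_eq)
next
  assume "\<exists>c. (\<forall>i<length gs. qdv 0 (c i)) \<and> x = (\<Sum>i<length gs. smul (c i) (gs ! i))"
  then obtain c where c: "\<forall>i<length gs. qdv 0 (c i)" "x = (\<Sum>i<length gs. smul (c i) (gs ! i))" by blast
  then have "x = lcomb (map c [0..<length gs]) gs" "set (map c [0..<length gs]) \<subseteq> OD val"
    by (auto simp: lcomb_eq OD_iff)
  then show "x \<in> ospan val gs" unfolding ospan_def by force
qed

lemma ospan_1: "x \<in> ospan val [g] \<longleftrightarrow> (\<exists>c. qdv 0 c \<and> x = smul c g)"
proof -
  have "x \<in> ospan val [g] \<longleftrightarrow> (\<exists>c. qdv 0 (c (0::nat)) \<and> x = smul (c 0) g)" by (simp add: ospan_iff)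
  also have "\<dots> \<longleftrightarrow> (\<exists>c. qdv 0 c \<and> x = smul c g)"
    by (rule iffI; elim exE) (blast, rule_tac x = "\<lambda>_. c" in exI, simp)
  finally show ?thesis .
qed

lemma ospan_2: "x \<in> ospan val [g, g'] \<longleftrightarrow> (\<exists>c d. qdv 0 c \<and> qdv 0 d \<and> x = smul c g + smul d g')"
proof -
  have "x \<in> ospan val [g, g'] \<longleftrightarrow> (\<exists>c. qdv 0 (c (0::nat)) \<and> qdv 0 (c 1) \<and> x = smul (c 0) g + smul (c 1) g')"
    unfolding ospan_iff by (simp add: lessThan_Suc less_Suc_eq all_conj_distrib add.commute conj_ac)
  also have "\<dots> \<longleftrightarrow> (\<exists>c d. qdv 0 c \<and> qdv 0 d \<and> x = smul c g + smul d g')"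
    by (safe, blast) (rule_tac x = "\<lambda>i. if i = 0 then c else d" in exI, simp)
  finally show ?thesis .
qed

lemma dindep_1: "dindep [g] \<longleftrightarrow> g \<noteq> (0 :: 'k vec)"
proof
  assume "dindep [g]"
  then show "g \<noteq> 0" unfolding dindep_def by (auto simp: lcomb_eq smul_simps vec_folds quat_folds dest!: spec[of _ "[1]"])
next
  assume g: "g \<noteq> 0"
  have "c = 0" if "smul c g = 0" for c
  proof (rule ccontr)
    assume "c \<noteq> 0"
    then have "g = smul (qinv c) (smul c g)" by (simp add: smul_smul qinv_left smul_simps)
    then show False using that g by (simp add: smul_simps)
  qed
  then show "dindep [g]" unfolding dindep_def
    by (auto simp: lcomb_eq vec_folds quat_folds length_Suc_conv)
qed

lemma dindep_2: "dindep [g, g'] \<Longrightarrow> smul c g + smul d g' = 0 \<Longrightarrow> c = 0 \<and> d = (0 :: 'k quat)"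
  unfolding dindep_def by (auto simp: lcomb_eq vec_folds quat_folds lessThan_Suc add.commute dest!: spec[of _ "[c, d]"])

definition omodule :: "'k vec set \<Rightarrow> bool" where
  "omodule M \<longleftrightarrow> 0 \<in> M \<and> (\<forall>x\<in>M. V x) \<and> (\<forall>x\<in>M. \<forall>y\<in>M. x + y \<in> M) \<and> (\<forall>c. \<forall>x\<in>M. qdv 0 c \<longrightarrow> smul c x \<in> M)"

lemma omoduleD:
  assumes "omodule M"
  shows "0 \<in> M" "x \<in> M \<Longrightarrow> V x" "x \<in> M \<Longrightarrow> y \<in> M \<Longrightarrow> x + y \<in> M" "x \<in> M \<Longrightarrow> qdv 0 c \<Longrightarrow> smul c x \<in> M"
    "x \<in> M \<Longrightarrow> y \<in> M \<Longrightarrow> x - y \<in> M"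
proof -
  show *: "0 \<in> M" "x \<in> M \<Longrightarrow> V x" "x \<in> M \<Longrightarrow> y \<in> M \<Longrightarrow> x + y \<in> M" "x \<in> M \<Longrightarrow> qdv 0 c \<Longrightarrow> smul c x \<in> M" for x y c
    using assms by (auto simp: omodule_def)
  show "x \<in> M \<Longrightarrow> y \<in> M \<Longrightarrow> x - y \<in> M" using *(3)[of x "- y"] *(4)[of y "- 1"] by (simp add: smul_simps)
qed

lemma omodule_ospan: assumes "\<And>g. g \<in> set gs \<Longrightarrow> V g" shows "omodule (ospan val gs)"
  unfolding omodule_def
proof (intro conjI ballI allI impI)
  show "0 \<in> ospan val gs" unfolding ospan_iff by (intro exI[of _ "\<lambda>_. 0"]) (simp add: smul_simps)
  fix x assume "x \<in> ospan val gs"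
  then obtain c where c: "\<forall>i<length gs. qdv 0 (c i)" "x = (\<Sum>i<length gs. smul (c i) (gs ! i))"
    unfolding ospan_iff by blast
  show "V x" unfolding c using assms by (intro inV_sum) auto
  show "smul d x \<in> ospan val gs" if "qdv 0 d" for d
    unfolding ospan_iff using c that
    by (intro exI[of _ "\<lambda>i. d * c i"]) (auto simp: smul_sum smul_smul intro: qdv_mult0)
  fix y assume "y \<in> ospan val gs"
  then obtain d where d: "\<forall>i<length gs. qdv 0 (d i)" "y = (\<Sum>i<length gs. smul (d i) (gs ! i))"
    unfolding ospan_iff by blast
  show "x + y \<in> ospan val gs" unfolding ospan_iff using c d
    by (intro exI[of _ "\<lambda>i. c i + d i"]) (auto simp: smul_simps sum.distrib intro: qdv_add)
qed

lemma Hgrp_iff: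
  "c \<in> Hgrp n Hm L \<longleftrightarrow> c \<noteq> 0 \<and> (\<exists>rs y. valid_word rs \<and> comp_rots n Hm rs ` L = L \<and> c = spin rs * y\<^sup>2 \<and> y \<noteq> 0)"
  unfolding Hgrp_def sqc_def spin_def by blast

lemma Hgrp_square: "y \<noteq> 0 \<Longrightarrow> y\<^sup>2 \<in> Hgrp n Hm L"
  unfolding Hgrp_iff by (auto intro!: exI[of _ "[]"] exI[of _ y])

lemma Hgrp_mult: assumes "c \<in> Hgrp n Hm L" "d \<in> Hgrp n Hm L" shows "c * d \<in> Hgrp n Hm L"
proof -
  obtain rs y where r: "valid_word rs" "comp_rots n Hm rs ` L = L" "c = spin rs * y\<^sup>2" "y \<noteq> 0" "c \<noteq> 0"
    using assms(1) unfolding Hgrp_iff by blast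
  obtain rs' y' where r': "valid_word rs'" "comp_rots n Hm rs' ` L = L" "d = spin rs' * y'\<^sup>2" "y' \<noteq> 0" "d \<noteq> 0"
    using assms(2) unfolding Hgrp_iff by blast
  have "comp_rots n Hm (rs @ rs') ` L = comp_rots n Hm rs ` comp_rots n Hm rs' ` L"
    by (auto simp: image_iff)
  then show ?thesis unfolding Hgrp_iff using r r'
    by (intro conjI exI[of _ "rs @ rs'"] exI[of _ "y * y'"]) (auto simp: power_mult_distrib)
qed

lemma Hgrp_mult_square: "c \<in> Hgrp n Hm L \<Longrightarrow> y \<noteq> 0 \<Longrightarrow> c * y\<^sup>2 \<in> Hgrp n Hm L"
  using Hgrp_mult Hgrp_square by blast

lemma Hgrp_nonzero: "c \<in> Hgrp n Hm L \<Longrightarrow> c \<noteq> 0" by (simp add: Hgrp_iff)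

text \<open>The bound makes every coefficient \<open>h x s * qinv \<sigma>\<close> integral. The
  inverse rotation has parameter \<open>- qconj \<sigma>\<close> of the same valuation, so the image
  is all of \<open>L\<close>.\<close>

lemma rot_stabilizes:
  assumes L: "omodule L" and s: "s \<in> L" and v: "valid_rot n Hm (s, \<sigma>)"
    and M: "\<And>x. x \<in> L \<Longrightarrow> qdv M (h x s)" "qnu val \<sigma> \<le> M"
  shows "rot n Hm s \<sigma> ` L = L"
proof -
  have sub: "rot n Hm s \<tau> x \<in> L" if "x \<in> L" "\<tau> \<noteq> 0" "qnu val \<tau> \<le> M" for x \<tau>
  proof -
    have "qdv 0 (h x s * qinv \<tau>)" using that qdv_mono[OF M(1)[of x]] by (simp add: qdv_qinv)
    then show ?thesis unfolding rot_eq using omoduleD[OF L] s that by blast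
  qed
  have \<sigma>: "\<sigma> \<noteq> 0" using v by (simp add: valid_rot_iff)
  have "x \<in> rot n Hm s \<sigma> ` L" if "x \<in> L" for x
    using rot_inverse'[OF v, of x] sub[OF that, of "- qconj \<sigma>"] \<sigma> M(2) by (metis image_eqI qconj_eq_0 neg_equal_0_iff_equal qnu_minus)
  then show ?thesis using sub[OF _ \<sigma> M(2)] by blast
qed

lemma rot_norm_in_Hgrp:
  assumes "omodule L" "s \<in> L" "valid_rot n Hm (s, \<sigma>)" "\<And>x. x \<in> L \<Longrightarrow> qdv M (h x s)" "qnu val \<sigma> \<le> M"
  shows "qnorm \<sigma> \<in> Hgrp n Hm L"
  unfolding Hgrp_iff using rot_stabilizes[OF assms] assms(3)
  by (intro conjI exI[of _ "[(s, \<sigma>)]"] exI[of _ 1]) (auto simp: valid_rot_iff image_def)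

lemma half_pure: "pure (\<gamma> :: 'k quat) \<Longrightarrow> (qof r + qof (1/2) * \<gamma>) - qconj (qof r + qof (1/2) * \<gamma>) = \<gamma>"
proof -
  assume p: "pure \<gamma>"
  have "(qof r + qof (1/2) * \<gamma>) - qconj (qof r + qof (1/2) * \<gamma>) = (qof (1/2) + qof (1/2)) * \<gamma>"
    using p by (simp add: qconj_mult pure_def qof_commute algebra_simps)
  also have "\<dots> = \<gamma>" by (simp flip: qof_simps) (simp add: qof_simps)
  finally show ?thesis .
qed

text \<open>The pure part of \<sigma> must be half of \<open>h s s\<close>, so only its real part is
  free. Real part \<open>x / (2 * y)\<close> gives the wanted norm up to the square of
  \<open>2 * y\<close>, and \<open>bound\<close> makes every real part admissible.\<close>

lemma norms_in_Hgrp: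
  assumes L: "omodule L" and s: "s \<in> L" and g: "h s s \<noteq> 0" and M: "\<And>x. x \<in> L \<Longrightarrow> qdv M (h x s)"
    and bound: "\<And>r. \<not> dv (M + 1) (r\<^sup>2 + qnorm (h s s) / 4)"
    and xy: "x\<^sup>2 + qnorm (h s s) * y\<^sup>2 \<noteq> 0"
  shows "x\<^sup>2 + qnorm (h s s) * y\<^sup>2 \<in> Hgrp n Hm L"
proof (cases "y = 0")
  case True
  then show ?thesis using xy Hgrp_square[of x] by auto
next
  case False
  define \<sigma> where "\<sigma> = qof (x / (2 * y)) + qof (1/2) * h s s"
  have re: "qre (h s s) = 0" using pure_h pure_iff by blast
  have N: "qnorm \<sigma> = (x / (2 * y))\<^sup>2 + qnorm (h s s) / 4"
    by (simp add: \<sigma>_def qnorm_qof_add qnorm_mult re power_divide)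
  also have "\<dots> = (x\<^sup>2 + qnorm (h s s) * y\<^sup>2) / (2 * y)\<^sup>2"
    using False by (simp add: field_simps power2_eq_square)
  finally have N': "x\<^sup>2 + qnorm (h s s) * y\<^sup>2 = qnorm \<sigma> * (2 * y)\<^sup>2" using False by simp
  have \<sigma>: "\<sigma> \<noteq> 0" "qnu val \<sigma> \<le> M"
    using bound[of "x / (2 * y)"] not_qdv_iff[of M \<sigma>] by (simp_all add: qdv_def N)
  moreover have "valid_rot n Hm (s, \<sigma>)"
    unfolding valid_rot_iff using \<sigma> half_pure[OF pure_h] omoduleD(2)[OF L s] by (auto simp: \<sigma>_def)
  ultimately have "qnorm \<sigma> \<in> Hgrp n Hm L" using rot_norm_in_Hgrp[OF L s _ M] by blast
  then show ?thesis unfolding N' by (rule Hgrp_mult_square) (use False in simp)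
qed

lemma normgrp_iff: "pure (a :: 'k quat) \<Longrightarrow> c \<in> normgrp a \<longleftrightarrow> c \<noteq> 0 \<and> (\<exists>x y. c = x\<^sup>2 + qnorm a * y\<^sup>2)"
proof -
  assume a: "pure a"
  have N: "qnorm (qof x + qof y * a) = x\<^sup>2 + qnorm a * y\<^sup>2" for x y
    using a by (simp add: qnorm_qof_add qnorm_mult pure_iff mult.commute)
  have "qof x + qof y * a \<noteq> 0 \<longleftrightarrow> x\<^sup>2 + qnorm a * y\<^sup>2 \<noteq> 0" for x y
    using N[of x y] qnorm_eq_0[of "qof x + qof y * a"] by simp
  then show ?thesis unfolding normgrp_def quat_folds N by auto
qed

lemma Hgrp_full:
  assumes "sum3 c1" "sum3 c2" "\<And>y. c1 * c2 \<noteq> y\<^sup>2"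
    and "\<And>x y. x\<^sup>2 + c1 * y\<^sup>2 \<noteq> 0 \<Longrightarrow> x\<^sup>2 + c1 * y\<^sup>2 \<in> Hgrp n Hm L"
    and "\<And>x y. x\<^sup>2 + c2 * y\<^sup>2 \<noteq> 0 \<Longrightarrow> x\<^sup>2 + c2 * y\<^sup>2 \<in> Hgrp n Hm L"
  shows "Hgrp n Hm L = {c. c \<noteq> 0}"
proof -
  have "z \<in> Hgrp n Hm L" if "z \<noteq> 0" for z
    using two_norm_groups[where P = "\<lambda>c. c \<in> Hgrp n Hm L", OF Hgrp_mult Hgrp_mult_square assms that] .
  then show ?thesis using Hgrp_nonzero by blast
qed

end

section \<open>Lattices with an orthogonal decomposition\<close>

locale decomposed_lattice = skew_space val n Hm for val :: "'k::field_char_0 \<Rightarrow> int" and n Hm +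
  fixes L :: "'k vec set" and Ls :: "'k vec set list"
  assumes lat: "is_lattice val n L" and dec: "orth_decomp n Hm L Ls"
    and free: "\<And>r. r < length Ls \<Longrightarrow> \<exists>t. free_rank val (Ls ! r) t"
begin

lemma omodule_L: "omodule L"
  using lat omodule_ospan unfolding is_lattice_def by blast

lemma L_iff: "x \<in> L \<longleftrightarrow> (\<exists>f. x = (\<Sum>r<length Ls. f r) \<and> (\<forall>r<length Ls. f r \<in> Ls ! r))"
proof -
  have "L = {sum_list xs |xs. length xs = length Ls \<and> (\<forall>r<length Ls. xs ! r \<in> Ls ! r)}"
    by (rule conjunct1[OF dec[unfolded orth_decomp_def vec_folds]])
  then have "x \<in> L \<longleftrightarrow> x \<in> {sum_list xs |xs. length xs = length Ls \<and> (\<forall>r<length Ls. xs ! r \<in> Ls ! r)}"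
    by (rule arg_cong)
  also have "\<dots> \<longleftrightarrow> (\<exists>f. x = sum_list (map f [0..<length Ls]) \<and> (\<forall>r<length Ls. map f [0..<length Ls] ! r \<in> Ls ! r))"
    unfolding mem_Collect_eq by (rule list_choice)
  also have "\<dots> \<longleftrightarrow> (\<exists>f. x = (\<Sum>r<length Ls. f r) \<and> (\<forall>r<length Ls. f r \<in> Ls ! r))"
    by (simp add: interv_sum_list_conv_sum_set_nat lessThan_atLeast0)
  finally show ?thesis .
qed

lemma orth: "r < length Ls \<Longrightarrow> r' < length Ls \<Longrightarrow> r \<noteq> r' \<Longrightarrow> x \<in> Ls ! r \<Longrightarrow> y \<in> Ls ! r' \<Longrightarrow> h x y = 0"
  by (rule dec[unfolded orth_decomp_def quat_folds, THEN conjunct2, THEN conjunct2, rule_format])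

lemma zero_comp: "r < length Ls \<Longrightarrow> 0 \<in> Ls ! r"
proof -
  assume "r < length Ls"
  then obtain bs where bs: "Ls ! r = ospan val bs" using free[of r] unfolding free_rank_def by metis
  have "\<exists>c. (\<forall>i<length bs. qdv 0 (c i)) \<and> 0 = (\<Sum>i<length bs. smul (c i) (bs ! i))"
    by (rule exI[of _ "\<lambda>_. 0"]) (simp add: smul_simps)
  then show ?thesis unfolding bs ospan_iff .
qed

lemma comp_sub: assumes "r < length Ls" "x \<in> Ls ! r" shows "x \<in> L"
proof -
  have "x = (\<Sum>i<length Ls. if i = r then x else 0)" using assms(1) by simp
  moreover have "\<forall>i<length Ls. (if i = r then x else 0) \<in> Ls ! i" using assms zero_comp by simp
  ultimately have "\<exists>f. x = (\<Sum>i<length Ls. f i) \<and> (\<forall>i<length Ls. f i \<in> Ls ! i)"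
    by (intro exI[of _ "\<lambda>i. if i = r then x else 0"]) (rule conjI)
  then show ?thesis unfolding L_iff .
qed

lemma comp_V: "r < length Ls \<Longrightarrow> x \<in> Ls ! r \<Longrightarrow> V x"
  using comp_sub omoduleD(2)[OF omodule_L] by blast

lemma comp_proj:
  assumes "r < length Ls" "z \<in> L"
  obtains z' where "z' \<in> Ls ! r" "\<And>s. s \<in> Ls ! r \<Longrightarrow> h z s = h z' s"
proof -
  obtain f where f: "z = (\<Sum>r<length Ls. f r)" "\<forall>r<length Ls. f r \<in> Ls ! r" using assms(2) unfolding L_iff by blast
  have "h z s = h (f r) s" if s: "s \<in> Ls ! r" for s
  proof -
    have "h z s = (\<Sum>i<length Ls. if i = r then h (f r) s else 0)"
      unfolding f(1) hform_sum using f s assms(1) orth by (intro sum.cong) auto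
    then show ?thesis using assms(1) by simp
  qed
  then show thesis using that f assms by blast
qed

lemma L_spans: "V x \<Longrightarrow> \<exists>m c g. x = (\<Sum>i<m. smul (c i) (g i)) \<and> (\<forall>i<(m::nat). g i \<in> L)"
proof -
  assume x: "V x"
  obtain gs where gs: "L = ospan val gs" "dspan gs = {x. V x}" using lat unfolding is_lattice_def by blast
  have "gs ! i \<in> L" if "i < length gs" for i
    unfolding gs(1) ospan_iff using that
    by (intro exI[of _ "\<lambda>j. if j = i then 1 else 0"]) (auto simp: if_distrib[of "\<lambda>c. smul c _"] smul_simps sum.delta cong: if_cong)
  moreover have "x \<in> dspan gs" using x gs by blast
  ultimately show ?thesis unfolding dspan_iff by blast
qed

lemma nondeg_L: "V x \<Longrightarrow> (\<And>z. z \<in> L \<Longrightarrow> h x z = 0) \<Longrightarrow> x = 0"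
proof (erule nondeg')
  fix y assume *: "\<And>z. z \<in> L \<Longrightarrow> h x z = 0" "V y"
  obtain m c g where "y = (\<Sum>i<m. smul (c i) (g i))" "\<forall>i<(m::nat). g i \<in> L" using L_spans[OF *(2)] by blast
  then show "h x y = 0" using * by (simp add: hform_sum hform_linear)
qed

lemma nondeg_comp:
  assumes "r < length Ls" "x \<in> Ls ! r" "\<And>z. z \<in> Ls ! r \<Longrightarrow> h x z = 0"
  shows "x = 0"
proof (rule nondeg_L)
  show "V x" using assms comp_V by blast
  fix z assume "z \<in> L"
  then obtain z' where "z' \<in> Ls ! r" "h z x = h z' x" using comp_proj[OF assms(1)] assms(2) by metis
  then show "h x z = 0" using assms(3) h_zero_sym by metis
qed

lemma gen_facts:
  assumes "r < length Ls" "gen val (Ls ! r) x"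
  shows "x \<in> Ls ! r" "h x x \<noteq> 0" "V x" "x \<noteq> 0" "z \<in> Ls ! r \<longleftrightarrow> (\<exists>c. qdv 0 c \<and> z = smul c x)"
proof -
  have g: "x \<noteq> 0" "Ls ! r = ospan val [x]" using assms unfolding gen_def vec_folds by auto
  show z: "z \<in> Ls ! r \<longleftrightarrow> (\<exists>c. qdv 0 c \<and> z = smul c x)" for z unfolding g(2) by (rule ospan_1)
  show x: "x \<in> Ls ! r" unfolding z by (intro exI[of _ 1]) (simp add: smul_simps)
  show "V x" using comp_V[OF assms(1) x] .
  show "x \<noteq> 0" by fact
  show "h x x \<noteq> 0"
  proof
    assume "h x x = 0"
    have "x = 0" by (rule nondeg_comp[OF assms(1) x]) (use \<open>h x x = 0\<close> z in \<open>auto simp: hform_linear\<close>)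
    then show False using g by simp
  qed
qed

lemma gen_proj:
  assumes "r < length Ls" "gen val (Ls ! r) x" "z \<in> L"
  obtains d where "qdv 0 d" "h z x = d * h x x"
proof -
  obtain z' where z': "z' \<in> Ls ! r" "h z x = h z' x"
    using comp_proj[OF assms(1,3)] gen_facts(1)[OF assms(1,2)] by metis
  then obtain d where "qdv 0 d" "z' = smul d x" using gen_facts(5)[OF assms(1,2)] by blast
  then show thesis using that z' by (simp add: hform_linear)
qed

lemma gen_proj_dv:
  assumes "r < length Ls" "gen val (Ls ! r) x" "z \<in> L"
  shows "qdv (qnu val (h x x)) (h z x)"
proof -
  obtain d where "qdv 0 d" "h z x = d * h x x" using gen_proj[OF assms] .
  moreover have "qdv (qnu val (h x x)) (h x x)" using gen_facts(2)[OF assms(1,2)] by (simp add: qdv_iff)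
  ultimately show ?thesis using qdv_mult[of 0 d] by fastforce
qed

lemma gen_norms:
  assumes "r < length Ls" "gen val (Ls ! r) x" "c\<^sup>2 + qnorm (h x x) * d\<^sup>2 \<noteq> 0"
  shows "c\<^sup>2 + qnorm (h x x) * d\<^sup>2 \<in> Hgrp n Hm L"
proof (rule norms_in_Hgrp[OF omodule_L comp_sub[OF assms(1) gen_facts(1)[OF assms(1,2)]] gen_facts(2)[OF assms(1,2)]
      gen_proj_dv[OF assms(1,2)] _ assms(3)])
  fix r
  have a: "h x x \<noteq> 0" using gen_facts(2)[OF assms(1,2)] .
  have "pure (qof (1/2) * h x x)" using pure_h by (simp add: pure_iff)
  then have s: "sum3 (qnorm (qof (1/2) * h x x))" using a by (intro pure_sum3) auto
  have eq: "qnorm (qof (1/2) * h x x) = qnorm (h x x) / 4" by (simp add: qnorm_mult power_divide)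
  \<comment> \<open>Division by four lowers the valuation by two, so the general bound on
    \<open>r\<^sup>2 + g\<close> is exactly what integrality along a generator demands.\<close>
  have k: "val (qnorm (h x x) / 4) + 3 = qnu val (h x x) + 1" using a by (simp add: val_divide qnu_def)
  show "\<not> dv (qnu val (h x x) + 1) (r\<^sup>2 + qnorm (h x x) / 4)"
    using sum3_bound[OF s, of r] unfolding eq k .
qed

lemma sqc_eq_iff: "c \<noteq> 0 \<Longrightarrow> d \<noteq> 0 \<Longrightarrow> c * d = y\<^sup>2 \<Longrightarrow> sqc c = sqc (d :: 'k)"
proof -
  have *: "sqc c \<subseteq> sqc d" if "c \<noteq> 0" "d \<noteq> 0" "c * d = y\<^sup>2" for c d :: 'k
  proof
    fix z assume "z \<in> sqc c"
    then obtain x where x: "z = c * x\<^sup>2" "x \<noteq> 0" by (auto simp: sqc_def)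
    have c: "c = d * (y / d)\<^sup>2" using that by (simp add: power_divide field_simps power2_eq_square)
    have "z = d * (y / d * x)\<^sup>2" by (subst x(1), subst c) (simp only: power_mult_distrib mult.assoc)
    moreover have "y / d * x \<noteq> 0" using that x by auto
    ultimately show "z \<in> sqc d" by (auto simp: sqc_def)
  qed
  assume "c \<noteq> 0" "d \<noteq> 0" "c * d = y\<^sup>2"
  then show ?thesis using *[of c d] *[of d c] by (simp add: mult.commute)
qed

lemma Hgrp_distinct_classes:
  assumes "card (Aset val n Hm Ls) > 1"
  shows "Hgrp n Hm L = {c. c \<noteq> 0}"
proof -
  obtain A B where AB: "A \<in> Aset val n Hm Ls" "B \<in> Aset val n Hm Ls" "A \<noteq> B"
  proof -
    have "\<not> card (Aset val n Hm Ls) \<le> Suc 0" "finite (Aset val n Hm Ls)" using assms card.infinite by fastforce+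
    then show thesis using that by (meson card_le_Suc0_iff_eq)
  qed
  obtain r x where x: "r < length Ls" "gen val (Ls ! r) x" "A = sqc (qnorm (h x x))" using AB(1) by (auto simp: Aset_def)
  obtain r' x' where x': "r' < length Ls" "gen val (Ls ! r') x'" "B = sqc (qnorm (h x' x'))" using AB(2) by (auto simp: Aset_def)
  show ?thesis
  proof (rule Hgrp_full[OF _ _ _ gen_norms[OF x(1,2)] gen_norms[OF x'(1,2)]])
    show "sum3 (qnorm (h x x))" "sum3 (qnorm (h x' x'))"
      using pure_sum3[OF pure_h] gen_facts(2) x x' by blast+
    show "qnorm (h x x) * qnorm (h x' x') \<noteq> y\<^sup>2" for y
      using sqc_eq_iff[of "qnorm (h x x)" "qnorm (h x' x')" y] AB(3) x x' gen_facts(2) by auto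
  qed
qed

end


section \<open>Orthogonal sums of two close rank-one components\<close>

context Q2_field
begin

definition un :: "'k \<Rightarrow> bool" where "un x \<longleftrightarrow> x \<noteq> 0 \<and> val x = 0"

lemma un_iff: "un x \<longleftrightarrow> dv 0 x \<and> \<not> dv 1 x"
  unfolding un_def dv_def by auto

lemma un_mult: "un x \<Longrightarrow> un y \<Longrightarrow> un (x * y)" by (simp add: un_def val_mult)

lemma un_dv: "un x \<Longrightarrow> dv 0 x" by (simp add: un_iff)

lemma un_add: "un x \<Longrightarrow> dv 1 y \<Longrightarrow> un (x + y)"
proof -
  assume x: "un x" and y: "dv 1 y"
  have "dv 0 (x + y)" using x y by (intro dv_add) (simp_all add: un_iff dv_mono[of 1])
  moreover have "\<not> dv 1 (x + y)" using dv_diff[of 1 "x + y" y] x y by (auto simp: un_iff)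
  ultimately show ?thesis by (simp add: un_iff)
qed

lemma un_add_un: "un x \<Longrightarrow> un y \<Longrightarrow> dv 1 (x + y)"
proof -
  assume "un x" "un y"
  then obtain s t where st: "x = 1 + 2 * s" "dv 0 s" "y = 1 + 2 * t" "dv 0 t" unfolding un_def by (metis unit_odd)
  then have eq: "x + y = 2 * (1 + s + t)" by simp
  have "dv 0 (1 + s + t)" using st by (intro dv_add) auto
  then show ?thesis unfolding eq by (simp only: dv_2) simp
qed

lemma not_dv_add: "dv m x \<Longrightarrow> \<not> dv m y \<Longrightarrow> \<not> dv m (x + y)"
  using dv_diff[of m "x + y" x] by auto

lemma not_square_odd: "z \<noteq> 0 \<Longrightarrow> odd (val z) \<Longrightarrow> z \<noteq> y\<^sup>2"
  by (auto simp: val_power)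

lemma not_square_unit:
  assumes u: "un u" "\<not> dv 3 (u - 1)" and z: "z = 2 powi (2 * m) * u"
  shows "z \<noteq> y\<^sup>2"
proof
  assume "z = y\<^sup>2"
  then have "u = (y / 2 powi m)\<^sup>2"
    using z power_int_2_val(2)[of "2 * m"] by (simp add: power_divide powi_sq eq_divide_eq mult.commute)
  moreover have "dv 3 ((y / 2 powi m)\<^sup>2 - 1)"
  proof (rule unit_square)
    show "y / 2 powi m \<noteq> 0" using u calculation by (auto simp: un_def)
    show "val (y / 2 powi m) = 0" using u calculation by (auto simp: un_def val_power)
  qed
  ultimately show False using u by simp
qed

text \<open>Three squares do not cancel modulo 4, so for pure quaternions the norm controls each
  coordinate. Without purity this fails: \<open>omega\<close> below has norm one and half-integral
  coordinates.\<close>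

lemma pure_normal:
  assumes "pure a" "qdv (2 * e) a"
  obtains p q r where "a = qof (2 powi e) * Quat 0 p q r" "dv 0 p" "dv 0 q" "dv 0 r"
    "qnorm a = 2 powi (2 * e) * (p\<^sup>2 + q\<^sup>2 + r\<^sup>2)"
proof -
  obtain p q r where a: "a = Quat 0 p q r" using assms(1) by (rule pureE)
  define s where "s = (2 powi e :: 'k)"
  have s: "s \<noteq> 0" "val s = e" using power_int_2_val[of e] by (simp_all add: s_def)
  have d: "dv e p" "dv e q" "dv e r" using pure_dv[of e p q r] assms(2) a by auto
  have i: "dv 0 (x / s)" if "dv e x" for x using that s by (cases "x = 0") (auto simp: dv_def val_divide)
  have a': "a = qof s * Quat 0 (p / s) (q / s) (r / s)" using s by (simp add: a qof_mult_Quat)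
  moreover have "qnorm a = 2 powi (2 * e) * ((p / s)\<^sup>2 + (q / s)\<^sup>2 + (r / s)\<^sup>2)"
    unfolding a' by (simp add: qnorm_mult s_def powi_sq)
  ultimately show thesis using that[of "p / s" "q / s" "r / s"] d i by (simp add: s_def)
qed

definition omega :: "'k quat" where "omega = Quat (1/2) (1/2) (1/2) (1/2)"

lemma omega: "qnorm omega = 1" "omega * Quat 0 p q r * qconj omega = Quat 0 r p q"
  by (simp_all add: omega_def Quat_ops power_divide field_simps)

lemma one_odd:
  assumes "dv 0 p" "dv 0 q" "dv 0 r" "dv 2 (p\<^sup>2 + q\<^sup>2 + r\<^sup>2 - 1)"
  shows "(un p \<and> dv 1 q \<and> dv 1 r) \<or> (dv 1 p \<and> un q \<and> dv 1 r) \<or> (dv 1 p \<and> dv 1 q \<and> un r)"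
proof -
  define l where "l = length (filter (\<lambda>x. \<not> dv 1 x) [p, q, r, 0])"
  have "dv 2 (of_nat l - 1)"
    using dv_diff[OF assms(4) parity_sum[OF assms(1-3), of 0, folded l_def]] assms by (simp add: dv_minus[of 2 "1 - of_nat l", symmetric])
  moreover have "l \<in> {0,1,2,3}" by (auto simp: l_def)
  ultimately have "l = 1" by (auto simp: dv_num)
  then show ?thesis using assms by (auto simp: l_def un_iff split: if_splits)
qed

lemma two_odd:
  assumes "dv 0 p" "dv 0 q" "dv 0 r" "dv 2 (p\<^sup>2 + q\<^sup>2 + r\<^sup>2 - 2)"
  shows "(dv 1 p \<and> un q \<and> un r) \<or> (un p \<and> dv 1 q \<and> un r) \<or> (un p \<and> un q \<and> dv 1 r)"
proof -
  define l where "l = length (filter (\<lambda>x. \<not> dv 1 x) [p, q, r, 0])"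
  have "dv 2 (of_nat l - 2)"
    using dv_diff[OF assms(4) parity_sum[OF assms(1-3), of 0, folded l_def]] assms by (simp add: dv_minus[of 2 "2 - of_nat l", symmetric])
  moreover have "l \<in> {0,1,2,3}" by (auto simp: l_def)
  ultimately have "l = 2" by (auto simp: dv_num)
  then show ?thesis using assms by (auto simp: l_def un_iff split: if_splits)
qed

text \<open>Conjugation by \<^term>\<open>omega\<close> permutes the coordinates cyclically, so the parity patterns can be made different.\<close>

lemma rotate_one_odd:
  assumes A: "dv 0 p" "dv 0 q" "dv 0 r" "dv 2 (p\<^sup>2 + q\<^sup>2 + r\<^sup>2 - 1)"
    and A': "dv 0 p'" "dv 0 q'" "dv 0 r'" "dv 2 (p'\<^sup>2 + q'\<^sup>2 + r'\<^sup>2 - 1)"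
  obtains c P Q R where "qnorm c = 1" "c * Quat 0 p' q' r' * qconj c = Quat 0 P Q R"
    "P\<^sup>2 + Q\<^sup>2 + R\<^sup>2 = p'\<^sup>2 + q'\<^sup>2 + r'\<^sup>2" "dv 0 P" "dv 0 Q" "dv 0 R" "dv 1 (p * P + q * Q + r * R)"
proof (cases "dv 1 (p * p' + q * q' + r * r')")
  case True
  then show ?thesis using that[of 1 p' q' r'] A' by simp
next
  case False
  note m = dv_multL dv_multR un_dv dv_add
  have m1: "dv 1 x \<Longrightarrow> un y \<Longrightarrow> dv 1 (x * y)" "un x \<Longrightarrow> dv 1 y \<Longrightarrow> dv 1 (x * y)" "dv 1 x \<Longrightarrow> dv 1 y \<Longrightarrow> dv 1 (x * y)" for x y
    using dv_multL[of 1 x y] dv_multR[of 1 y x] un_dv dv_mono[of 1 y 0] by auto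
  have "dv 1 (p * r' + q * p' + r * q')"
    using one_odd[OF A] one_odd[OF A'] False by (elim disjE conjE; simp add: dv_add m1)
  then show ?thesis using that[of omega r' p' q'] A' by (simp add: omega add_ac)
qed

text \<open>Here an odd inner product is wanted. Two equal patterns with two odd entries share two
  odd places, two patterns shifted against each other share exactly one.\<close>

lemma rotate_two_odd:
  assumes A: "dv 0 p" "dv 0 q" "dv 0 r" "dv 2 (p\<^sup>2 + q\<^sup>2 + r\<^sup>2 - 2)"
    and A': "dv 0 p'" "dv 0 q'" "dv 0 r'" "dv 2 (p'\<^sup>2 + q'\<^sup>2 + r'\<^sup>2 - 2)"
  obtains c P Q R where "qnorm c = 1" "c * Quat 0 p' q' r' * qconj c = Quat 0 P Q R"
    "P\<^sup>2 + Q\<^sup>2 + R\<^sup>2 = p'\<^sup>2 + q'\<^sup>2 + r'\<^sup>2" "dv 0 P" "dv 0 Q" "dv 0 R" "un (p * P + q * Q + r * R)"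
proof (cases "un (p * p' + q * q' + r * r')")
  case True
  then show ?thesis using that[of 1 p' q' r'] A' by simp
next
  case False
  have m1: "dv 1 x \<Longrightarrow> un y \<Longrightarrow> dv 1 (x * y)" "un x \<Longrightarrow> dv 1 y \<Longrightarrow> dv 1 (x * y)" "dv 1 x \<Longrightarrow> dv 1 y \<Longrightarrow> dv 1 (x * y)" for x y
    using dv_multL[of 1 x y] dv_multR[of 1 y x] un_dv dv_mono[of 1 y 0] by auto
  have un3: "un (x + y + z)" if "un x \<and> dv 1 y \<and> dv 1 z \<or> dv 1 x \<and> un y \<and> dv 1 z \<or> dv 1 x \<and> dv 1 y \<and> un z" for x y z
    using that un_add[of x "y + z"] un_add[of y "x + z"] un_add[of z "x + y"] dv_add by (auto simp: add_ac)
  have "un (p * r' + q * p' + r * q')"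
    using two_odd[OF A] two_odd[OF A'] False by (elim disjE conjE; simp add: un3 un_mult m1)
  then show ?thesis using that[of omega r' p' q'] A' by (simp add: omega add_ac)
qed

end

context decomposed_lattice
begin

text \<open>The generator \<open>x\<close> contributes its own norm group unconditionally. The
  vector \<open>smul c x + smul c' x'\<close>, on which the form takes the value \<gamma>, supplies
  the second one if its class is new and \<open>M\<close> is large enough.\<close>

lemma pair_full:
  assumes r: "r < length Ls" "gen val (Ls ! r) x" and r': "r' < length Ls" "gen val (Ls ! r') x'" and ne: "r \<noteq> r'"
    and c: "qdv 0 c" "qdv 0 c'" and g: "\<gamma> = c * h x x * qconj c + c' * h x' x' * qconj c'" "\<gamma> \<noteq> 0"
    and M: "qdv M (h x x * qconj c)" "qdv M (h x' x' * qconj c')"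
    and bound: "\<And>r. \<not> dv (M + 1) (r\<^sup>2 + qnorm \<gamma> / 4)"
    and nsq: "\<And>y. qnorm (h x x) * qnorm \<gamma> \<noteq> y\<^sup>2"
  shows "Hgrp n Hm L = {c. c \<noteq> 0}"
proof -
  define s where "s = smul c x + smul c' x'"
  have xL: "x \<in> Ls ! r" "x' \<in> Ls ! r'" using gen_facts(1) r r' by blast+
  have o: "h x x' = 0" "h x' x = 0" using orth[OF r(1) r'(1) ne xL] orth[OF r'(1) r(1) _ xL(2,1)] ne by auto
  have s: "s \<in> L" unfolding s_def using comp_sub[OF r(1) xL(1)] comp_sub[OF r'(1) xL(2)] c omoduleD[OF omodule_L] by blast
  have hs: "h s s = \<gamma>" unfolding s_def g by (simp add: hform_linear o mult.assoc)
  have zM: "qdv M (h z s)" if z: "z \<in> L" for z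
  proof -
    obtain d where d: "qdv 0 d" "h z x = d * h x x" using gen_proj[OF r z] .
    obtain d' where d': "qdv 0 d'" "h z x' = d' * h x' x'" using gen_proj[OF r' z] .
    have "h z s = d * (h x x * qconj c) + d' * (h x' x' * qconj c')"
      unfolding s_def by (simp add: hform_linear d d' mult.assoc)
    then show ?thesis using qdv_mult[OF d(1) M(1)] qdv_mult[OF d'(1) M(2)] qdv_add by simp
  qed
  have "pure (h x x)" by simp
  show ?thesis
  proof (rule Hgrp_full[OF _ _ nsq gen_norms[OF r]])
    show "sum3 (qnorm (h x x))" using pure_sum3[OF pure_h] gen_facts(2)[OF r] by blast
    show "sum3 (qnorm \<gamma>)" using pure_sum3[OF pure_h, of s] hs g(2) by simp
    show "u\<^sup>2 + qnorm \<gamma> * v\<^sup>2 \<in> Hgrp n Hm L" if "u\<^sup>2 + qnorm \<gamma> * v\<^sup>2 \<noteq> 0" for u v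
      using norms_in_Hgrp[OF omodule_L s _ zM, of u v] bound that hs g(2) by simp
  qed
qed

text \<open>An infimum strictly below a bound is undercut by an actual pair; in particular such a
  pair exists, as the infimum over the empty set is infinite.\<close>

lemma mu_witness:
  assumes "0 \<le> mu val n Hm Ls" "mu val n Hm Ls < ereal (real_of_int m)"
  obtains r r' x x' where "r < length Ls" "r' < length Ls" "r \<noteq> r'" "gen val (Ls ! r) x" "gen val (Ls ! r') x'"
    "0 \<le> qnu val (h x' x') - qnu val (h x x)" "qnu val (h x' x') - qnu val (h x x) < m"
proof -
  let ?S = "{qnu val (h x' x') - qnu val (h x x) | r r' x x'. consec val Ls r r' \<and> gen val (Ls!r) x \<and> gen val (Ls!r') x'}"
  have "\<exists>d\<in>?S. ereal (real_of_int d) < ereal (real_of_int m)"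
    using assms(2) unfolding mu_def INF_less_iff .
  then obtain d where d: "d \<in> ?S" and "ereal (real_of_int d) < ereal (real_of_int m)" by (rule bexE)
  then have "d < m" by simp
  have "0 \<le> ereal (real_of_int d)" using assms(1) d unfolding mu_def by (meson INF_lower order_trans)
  then have "0 \<le> d" by simp
  obtain r r' x x' where *: "d = qnu val (h x' x') - qnu val (h x x)" "consec val Ls r r'"
    "gen val (Ls!r) x" "gen val (Ls!r') x'" using d by blast
  show thesis
  proof (rule that[OF _ _ _ *(3,4)])
    show "r < length Ls" "r' < length Ls" "r \<noteq> r'" using *(2) unfolding consec_def by auto
    show "0 \<le> qnu val (h x' x') - qnu val (h x x)" "qnu val (h x' x') - qnu val (h x x) < m"
      using \<open>0 \<le> d\<close> \<open>d < m\<close> *(1) by simp_all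
  qed
qed

end


section \<open>Close components with norms of even valuation\<close>

context Q2_field
begin

lemma powi_mult: "(2::'k) powi i * 2 powi j = 2 powi (i + j)"
  by (simp add: power_int_add)

lemma sum3_quarter: "sum3 g \<Longrightarrow> sum3 (g / 4)"
proof -
  assume "sum3 g"
  then obtain a b c where "g = a\<^sup>2 + b\<^sup>2 + c\<^sup>2" "g \<noteq> 0" by (auto simp: sum3_def)
  moreover have "(a\<^sup>2 + b\<^sup>2 + c\<^sup>2) / 4 = (a / 2)\<^sup>2 + (b / 2)\<^sup>2 + (c / 2)\<^sup>2"
    by (simp add: power_divide add_divide_distrib)
  ultimately have "g / 4 = (a / 2)\<^sup>2 + (b / 2)\<^sup>2 + (c / 2)\<^sup>2 \<and> g / 4 \<noteq> 0" by simp
  then show ?thesis unfolding sum3_def by blast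
qed

lemma gamma_norm:
  "qnorm (qof (2 powi f) * (Quat 0 p q r + qof (t::'k) * Quat 0 P Q R)) =
     2 powi (2 * f) * ((p\<^sup>2 + q\<^sup>2 + r\<^sup>2) + 2 * t * (p * P + q * Q + r * R) + t\<^sup>2 * (P\<^sup>2 + Q\<^sup>2 + R\<^sup>2))"
proof -
  have eq: "Quat 0 p q r + qof t * Quat 0 P Q R = Quat 0 (p + t * P) (q + t * Q) (r + t * R)"
    by (simp add: Quat_ops qof_def)
  have "(p + t * P)\<^sup>2 + (q + t * Q)\<^sup>2 + (r + t * R)\<^sup>2 =
    (p\<^sup>2 + q\<^sup>2 + r\<^sup>2) + 2 * t * (p * P + q * Q + r * R) + t\<^sup>2 * (P\<^sup>2 + Q\<^sup>2 + R\<^sup>2)"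
    by (simp add: power2_eq_square algebra_simps)
  then show ?thesis unfolding eq qnorm_mult qnorm_simps powi_sq qnorm.simps by simp
qed

lemma unit_class_5:
  assumes N: "N = y\<^sup>2 \<or> N = 5 * y\<^sup>2" "y \<noteq> 0" and N0: "N = 2 powi (2 * val y) * N0"
  shows "dv 2 (N0 - 1)"
proof -
  define z where "z = y / 2 powi (val y)"
  have p: "(2::'k) powi (val y) \<noteq> 0" "(2::'k) powi (2 * val y) \<noteq> 0" by simp_all
  have "z \<noteq> 0" "val z = 0" using N(2) power_int_2_val[of "val y"] by (simp_all add: z_def val_divide)
  then have z: "dv 2 (z\<^sup>2 - 1)" by (rule dv_mono[OF unit_square]) simp
  have zz: "y\<^sup>2 = 2 powi (2 * val y) * z\<^sup>2" by (simp add: z_def power_divide powi_sq)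
  from N(1) show ?thesis
  proof
    assume "N = y\<^sup>2"
    then have "N0 = z\<^sup>2" using N0 zz p by simp
    then show ?thesis using z by simp
  next
    assume "N = 5 * y\<^sup>2"
    then have "2 powi (2 * val y) * N0 = 2 powi (2 * val y) * (5 * z\<^sup>2)" using N0 zz by simp
    then have "N0 = 5 * z\<^sup>2" using p by simp
    then have "N0 - 1 = 5 * (z\<^sup>2 - 1) + 4 * 1" by simp
    moreover have "dv 2 (5 * (z\<^sup>2 - 1) + 4 * 1)" using dv_multR[OF z, of 5] by (intro dv_add) (simp_all only: dv_4, simp_all)
    ultimately show ?thesis by metis
  qed
qed

lemma un_of_dv2: "dv 2 (x - 1) \<Longrightarrow> un x"
  using un_add[of 1 "x - 1"] dv_mono[of 2 "x - 1" 1] by (simp add: un_def)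

text \<open>Conjugation with \<open>1 + i\<close> doubles a pure quaternion up to a signed
  permutation of its coordinates. It serves to adjust the ratio of two components by a single factor
  of two.\<close>

lemma conj_1_i: "Quat 1 1 0 0 * Quat 0 p q r * qconj (Quat 1 1 0 0) = qof 2 * Quat 0 p (- r) q"
  by (simp add: Quat_ops qof_def)

end

context decomposed_lattice
begin

text \<open>The valuations are \<open>2 * e\<close> and \<open>2 * (e + k)\<close> with
  \<open>k\<close> at most 2. The coefficients make the new value a power of two times
  \<open>A + t B\<close>, where \<open>A\<close> and \<open>B\<close> are integral with norms 1
  modulo 4 and \<open>t\<close> is 1 or 2; an even inner product of \<open>A\<close> and
  \<open>B\<close> then leads to a new class.\<close>

lemma Hgrp_close_unit_classes:
  assumes A: "\<And>r x. r < length Ls \<Longrightarrow> gen val (Ls ! r) x \<Longrightarrow> \<exists>y. y \<noteq> 0 \<and> (qnorm (h x x) = y\<^sup>2 \<or> qnorm (h x x) = 5 * y\<^sup>2)"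
    and mu: "0 \<le> mu val n Hm Ls" "mu val n Hm Ls < ereal (real_of_int 6)"
  shows "Hgrp n Hm L = {c. c \<noteq> 0}"
proof -
  obtain r r' x x' where r: "r < length Ls" "gen val (Ls ! r) x" and r': "r' < length Ls" "gen val (Ls ! r') x'"
    and ne: "r \<noteq> r'" and d: "0 \<le> qnu val (h x' x') - qnu val (h x x)" "qnu val (h x' x') - qnu val (h x x) < 6"
    using mu_witness[OF mu] by metis
  define a where "a = h x x"
  define a' where "a' = h x' x'"
  obtain y where y: "y \<noteq> 0" "qnorm a = y\<^sup>2 \<or> qnorm a = 5 * y\<^sup>2" using A[OF r] unfolding a_def by blast
  obtain y' where y': "y' \<noteq> 0" "qnorm a' = y'\<^sup>2 \<or> qnorm a' = 5 * y'\<^sup>2" using A[OF r'] unfolding a'_def by blast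
  define e where "e = val y"
  define k where "k = val y' - e"
  have qa: "qnu val a = 2 * e" using y by (auto simp: qnu_def e_def val_power val_mult)
  have qa': "qnu val a' = 2 * (e + k)" using y' by (auto simp: qnu_def k_def val_power val_mult)
  have k: "k = 0 \<or> k = 1 \<or> k = 2" using d qa qa' unfolding a_def[symmetric] a'_def[symmetric] by auto
  have a0: "a \<noteq> 0" "a' \<noteq> 0" using gen_facts(2)[OF r] gen_facts(2)[OF r'] by (simp_all add: a_def a'_def)
  have pa: "pure a" "pure a'" by (simp_all add: a_def a'_def)
  have da: "qdv (2 * e) a" "qdv (2 * (e + k)) a'" using a0 qa qa' by (simp_all add: qdv_iff)
  obtain p q s where P: "a = qof (2 powi e) * Quat 0 p q s" "dv 0 p" "dv 0 q" "dv 0 s"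
    "qnorm a = 2 powi (2 * e) * (p\<^sup>2 + q\<^sup>2 + s\<^sup>2)" by (rule pure_normal[OF pa(1) da(1)])
  obtain p' q' s' where P': "a' = qof (2 powi (e + k)) * Quat 0 p' q' s'" "dv 0 p'" "dv 0 q'" "dv 0 s'"
    "qnorm a' = 2 powi (2 * (e + k)) * (p'\<^sup>2 + q'\<^sup>2 + s'\<^sup>2)" by (rule pure_normal[OF pa(2) da(2)])
  define N0 where "N0 = p\<^sup>2 + q\<^sup>2 + s\<^sup>2"
  define N0' where "N0' = p'\<^sup>2 + q'\<^sup>2 + s'\<^sup>2"
  have N0: "dv 2 (N0 - 1)" using unit_class_5[OF y(2,1), of N0] P(5) unfolding N0_def e_def by blast
  have N0': "dv 2 (N0' - 1)" using unit_class_5[OF y'(2,1), of N0'] P'(5) unfolding N0'_def k_def by simp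
  note un = un_of_dv2[OF N0] un_of_dv2[OF N0']
  \<comment> \<open>The three alternatives for \<open>t\<close>, \<open>f\<close> and
    \<open>M\<close> belong to \<open>k = 0\<close>, \<open>k = 1\<close> and \<open>k = 2\<close>;
    \<open>D\<close> is the inner product of the two pure quaternions and \<open>U\<close> the norm
    of their combination.\<close>
  have full: ?thesis
    if c: "qdv 0 c" "qdv 0 c'" and g: "c * a * qconj c + c' * a' * qconj c' = qof (2 powi f) * (Quat 0 p1 q1 s1 + qof t * Quat 0 P Q R)"
      and b1: "p1\<^sup>2 + q1\<^sup>2 + s1\<^sup>2 = N0" and B: "P\<^sup>2 + Q\<^sup>2 + R\<^sup>2 = N0'" "dv 1 (p1 * P + q1 * Q + s1 * R)"
      and M: "qdv M (a * qconj c)" "qdv M (a' * qconj c')"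
      and tf: "t = 1 \<and> f = e \<and> M = 2 * e \<or> t = 2 \<and> f = e \<and> M = 2 * e \<or> t = 2 \<and> f = e + 1 \<and> M = 2 * e + 1"
    for c c' f p1 q1 s1 t P Q R M
  proof -
    define \<gamma> where "\<gamma> = c * a * qconj c + c' * a' * qconj c'"
    define D where "D = p1 * P + q1 * Q + s1 * R"
    define U where "U = N0 + 2 * t * D + t\<^sup>2 * N0'"
    have N\<gamma>: "qnorm \<gamma> = 2 powi (2 * f) * U" unfolding \<gamma>_def g gamma_norm b1 B D_def U_def ..
    have Na: "qnorm a = 2 powi (2 * e) * N0" using P(5) by (simp add: N0_def)
    have D: "dv 1 D" using B(2) by (simp add: D_def)
    have p\<gamma>: "pure \<gamma>" unfolding \<gamma>_def using pa by (intro pure_add pure_conj)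
    show ?thesis
    proof (cases "t = 1")
      case True
      then have tf': "f = e" "M = 2 * e" using tf by auto
      \<comment> \<open>Two norms that are 1 modulo 4 and an even cross term make \<open>U\<close>
        congruent to 2 modulo 4, so the new norm has odd valuation and a class different from that
        of \<open>a\<close>.\<close>
      have eq: "U - 2 = (N0 - 1) + (N0' - 1) + 2 * D" using True by (simp add: U_def)
      have "dv 2 (U - 2)" unfolding eq using N0 N0' D by (intro dv_add) simp_all
      then have "dv 1 U" "\<not> dv 2 U"
        using dv_add[of 1 "U - 2" 2] dv_mono[of 2 "U - 2" 1] dv_diff[of 2 U "U - 2"] by (auto simp: dv_num)
      moreover from this have "U \<noteq> 0" by auto
      ultimately have U: "U \<noteq> 0" "val U = 1" using val_eq_dv[of U 1] by simp_all
      then have v: "qnorm \<gamma> \<noteq> 0" "val (qnorm \<gamma>) = 2 * e + 1" unfolding N\<gamma> tf' by (simp_all add: val_mult power_int_2_val)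
      have b: "\<not> dv (M + 1) (r\<^sup>2 + qnorm \<gamma> / 4)" for r
      proof -
        have "\<not> dv (2 * e - 1 + 1) (r\<^sup>2 + qnorm \<gamma> / 4)"
          using sum3_bound_odd[of "qnorm \<gamma> / 4" r] v by (simp add: val_divide)
        then show ?thesis using dv_mono[of "M + 1" _ "2 * e"] tf' by auto
      qed
      show ?thesis
      proof (rule pair_full[OF r r' ne c \<gamma>_def[unfolded a_def a'_def] _ M[unfolded a_def a'_def] b])
        show "\<gamma> \<noteq> 0" using v by auto
        show "qnorm (h x x) * qnorm \<gamma> \<noteq> y\<^sup>2" for y
          by (rule not_square_odd) (use v a0 qa in \<open>simp_all add: a_def val_mult qnu_def\<close>)
      qed
    next
      case False
      then have t2: "t = 2" using tf by auto
      have eq1: "U - 1 = (N0 - 1) + 4 * (D + N0')" using t2 by (simp add: U_def)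
      have "dv 0 (D + N0')" using dv_mono[OF D, of 0] un_dv[OF un(2)] by (intro dv_add) auto
      then have "dv 2 (4 * (D + N0'))" by (simp only: dv_4) simp
      then have U1: "dv 2 (U - 1)" unfolding eq1 using N0 by (intro dv_add)
      have Uu: "un U" using un_of_dv2[OF U1] .
      have v: "qnorm \<gamma> \<noteq> 0" "val (qnorm \<gamma>) = 2 * f" unfolding N\<gamma> using Uu by (auto simp: val_mult power_int_2_val un_def)
      have "un (N0 * N0')" using un by (rule un_mult)
      \<comment> \<open>Modulo 8 the product \<open>N0 * U\<close> is 5: the square contributes 1,
        the middle term vanishes because \<open>D\<close> is even, and the last one contributes
        4.\<close>
      have eq: "N0 * U - 1 = (N0\<^sup>2 - 1) + 4 * (N0 * D) + 4 * (N0 * N0')"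
        using t2 by (simp add: U_def algebra_simps power2_eq_square)
      have "dv 3 ((N0\<^sup>2 - 1) + 4 * (N0 * D))" using dv_multR[OF D un_dv[OF un(1)]] unit_square[of N0] un(1)
        by (intro dv_add) (auto simp: un_def)
      then have nd: "\<not> dv 3 (N0 * U - 1)" unfolding eq using \<open>un (N0 * N0')\<close> by (intro not_dv_add) (auto simp: un_iff)
      have b: "\<not> dv (M + 1) (r\<^sup>2 + qnorm \<gamma> / 4)" for r
      proof (cases "f = e")
        case True
        have "sum3 (qnorm \<gamma> / 4)" using p\<gamma> v by (intro sum3_quarter pure_sum3) auto
        from sum3_bound[OF this, of r] show ?thesis using v True tf t2 by (simp add: val_divide add.commute)
      next
        case False
        \<comment> \<open>The norm has grown by two powers of two but \<open>M\<close> by one only,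
          so the sharper bound for a unit part that is 1 modulo 4 is required.\<close>
        then have f: "f = e + 1" "M = 2 * e + 1" using tf t2 by auto
        have "qnorm \<gamma> / 4 = 2 powi (2 * e) * U" unfolding N\<gamma> f by (simp add: distrib_left power_int_add)
        from sum3_bound_1mod4[OF this U1, of r] show ?thesis using f by (simp add: add.commute)
      qed
      show ?thesis
      proof (rule pair_full[OF r r' ne c \<gamma>_def[unfolded a_def a'_def] _ M[unfolded a_def a'_def] b])
        show "\<gamma> \<noteq> 0" using v by auto
        show "qnorm (h x x) * qnorm \<gamma> \<noteq> y\<^sup>2" for y
        proof (rule not_square_unit)
          show "un (N0 * U)" using un(1) Uu by (rule un_mult)
          show "\<not> dv 3 (N0 * U - 1)" by (rule nd)
          show "qnorm (h x x) * qnorm \<gamma> = 2 powi (2 * (e + f)) * (N0 * U)"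
            unfolding a_def[symmetric] Na N\<gamma> by (simp add: distrib_left flip: powi_mult)
        qed
      qed
    qed
  qed
  have ma: "qdv M a" if "M \<le> 2 * e" for M using da(1) that by (rule qdv_mono)
  have ma': "qdv M a'" if "M \<le> 2 * (e + k)" for M using da(2) that by (rule qdv_mono)
  have qc: "qdv 0 c" "qdv 0 (qconj c)" if "qnorm c = 1" for c using that by (simp_all add: qdv_def)
  show ?thesis
  proof (cases "k = 2")
    case False
    define t where "t = (2::'k) powi k"
    have t: "t = 1 \<or> t = 2" using k False by (auto simp: t_def)
    obtain c P Q R where c: "qnorm c = 1" "c * Quat 0 p' q' s' * qconj c = Quat 0 P Q R"
      "P\<^sup>2 + Q\<^sup>2 + R\<^sup>2 = p'\<^sup>2 + q'\<^sup>2 + s'\<^sup>2" "dv 1 (p * P + q * Q + s * R)"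
      using rotate_one_odd[OF P(2-4) N0[unfolded N0_def] P'(2-4) N0'[unfolded N0'_def]] by metis
    have "c * a' * qconj c = qof (2 powi (e + k)) * (c * Quat 0 p' q' s' * qconj c)"
      unfolding P'(1) using qof_commute[of c "2 powi (e + k)"] by (simp flip: mult.assoc)
    then have g: "1 * a * qconj 1 + c * a' * qconj c = qof (2 powi e) * (Quat 0 p q s + qof t * Quat 0 P Q R)"
      unfolding c(2) P(1) by (simp add: distrib_left t_def qof_simps mult.assoc flip: powi_mult)
    show ?thesis
    proof (rule full[OF _ qc(1)[OF c(1)] g N0_def[symmetric] c(3)[folded N0'_def] c(4)])
      show "qdv (2 * e) (a * qconj 1)" using da by simp
      show "qdv (2 * e) (a' * qconj c)" using qdv_mult[OF ma'[of "2 * e"] qc(2)[OF c(1)]] k by auto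
      show "t = 1 \<and> e = e \<and> 2 * e = 2 * e \<or> t = 2 \<and> e = e \<and> 2 * e = 2 * e \<or> t = 2 \<and> e = e + 1 \<and> 2 * e = 2 * e + 1" using t by auto
    qed simp
  next
    case True
    \<comment> \<open>Scaling \<open>x\<close> by \<open>1 + i\<close> raises the valuation of its
      form value by two, hence the ratio 4 of the components becomes 2; the values
      \<open>h z s\<close> lose nothing because they gain one power themselves.\<close>
    define c0 :: "'k quat" where "c0 = Quat 1 1 0 0"
    have n0: "qdv 1 (qconj c0)" "qdv 0 c0" by (simp_all add: c0_def qdv_def dv_num)
    have b1: "p\<^sup>2 + (- s)\<^sup>2 + q\<^sup>2 = N0" by (simp add: N0_def)
    obtain c P Q R where c: "qnorm c = 1" "c * Quat 0 p' q' s' * qconj c = Quat 0 P Q R"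
      "P\<^sup>2 + Q\<^sup>2 + R\<^sup>2 = p'\<^sup>2 + q'\<^sup>2 + s'\<^sup>2" "dv 1 (p * P + (- s) * Q + q * R)"
      using rotate_one_odd[of p "- s" q p' q' s'] P(2-4) N0 P'(2-4) N0'[unfolded N0'_def] unfolding b1 dv_minus by metis
    have "c * a' * qconj c = qof (2 powi (e + k)) * (c * Quat 0 p' q' s' * qconj c)"
      unfolding P'(1) using qof_commute[of c "2 powi (e + k)"] by (simp flip: mult.assoc)
    moreover have "c0 * a * qconj c0 = qof (2 powi e) * (c0 * Quat 0 p q s * qconj c0)"
      unfolding P(1) using qof_commute[of c0 "2 powi e"] by (simp flip: mult.assoc)
    moreover have "qof (2 powi (e + k)) = qof (2 powi e) * qof 2 * (qof 2 :: 'k quat)" "qof (2 powi (e + 1)) = qof (2 powi e) * (qof 2 :: 'k quat)"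
      using True by (simp_all add: power_int_add flip: qof_simps)
    ultimately have g: "c0 * a * qconj c0 + c * a' * qconj c = qof (2 powi (e + 1)) * (Quat 0 p (- s) q + qof 2 * Quat 0 P Q R)"
      unfolding c(2) c0_def conj_1_i by (simp only: distrib_left mult.assoc)
    show ?thesis
    proof (rule full[OF n0(2) qc(1)[OF c(1)] g b1 c(3)[folded N0'_def] c(4)])
      show "qdv (2 * e + 1) (a * qconj c0)" using qdv_mult[OF da(1) n0(1)] .
      show "qdv (2 * e + 1) (a' * qconj c)" using qdv_mult[OF ma'[of "2 * e + 1"] qc(2)[OF c(1)]] True by simp
    qed simp
  qed
qed

end


section \<open>Close components with norms of odd valuation\<close>

context Q2_field
begin

lemma dv_16 [simp]: "dv m (16 * x) \<longleftrightarrow> dv (m - 4) x"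
  using dv_2[of m "8 * x"] by simp

text \<open>Squares of units agree modulo 8, and the common factor \<pi> adds one more power of two:
  the normalised norms agree modulo 16.\<close>

lemma prime_class:
  assumes \<pi>: "\<pi> \<noteq> 0" "val \<pi> = 1" and y: "y \<noteq> 0" "y' \<noteq> 0"
    and N0: "\<pi> * y\<^sup>2 = 2 powi (2 * val y) * N0" and N0': "\<pi> * y'\<^sup>2 = 2 powi (2 * val y') * N0'"
  obtains m w where "N0 = 2 * m" "un m" "N0' = N0 + 16 * w" "dv 0 w"
proof -
  define z where "z = y / 2 powi (val y)"
  define z' where "z' = y' / 2 powi (val y')"
  have u: "un z" "un z'" using y power_int_2_val by (simp_all add: z_def z'_def un_def val_divide)
  have yy: "y\<^sup>2 = 2 powi (2 * val y) * z\<^sup>2" "y'\<^sup>2 = 2 powi (2 * val y') * z'\<^sup>2"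
    by (simp_all add: z_def z'_def power_divide powi_sq)
  have "2 powi (2 * val y) * N0 = 2 powi (2 * val y) * (\<pi> * z\<^sup>2)" unfolding N0[symmetric] yy by simp
  then have n: "N0 = \<pi> * z\<^sup>2" by simp
  have "2 powi (2 * val y') * N0' = 2 powi (2 * val y') * (\<pi> * z'\<^sup>2)" unfolding N0'[symmetric] yy by simp
  then have n': "N0' = \<pi> * z'\<^sup>2" by simp
  have "dv 3 ((z'\<^sup>2 - 1) - (z\<^sup>2 - 1))" using u unfolding un_def by (intro dv_diff unit_square) auto
  then have "dv 3 (z'\<^sup>2 - z\<^sup>2)" by simp
  then have "dv (1 + 3) (\<pi> * (z'\<^sup>2 - z\<^sup>2))" using \<pi> by (intro dv_mult) (simp_all add: dv_def)
  then have d: "dv 4 (N0' - N0)" by (simp add: n n' algebra_simps)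
  define w where "w = (N0' - N0) / 16"
  have w: "N0' - N0 = 4 * (4 * w)" by (simp add: w_def)
  have "dv 0 w" using d unfolding w by simp
  moreover have "N0' = N0 + 16 * w" using w by (simp add: algebra_simps)
  moreover have "N0 = 2 * (N0 / 2)" by simp
  moreover have "un (N0 / 2)" using \<pi> u unfolding n un_def by (simp add: val_mult val_divide val_power)
  ultimately show thesis using that by blast
qed

lemma two_mod_four_add:
  assumes "dv 1 x" "\<not> dv 2 x" "dv 1 y" "\<not> dv 2 y" shows "dv 2 (x + y)"
proof -
  have h: "2 * (z / 2) = z" for z :: 'k by simp
  have "un (z / 2)" if "dv 1 z" "\<not> dv 2 z" for z
    using that dv_2[of 1 "z / 2"] dv_2[of 2 "z / 2"] unfolding h by (simp add: un_iff)
  then have "dv 1 (x / 2 + y / 2)" using assms by (intro un_add_un) auto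
  then have "dv 2 (2 * (x / 2 + y / 2))" by (subst dv_2) simp
  moreover have "2 * (x / 2 + y / 2) = x + y" by (simp add: distrib_left)
  ultimately show ?thesis by simp
qed

text \<open>A pure quaternion commutes with one plus itself, so this conjugation merely multiplies
  it by the norm of the conjugator.\<close>

lemma pure_norm_twist:
  "Quat 1 p q r * Quat 0 p q r * qconj (Quat 1 p q r) = qof (1 + (p\<^sup>2 + q\<^sup>2 + r\<^sup>2)) * Quat 0 p q r" for p :: 'k
  by (simp add: Quat_ops qof_def power2_eq_square algebra_simps)

lemma not_dv3: "dv 2 x \<Longrightarrow> un y \<Longrightarrow> \<not> dv 3 (x + 2 * y)" "dv 3 x \<Longrightarrow> un y \<Longrightarrow> \<not> dv 3 (x + 4 * y)"
proof -
  show "\<not> dv 3 (x + 2 * y)" if "dv 2 x" "un y"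
  proof -
    have "\<not> dv 2 (x + 2 * y)" using that by (intro not_dv_add) (simp_all add: un_iff)
    then show ?thesis using dv_mono[of 3 "x + 2 * y" 2] by auto
  qed
  show "dv 3 x \<Longrightarrow> un y \<Longrightarrow> \<not> dv 3 (x + 4 * y)"
    by (intro not_dv_add) (simp_all add: un_iff)
qed

end

context decomposed_lattice
begin

text \<open>The valuations are \<open>2 * e + 1\<close> and \<open>2 * (e + k) + 1\<close> with
  \<open>k\<close> at most 4. The normalised norms are twice a unit, so the patterns have two odd
  entries, and an odd inner product \<open>D\<close> makes the cross term change the class.\<close>

lemma Hgrp_close_prime_classes:
  assumes \<pi>: "\<pi> \<noteq> 0" "val \<pi> = 1"
    and A: "\<And>r x. r < length Ls \<Longrightarrow> gen val (Ls ! r) x \<Longrightarrow> \<exists>y. y \<noteq> 0 \<and> qnorm (h x x) = \<pi> * y\<^sup>2"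
    and mu: "0 \<le> mu val n Hm Ls" "mu val n Hm Ls < ereal (real_of_int 9)"
  shows "Hgrp n Hm L = {c. c \<noteq> 0}"
proof -
  obtain r r' x x' where r: "r < length Ls" "gen val (Ls ! r) x" and r': "r' < length Ls" "gen val (Ls ! r') x'"
    and ne: "r \<noteq> r'" and d: "0 \<le> qnu val (h x' x') - qnu val (h x x)" "qnu val (h x' x') - qnu val (h x x) < 9"
    using mu_witness[OF mu] by metis
  define a where "a = h x x"
  define a' where "a' = h x' x'"
  obtain y where y: "y \<noteq> 0" "qnorm a = \<pi> * y\<^sup>2" using A[OF r] unfolding a_def by blast
  obtain y' where y': "y' \<noteq> 0" "qnorm a' = \<pi> * y'\<^sup>2" using A[OF r'] unfolding a'_def by blast
  define e where "e = val y"
  define k where "k = val y' - e"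
  have qa: "qnu val a = 2 * e + 1" using y \<pi> by (auto simp: qnu_def e_def val_power val_mult)
  have qa': "qnu val a' = 2 * (e + k) + 1" using y' \<pi> by (auto simp: qnu_def k_def val_power val_mult)
  have k: "0 \<le> k" "k \<le> 4" using d qa qa' unfolding a_def[symmetric] a'_def[symmetric] by auto
  have a0: "a \<noteq> 0" "a' \<noteq> 0" using gen_facts(2)[OF r] gen_facts(2)[OF r'] by (simp_all add: a_def a'_def)
  have pa: "pure a" "pure a'" by (simp_all add: a_def a'_def)
  have ma: "qdv M a" if "M \<le> 2 * e + 1" for M using a0 qa that by (simp add: qdv_iff)
  have ma': "qdv M a'" if "M \<le> 2 * (e + k) + 1" for M using a0 qa' that by (simp add: qdv_iff)
  have da: "qdv (2 * e) a" "qdv (2 * (e + k)) a'" using ma ma' by simp_all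
  obtain p q s where P: "a = qof (2 powi e) * Quat 0 p q s" "dv 0 p" "dv 0 q" "dv 0 s"
    "qnorm a = 2 powi (2 * e) * (p\<^sup>2 + q\<^sup>2 + s\<^sup>2)" by (rule pure_normal[OF pa(1) da(1)])
  obtain p' q' s' where P': "a' = qof (2 powi (e + k)) * Quat 0 p' q' s'" "dv 0 p'" "dv 0 q'" "dv 0 s'"
    "qnorm a' = 2 powi (2 * (e + k)) * (p'\<^sup>2 + q'\<^sup>2 + s'\<^sup>2)" by (rule pure_normal[OF pa(2) da(2)])
  define N0 where "N0 = p\<^sup>2 + q\<^sup>2 + s\<^sup>2"
  define N0' where "N0' = p'\<^sup>2 + q'\<^sup>2 + s'\<^sup>2"
  obtain m w where m: "N0 = 2 * m" "un m" "N0' = N0 + 16 * w" "dv 0 w"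
  proof (rule prime_class[OF \<pi> y(1) y'(1), of N0 N0'])
    show "\<pi> * y\<^sup>2 = 2 powi (2 * val y) * N0" using P(5) y(2) by (simp add: N0_def e_def)
    show "\<pi> * y'\<^sup>2 = 2 powi (2 * val y') * N0'" using P'(5) y'(2) by (simp add: N0'_def k_def)
  qed
  have "un (- 1)" by (simp add: un_def)
  from un_add_un[OF m(2) this] have m1: "dv 1 (m - 1)" by simp
  have N02: "dv 2 (N0 - 2)"
  proof -
    have "N0 - 2 = 2 * (m - 1)" using m(1) by simp
    then show ?thesis using m1 by (simp only: dv_2) simp
  qed
  have N02': "dv 2 (N0' - 2)"
  proof -
    have "N0' - 2 = (N0 - 2) + 4 * (4 * w)" using m(3) by simp
    moreover have "dv 2 (4 * (4 * w))" using dv_mono[OF m(4)] by simp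
    ultimately show ?thesis using N02 dv_add by metis
  qed
  have mm: "dv 3 (m\<^sup>2 - 1)" using m(2) unit_square by (simp add: un_def)
  define m' where "m' = m + 8 * w"
  have m': "un m'" unfolding m'_def using m dv_mono[OF m(4)] by (intro un_add) simp_all
  have full: ?thesis
    if c: "qdv 0 c" "qdv 0 c'" and g: "c * a * qconj c + c' * a' * qconj c' = qof (2 powi f) * (Quat 0 p1 q1 s1 + qof t * Quat 0 P Q R)"
      and b1: "p1\<^sup>2 + q1\<^sup>2 + s1\<^sup>2 = N0" and B: "P\<^sup>2 + Q\<^sup>2 + R\<^sup>2 = N0'" and D: "D = p1 * P + q1 * Q + s1 * R" "un D"
      and M: "qdv M (a * qconj c)" "qdv M (a' * qconj c')" "2 * f \<le> M + 1"
      and t: "t = 2 \<or> t = 4 \<or> un t \<and> dv 2 (m * (t * D) - 1)"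
    for c c' f p1 q1 s1 t P Q R M D
  proof -
    define \<gamma> where "\<gamma> = c * a * qconj c + c' * a' * qconj c'"
    define U where "U = m + t * D + t\<^sup>2 * m'"
    have "qnorm \<gamma> = 2 powi (2 * f) * (N0 + 2 * t * D + t\<^sup>2 * N0')" unfolding \<gamma>_def g gamma_norm b1 B D ..
    also have "N0 + 2 * t * D + t\<^sup>2 * N0' = 2 * U" by (simp add: U_def m m'_def algebra_simps)
    finally have N\<gamma>: "qnorm \<gamma> = 2 powi (2 * f) * (2 * U)" .
    have Na: "qnorm a = 2 powi (2 * e) * (2 * m)" using P(5) m by (simp add: N0_def)
    have mD: "un (m * D)" using m(2) D(2) by (rule un_mult)
    \<comment> \<open>\<open>m * U\<close> is compared with a square: it is 3 modulo 4 for
      \<open>t = 2\<close>, 5 modulo 8 for \<open>t = 4\<close>, and 3 modulo 4 for a unit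
      \<open>t\<close> with \<open>m * (t * D)\<close> congruent to 1 modulo 4.\<close>
    have key: "dv 1 (m * U - 1) \<and> \<not> dv 3 (m * U - 1)"
      using t
    proof (elim disjE conjE)
      assume t: "t = 2"
      have eq: "m * U - 1 = ((m\<^sup>2 - 1) + 4 * (m * m')) + 2 * (m * D)"
        using t by (simp add: U_def algebra_simps power2_eq_square)
      have 2: "dv 2 ((m\<^sup>2 - 1) + 4 * (m * m'))"
        using dv_mono[OF mm, of 2] un_dv[OF un_mult[OF m(2) m']] by (intro dv_add) simp_all
      have "dv 1 (2 * (m * D))" using un_dv[OF mD] by simp
      then show ?thesis unfolding eq using not_dv3(1)[OF 2 mD] dv_add[OF dv_mono[OF 2, of 1]] by simp
    next
      assume t: "t = 4"
      have eq: "m * U - 1 = ((m\<^sup>2 - 1) + 4 * (4 * (m * m'))) + 4 * (m * D)"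
        using t by (simp add: U_def algebra_simps power2_eq_square)
      have 2: "dv 3 ((m\<^sup>2 - 1) + 4 * (4 * (m * m')))"
        using mm dv_mono[OF un_dv[OF un_mult[OF m(2) m']]] by (intro dv_add) simp_all
      have "dv 1 (4 * (m * D))" using dv_mono[OF un_dv[OF mD]] by simp
      then show ?thesis unfolding eq using not_dv3(2)[OF 2 mD] dv_add[OF dv_mono[OF 2, of 1]] by simp
    next
      assume t: "un t" "dv 2 (m * (t * D) - 1)"
      have tt: "dv 3 (t\<^sup>2 - 1)" using t unit_square by (simp add: un_def)
      have eq: "m * U - 1 = (2 * (m\<^sup>2 - 1) + (m * (t * D) - 1) + (m\<^sup>2 * (t\<^sup>2 - 1) + 8 * (m * t\<^sup>2 * w))) + 2 * 1"
        by (simp add: U_def m'_def algebra_simps power2_eq_square)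
      have "dv 0 (m * t\<^sup>2 * w)" using m t by (intro dv_mult0 dv_power0) (simp_all add: un_dv)
      then have "dv 2 (8 * (m * t\<^sup>2 * w))" using dv_mono by simp
      moreover have "dv 2 (m\<^sup>2 * (t\<^sup>2 - 1))" using dv_multR[OF dv_mono[OF tt, of 2] dv_power0[OF un_dv[OF m(2)], of 2]] by simp
      moreover have "dv 2 (2 * (m\<^sup>2 - 1))" by (subst dv_2) (use dv_mono[OF mm] in simp)
      ultimately have 2: "dv 2 (2 * (m\<^sup>2 - 1) + (m * (t * D) - 1) + (m\<^sup>2 * (t\<^sup>2 - 1) + 8 * (m * t\<^sup>2 * w)))"
        using t(2) by (intro dv_add)
      have "un 1" by (simp add: un_def)
      from not_dv3(1)[OF 2 this] dv_add[OF dv_mono[OF 2, of 1], of "2 * 1"] show ?thesis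
        unfolding eq by (simp add: dv_num del: mult_1_right)
    qed
    have "un 1" by (simp add: un_def)
    from un_add[OF this, of "m * U - 1"] key have umU: "un (m * U)" by simp
    then have U: "U \<noteq> 0" "val U = 0" using m(2) by (auto simp: un_def val_mult)
    then have v: "qnorm \<gamma> \<noteq> 0" "val (qnorm \<gamma>) = 2 * f + 1" unfolding N\<gamma> by (simp_all add: val_mult power_int_2_val)
    have b: "\<not> dv (M + 1) (r\<^sup>2 + qnorm \<gamma> / 4)" for r
    proof -
      have "\<not> dv (2 * f) (r\<^sup>2 + qnorm \<gamma> / 4)"
        using sum3_bound_odd[of "qnorm \<gamma> / 4" r] v by (simp add: val_divide)
      then show ?thesis using dv_mono[of "M + 1" _ "2 * f"] M(3) by blast
    qed
    show ?thesis
    proof (rule pair_full[OF r r' ne c \<gamma>_def[unfolded a_def a'_def] _ M(1,2)[unfolded a_def a'_def] b])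
      show "\<gamma> \<noteq> 0" using v by auto
      show "qnorm (h x x) * qnorm \<gamma> \<noteq> y\<^sup>2" for y
      proof (rule not_square_unit)
        show "un (m * U)" by (rule umU)
        show "\<not> dv 3 (m * U - 1)" using key by blast
        have "(2::'k) powi (2 * (e + f + 1)) = 2 powi (2 * e) * 2 powi (2 * f) * 4"
          by (simp add: distrib_left power_int_add)
        then show "qnorm (h x x) * qnorm \<gamma> = 2 powi (2 * (e + f + 1)) * (m * U)"
          unfolding a_def[symmetric] Na N\<gamma> by simp
      qed
    qed
  qed
  have qc: "qdv 0 c" "qdv 0 (qconj c)" if "qnorm c = 1" for c using that by (simp_all add: qdv_def)
  have conj_a': "c * a' * qconj c = qof (2 powi (e + k)) * (c * Quat 0 p' q' s' * qconj c)" for c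
    unfolding P'(1) using qof_commute[of c "2 powi (e + k)"] by (simp flip: mult.assoc)
  have conj_a: "c * a * qconj c = qof (2 powi e) * (c * Quat 0 p q s * qconj c)" for c
    unfolding P(1) using qof_commute[of c "2 powi e"] by (simp flip: mult.assoc)
  have pk: "qof (2 powi (e + k)) = qof (2 powi f) * (qof t :: 'k quat)" if "2 powi (e + k) = 2 powi f * (t::'k)" for f t
    using that by (simp flip: qof_simps)
  obtain c P Q R where c: "qnorm c = 1" "c * Quat 0 p' q' s' * qconj c = Quat 0 P Q R"
    "P\<^sup>2 + Q\<^sup>2 + R\<^sup>2 = p'\<^sup>2 + q'\<^sup>2 + s'\<^sup>2" "un (p * P + q * Q + s * R)"
    using rotate_two_odd[OF P(2-4) N02[unfolded N0_def] P'(2-4) N02'[unfolded N0'_def]] by metis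
  have M0: "qdv (2 * e + 1) (a * qconj 1)" using ma by simp
  have Mc: "qdv M (a' * qconj c)" if "M \<le> 2 * (e + k) + 1" "qdv 0 (qconj c)" for c M
    using qdv_mult[OF ma'[OF that(1)] that(2)] by simp
  consider "k = 0" | "k = 1 \<or> k = 2" | "k = 3" | "k = 4" using k by linarith
  then show ?thesis
  proof cases
    case 1
    define D where "D = p * P + q * Q + s * R"
    have D: "un D" using c(4) by (simp add: D_def)
    have mD: "un (m * D)" using m(2) D by (rule un_mult)
    have mD1: "dv 1 (m * D - 1)" using un_add_un[OF mD \<open>un (- 1)\<close>] by simp
    show ?thesis
    proof (cases "dv 2 (m * D - 1)")
      case True
      have g: "1 * a * qconj 1 + c * a' * qconj c = qof (2 powi e) * (Quat 0 p q s + qof 1 * Quat 0 P Q R)"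
        unfolding conj_a' c(2) using 1 P(1) by (simp add: distrib_left qof_simps)
      show ?thesis
        by (rule full[OF _ qc(1)[OF c(1)] g N0_def[symmetric] c(3)[folded N0'_def] D_def D M0])
          (use True 1 Mc[of "2 * e + 1", OF _ qc(2)[OF c(1)]] in \<open>simp_all add: un_def\<close>)
    next
      case False
      \<comment> \<open>If \<open>m * D\<close> is 3 modulo 4, conjugating the second component by
        one plus its normalised value multiplies it by \<open>t\<close>, which is 3 modulo 4 and
        corrects the residue.\<close>
      define t where "t = 1 + N0'"
      have t: "t = 1 + 2 * m'" by (simp add: t_def m'_def m)
      define c1 where "c1 = c * Quat 1 p' q' s'"
      have "c1 * Quat 0 p' q' s' * qconj c1 = c * (Quat 1 p' q' s' * Quat 0 p' q' s' * qconj (Quat 1 p' q' s')) * qconj c"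
        by (simp only: c1_def qconj_mult mult.assoc)
      also have "\<dots> = qof t * (c * Quat 0 p' q' s' * qconj c)"
        unfolding pure_norm_twist t_def N0'_def using qof_commute[of c] by (simp flip: mult.assoc)
      finally have g: "1 * a * qconj 1 + c1 * a' * qconj c1 = qof (2 powi e) * (Quat 0 p q s + qof t * Quat 0 P Q R)"
        unfolding conj_a' c(2) using 1 P(1) by (simp add: distrib_left)
      have ut: "un t" unfolding t using odd_unit[of m'] un_dv[OF m'] by (simp add: un_def)
      have "qnorm c1 = t" unfolding c1_def qnorm_mult c(1) t_def N0'_def by (simp add: add.assoc)
      then have q1: "qdv 0 c1" "qdv 0 (qconj c1)" using un_dv[OF ut] by (simp_all add: qdv_def)
      have "m * (t * D) - 1 = (m * D - 1) + 2 * (m * D * m')" by (simp add: t algebra_simps)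
      moreover have "dv 2 ((m * D - 1) + 2 * (m * D * m'))"
        using mD1 False un_mult[OF mD m'] by (intro two_mod_four_add) (simp_all add: un_iff)
      ultimately have "dv 2 (m * (t * D) - 1)" by metis
      then show ?thesis
        by (intro full[OF _ q1(1) g N0_def[symmetric] c(3)[folded N0'_def] D_def D M0])
          (use ut 1 Mc[of "2 * e + 1", OF _ q1(2)] in simp_all)
    qed
  next
    case 2
    define t where "t = (2::'k) powi k"
    have t: "t = 2 \<or> t = 4" using 2 by (auto simp: t_def)
    have g: "1 * a * qconj 1 + c * a' * qconj c = qof (2 powi e) * (Quat 0 p q s + qof t * Quat 0 P Q R)"
      unfolding conj_a' c(2) P(1) pk[of e t, OF powi_mult[symmetric, of e k, folded t_def]] by (simp add: distrib_left mult.assoc)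
    show ?thesis
      by (rule full[OF _ qc(1)[OF c(1)] g N0_def[symmetric] c(3)[folded N0'_def] refl c(4) M0])
        (use t 2 Mc[of "2 * e + 1", OF _ qc(2)[OF c(1)]] in auto)
  next
    case 3
    \<comment> \<open>Conjugation with \<open>1 + i\<close> absorbs one factor of two, so the ratio
      8 of the components becomes 4.\<close>
    define c0 :: "'k quat" where "c0 = Quat 1 1 0 0"
    have n0: "qdv 0 (qconj c0)" "qdv 0 c0" by (simp_all add: c0_def qdv_def dv_num)
    have b1: "p\<^sup>2 + (- s)\<^sup>2 + q\<^sup>2 = N0" by (simp add: N0_def)
    obtain c P Q R where c: "qnorm c = 1" "c * Quat 0 p' q' s' * qconj c = Quat 0 P Q R"
      "P\<^sup>2 + Q\<^sup>2 + R\<^sup>2 = p'\<^sup>2 + q'\<^sup>2 + s'\<^sup>2" "un (p * P + (- s) * Q + q * R)"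
      using rotate_two_odd[of p "- s" q p' q' s'] P(2-4) N02 P'(2-4) N02'[unfolded N0'_def] unfolding b1 dv_minus by metis
    have e1: "qof (2 powi (e + k)) = qof (2 powi (e + 1)) * (qof 4 :: 'k quat)" "qof (2 powi (e + 1)) = qof (2 powi e) * (qof 2 :: 'k quat)"
      using 3 by (simp_all add: power_int_add flip: qof_simps)
    have g: "c0 * a * qconj c0 + c * a' * qconj c = qof (2 powi (e + 1)) * (Quat 0 p (- s) q + qof 4 * Quat 0 P Q R)"
      unfolding conj_a' conj_a c(2) c0_def conj_1_i e1 by (simp only: distrib_left mult.assoc)
    show ?thesis
      by (rule full[OF n0(2) qc(1)[OF c(1)] g b1 c(3)[folded N0'_def] refl c(4), of "2 * e + 1"])
        (use 3 Mc[of "2 * e + 1", OF _ qc(2)[OF c(1)]] qdv_mult[OF ma[OF order_refl] n0(1)] in simp_all)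
  next
    case 4
    \<comment> \<open>Scaling \<open>x\<close> by 2 multiplies its form value by 4 and turns the
      ratio 16 into 4. The condition \<open>2 * f \<le> M + 1\<close> then holds with equality for
      \<open>M = 2 * e + 3\<close>.\<close>
    have e1: "qof (2 powi (e + k)) = qof (2 powi (e + 2)) * (qof 4 :: 'k quat)" "qof (2 powi (e + 2)) = qof (2 powi e) * (qof 2 :: 'k quat) * qof 2"
      using 4 by (simp_all add: power_int_add flip: qof_simps)
    have g: "qof 2 * a * qconj (qof 2) + c * a' * qconj c = qof (2 powi (e + 2)) * (Quat 0 p q s + qof 4 * Quat 0 P Q R)"
      unfolding conj_a' conj_a c(2) e1 by (simp only: distrib_left mult.assoc qconj_simps qof_commute[of "Quat 0 p q s"])
    have n0: "qdv 2 (qconj (qof 2))" "qdv 0 (qof 2)" by (simp_all add: qdv_def dv_num)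
    show ?thesis
      by (rule full[OF n0(2) qc(1)[OF c(1)] g N0_def[symmetric] c(3)[folded N0'_def] refl c(4), of "2 * e + 3"])
        (use 4 Mc[of "2 * e + 3", OF _ qc(2)[OF c(1)]] qdv_mult[OF ma[OF order_refl] n0(1)] in \<open>simp_all add: add.commute\<close>)
  qed
qed

end


section \<open>Indecomposable binary components\<close>

context Q2_field
begin

lemma un_or_dv: "dv 0 p \<Longrightarrow> un p \<or> dv 1 p" by (auto simp: un_iff)

lemma un_not_dv: "un p \<Longrightarrow> \<not> dv 1 p" by (simp add: un_iff)

lemma un_1: "un 1" by (simp add: un_def)

lemma parity_flip:
  assumes "dv 0 p" "dv 1 c" shows "un (p + 1 + c) \<longleftrightarrow> dv 1 p" "dv 1 (p + 1 + c) \<longleftrightarrow> un p"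
proof -
  have 1: "un (p + 1 + c)" if "dv 1 p" using un_add[OF un_1, of "p + c"] dv_add[OF that assms(2)] by (simp add: add_ac)
  have 2: "dv 1 (p + 1 + c)" if "un p" using dv_add[OF un_add_un[OF that un_1] assms(2)] .
  show "un (p + 1 + c) \<longleftrightarrow> dv 1 p" "dv 1 (p + 1 + c) \<longleftrightarrow> un p"
    using 1 2 un_or_dv[OF assms(1)] un_not_dv by blast+
qed

text \<open>For integral coordinates these are the parity patterns whose sum of squares is 1 or 2
  modulo 4, i.e. those to which the sharper bounds on \<open>r\<^sup>2 + g\<close> apply.\<close>

definition mixed :: "'k \<Rightarrow> 'k \<Rightarrow> 'k \<Rightarrow> bool" where
  "mixed p q s \<longleftrightarrow> \<not> (dv 1 p \<and> dv 1 q \<and> dv 1 s) \<and> \<not> (un p \<and> un q \<and> un s)"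

definition odds :: "'k \<Rightarrow> 'k \<Rightarrow> 'k \<Rightarrow> nat" where
  "odds p q s = length (filter (\<lambda>x. \<not> dv 1 x) [p, q, s, 0])"

lemma odds_norm: "dv 0 p \<Longrightarrow> dv 0 q \<Longrightarrow> dv 0 s \<Longrightarrow> dv 2 (p\<^sup>2 + q\<^sup>2 + s\<^sup>2 - of_nat (odds p q s))"
  using parity_sum[of p q s 0] unfolding odds_def by simp

lemma odds_mixed: "dv 0 p \<Longrightarrow> dv 0 q \<Longrightarrow> dv 0 s \<Longrightarrow> mixed p q s \<longleftrightarrow> odds p q s = 1 \<or> odds p q s = 2"
  by (auto simp: mixed_def odds_def un_iff)

lemma odds_flip:
  assumes "dv 0 p" "dv 0 q" "dv 0 s" "dv 1 a" "dv 1 b" "dv 1 c"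
  shows "odds (p + 1 + a) (q + 1 + b) (s + 1 + c) + odds p q s = 3"
  using assms by (auto simp: odds_def parity_flip un_iff)

end

section \<open>Bases of an indecomposable plane adapted to its scale\<close>

context skew_space
begin

lemma orth_decomp_pair:
  assumes "\<And>w. w \<in> M \<longleftrightarrow> (\<exists>u\<in>A. \<exists>v\<in>B. w = u + v)"
    and "\<And>u v. u \<in> A \<Longrightarrow> v \<in> B \<Longrightarrow> u + v = 0 \<Longrightarrow> u = 0 \<and> v = 0"
    and "\<And>u v. u \<in> A \<Longrightarrow> v \<in> B \<Longrightarrow> h u v = 0"
  shows "orth_decomp n Hm M [A, B]"
proof -
  have len: "length xs = length [A, B] \<longleftrightarrow> (\<exists>u v. xs = [u, v])" for xs :: "'k vec list"
    by (auto simp: length_Suc_conv)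
  have all: "(\<forall>r<length [A, B]. P r) \<longleftrightarrow> P 0 \<and> P 1" for P by (auto simp: less_Suc_eq)
  show ?thesis unfolding orth_decomp_def vec_folds quat_folds all len
  proof (intro conjI)
    show "M = {sum_list xs |xs. (\<exists>u v. xs = [u, v]) \<and> xs ! 0 \<in> [A, B] ! 0 \<and> xs ! 1 \<in> [A, B] ! 1}"
      by (rule Set.set_eqI) (force simp: assms(1))
    show "\<forall>xs. (\<exists>u v. xs = [u, v]) \<longrightarrow> xs ! 0 \<in> [A, B] ! 0 \<and> xs ! 1 \<in> [A, B] ! 1 \<longrightarrow> sum_list xs = 0 \<longrightarrow> xs ! 0 = 0 \<and> xs ! 1 = 0"
      using assms(2) by auto
  qed (use assms(3) h_zero_sym in auto)
qed

text \<open>Gram-Schmidt: the valuation hypothesis makes the projection coefficient of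
  \<open>y\<close> on \<open>z\<close> integral, so the orthogonal complement of \<open>z\<close> is
  taken inside the lattice.\<close>

lemma split_off:
  assumes B: "B = ospan val [z, y]" and ind: "dindep [z, y]" and z: "h z z \<noteq> 0" "qdv (qnu val (h z z)) (h y z)"
  shows "\<not> indecomp val n Hm B"
proof -
  define d where "d = h y z * qinv (h z z)"
  have d: "qdv 0 d" using z by (simp add: d_def qdv_qinv)
  define y' where "y' = y - smul d z"
  have y'z: "h y' z = 0" using z by (simp add: y'_def d_def hform_linear mult.assoc qinv_left)
  have y'0: "y' \<noteq> 0"
  proof
    assume "y' = 0"
    then have "smul (- d) z + smul 1 y = 0" by (simp add: y'_def smul_simps)
    then show False using dindep_2[OF ind] by fastforce
  qed
  have zn: "z \<noteq> 0" using z(1) by (auto simp: hform_linear)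
  have "orth_decomp n Hm B [ospan val [z], ospan val [y']]"
  proof (rule orth_decomp_pair)
    fix w
    have "w \<in> B \<longleftrightarrow> (\<exists>c e. qdv 0 c \<and> qdv 0 e \<and> w = smul c z + smul e y')"
    proof
      assume "w \<in> B"
      then obtain c e where w: "qdv 0 c" "qdv 0 e" "w = smul c z + smul e y" unfolding B ospan_2 by blast
      then have "w = smul (c + e * d) z + smul e y'" by (simp add: y'_def smul_simps smul_smul)
      then show "\<exists>c e. qdv 0 c \<and> qdv 0 e \<and> w = smul c z + smul e y'" using w d by (metis qdv_add qdv_mult0)
    next
      assume "\<exists>c e. qdv 0 c \<and> qdv 0 e \<and> w = smul c z + smul e y'"
      then obtain c e where w: "qdv 0 c" "qdv 0 e" "w = smul c z + smul e y'" by blast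
      then have "w = smul (c - e * d) z + smul e y" by (simp add: y'_def smul_simps smul_smul)
      then show "w \<in> B" unfolding B ospan_2 using w d by (metis qdv_diff qdv_mult0)
    qed
    then show "w \<in> B \<longleftrightarrow> (\<exists>u\<in>ospan val [z]. \<exists>v\<in>ospan val [y']. w = u + v)"
      unfolding Bex_def ospan_1 by blast
  next
    fix u v assume "u \<in> ospan val [z]" "v \<in> ospan val [y']"
    then obtain c e where uv: "u = smul c z" "v = smul e y'" unfolding ospan_1 by blast
    show "h u v = 0" using h_zero_sym[OF y'z] by (simp add: uv hform_linear)
    assume "u + v = 0"
    then have "smul (c - e * d) z + smul e y = 0" by (simp add: uv y'_def smul_simps smul_smul algebra_simps)
    then have "e = 0" "c = 0" using dindep_2[OF ind] by force+
    then show "u = 0 \<and> v = 0" by (simp add: uv smul_simps)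
  qed
  moreover have "free_rank val (ospan val [z]) 1" "free_rank val (ospan val [y']) 1"
    unfolding free_rank_def using zn y'0 dindep_1 by (metis One_nat_def length_Cons list.size(3))+
  ultimately show ?thesis unfolding indecomp_def by blast
qed

lemma dindep_2I:
  fixes g g' :: "'k vec"
  assumes "\<And>c d. smul c g + smul d g' = 0 \<Longrightarrow> c = 0 \<and> d = 0"
  shows "dindep [g, g']"
  unfolding dindep_def vec_folds quat_folds
proof (intro allI impI)
  fix cs assume cs: "length cs = length [g, g']" "lcomb cs [g, g'] = 0"
  then obtain c d where cd: "cs = [c, d]" by (auto simp: length_Suc_conv)
  then have "smul c g + smul d g' = 0" using cs by (simp add: lcomb_eq lessThan_Suc add.commute)
  then show "set cs \<subseteq> {0}" using assms cd by auto
qed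

lemma dindep_change: assumes "dindep [x, y :: 'k vec]" shows "dindep [x + smul c y, y]"
proof (rule dindep_2I)
  fix a b assume "smul a (x + smul c y) + smul b y = 0"
  then have "smul a x + smul (a * c + b) y = 0" by (simp add: smul_simps smul_smul add.assoc)
  then show "a = 0 \<and> b = 0" using dindep_2[OF assms] by force
qed

lemma ospan_change: assumes "qdv 0 c" shows "ospan val [x + smul c y, y] = ospan val [x, y]"
proof (rule Set.set_eqI)
  fix w
  show "w \<in> ospan val [x + smul c y, y] \<longleftrightarrow> w \<in> ospan val [x, y]"
  proof
    assume "w \<in> ospan val [x + smul c y, y]"
    then obtain a b where w: "qdv 0 a" "qdv 0 b" "w = smul a (x + smul c y) + smul b y" unfolding ospan_2 by blast
    then have "w = smul a x + smul (a * c + b) y" by (simp add: smul_simps smul_smul add.assoc)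
    then show "w \<in> ospan val [x, y]" unfolding ospan_2 using w assms by (metis qdv_add qdv_mult0)
  next
    assume "w \<in> ospan val [x, y]"
    then obtain a b where w: "qdv 0 a" "qdv 0 b" "w = smul a x + smul b y" unfolding ospan_2 by blast
    then have "w = smul a (x + smul c y) + smul (b - a * c) y" by (simp add: smul_simps smul_smul)
    then show "w \<in> ospan val [x + smul c y, y]" unfolding ospan_2 using w assms by (metis qdv_diff qdv_mult0)
  qed
qed

lemma ospan_swap: "ospan val [x, y] = ospan val [y, x]"
  by (rule Set.set_eqI) (unfold ospan_2, metis add.commute)

lemma dindep_swap: "dindep [x, y :: 'k vec] \<Longrightarrow> dindep [y, x]"
  by (rule dindep_2I) (metis add.commute dindep_2)

text \<open>Indecomposability forces the diagonal entries to lie strictly inside the scale, which \<open>h x y\<close> then generates.\<close>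

definition scale_basis :: "int \<Rightarrow> 'k vec set \<Rightarrow> 'k vec \<Rightarrow> 'k vec \<Rightarrow> bool" where
  "scale_basis m B x y \<longleftrightarrow> B = ospan val [x, y] \<and> dindep [x, y] \<and> h x y \<noteq> 0 \<and> qnu val (h x y) = m \<and>
     qdv (m + 1) (h x x) \<and> qdv (m + 1) (h y y)"

lemma scale_basis_swap: assumes "scale_basis m B x y" shows "scale_basis m B y x"
proof -
  note b = assms[unfolded scale_basis_def]
  have "B = ospan val [y, x]" using b ospan_swap[of x y] by (metis (no_types))
  moreover have "dindep [y, x]" using b dindep_swap by blast
  moreover have "h y x \<noteq> 0" "qnu val (h y x) = m" using b unfolding h_skew[of y x] by simp_all
  ultimately show ?thesis using b unfolding scale_basis_def by blast
qed

lemma indecomp_qdv: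
  assumes "indecomp val n Hm B" "B = ospan val [z, y]" "dindep [z, y]" "qdv m (h z z)" "qdv m (h y z)"
  shows "qdv (m + 1) (h z z)"
proof (rule ccontr)
  assume "\<not> qdv (m + 1) (h z z)"
  then have z: "h z z \<noteq> 0" "qnu val (h z z) \<le> m" unfolding not_qdv_iff by blast+
  show False using split_off[OF assms(2,3) z(1)] assms(1) qdv_mono[OF assms(5) z(2)] by blast
qed

lemma scale_basis_exists:
  assumes "indecomp val n Hm B" "B = ospan val [x, y]" "dindep [x, y]" "h x x \<noteq> 0 \<or> h x y \<noteq> 0 \<or> h y y \<noteq> 0"
  obtains m where "scale_basis m B x y"
proof -
  define S where "S = qnu val ` ({h x x, h x y, h y y} - {0})"
  have S: "finite S" "S \<noteq> {}" using assms(4) by (auto simp: S_def)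
  define m where "m = Min S"
  have q: "qdv m v" if "v \<in> {h x x, h x y, h y y}" for v
  proof (cases "v = 0")
    case False
    then have "qnu val v \<in> S" using that by (auto simp: S_def)
    then show ?thesis using Min_le[OF S(1)] False by (simp add: m_def qdv_iff)
  qed simp
  have yx: "qdv m (h y x)" using q[of "h x y"] h_skew[of y x] by simp
  have xx: "qdv (m + 1) (h x x)" using indecomp_qdv[OF assms(1-3)] q yx by simp
  have yy: "qdv (m + 1) (h y y)"
    using indecomp_qdv[OF assms(1) assms(2)[unfolded ospan_swap[of x y]] dindep_swap[OF assms(3)]] q by simp
  have "m \<in> qnu val ` ({h x x, h x y, h y y} - {0})" using Min_in[OF S] unfolding m_def S_def .
  then obtain v where "m = qnu val v" "v \<in> {h x x, h x y, h y y} - {0}" by (rule imageE)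
  then have v: "v \<in> {h x x, h x y, h y y}" "v \<noteq> 0" "qnu val v = m" by auto
  have "\<not> qdv (m + 1) v" using v by (simp add: qdv_iff)
  then have "v = h x y" using v xx yy by auto
  then have "h x y \<noteq> 0" "qnu val (h x y) = m" using v by simp_all
  then show thesis using that[of m] assms(2,3) xx yy unfolding scale_basis_def by blast
qed

lemma scale_basis_change:
  assumes "indecomp val n Hm B" "scale_basis m B x y" "qdv 0 c"
  shows "scale_basis m B (x + smul c y) y"
    "h (x + smul c y) (x + smul c y) = h x x + (h x y * qconj c - qconj (h x y * qconj c)) + c * h y y * qconj c"
proof -
  note b = assms(2)[unfolded scale_basis_def]
  have q: "qdv m (h x y)" "qdv m (h y y)" "qdv m (h x x)" "qdv m (h y x)"
    using b h_skew[of y x] by (auto simp: qdv_iff intro: qdv_mono[of "m + 1"])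
  show eq: "h (x + smul c y) (x + smul c y) = h x x + (h x y * qconj c - qconj (h x y * qconj c)) + c * h y y * qconj c"
    by (simp add: hform_linear qconj_mult h_qconj algebra_simps)
  have cyy: "qdv (m + 1) (c * h y y)" using qdv_mult[OF assms(3), of "m + 1" "h y y"] b by simp
  have "\<not> qdv (m + 1) (h x y + c * h y y)"
  proof
    assume "qdv (m + 1) (h x y + c * h y y)"
    then have "qdv (m + 1) (h x y)" using qdv_diff[OF _ cyy] by fastforce
    then show False using b by (simp add: qdv_iff)
  qed
  moreover have "qdv m (h x y + c * h y y)" using q(1) qdv_mono[OF cyy, of m] by (intro qdv_add) auto
  ultimately have xy: "h (x + smul c y) y \<noteq> 0" "qnu val (h (x + smul c y) y) = m"
    using not_qdv_iff[of m "h x y + c * h y y"] by (auto simp: hform_linear qdv_iff)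
  have B: "B = ospan val [x + smul c y, y]" using b ospan_change[OF assms(3)] by simp
  have i: "dindep [x + smul c y, y]" using b dindep_change by blast
  have "qdv m (h y (x + smul c y))" using xy h_skew[of y "x + smul c y"] by (simp add: qdv_iff)
  moreover have "qdv m (h (x + smul c y) (x + smul c y))"
  proof -
    have *: "qdv m (h x y * qconj c)" "qdv m (c * h y y * qconj c)"
      using qdv_mult[OF q(1), of 0 "qconj c"] qdv_mult[OF qdv_mult[OF assms(3) q(2)], of 0 "qconj c"] assms(3) by simp_all
    then have "qdv m (qconj (h x y * qconj c))" by (simp only: qdv_qconj)
    with * show ?thesis unfolding eq using q(3) by (intro qdv_add qdv_diff)
  qed
  ultimately have "qdv (m + 1) (h (x + smul c y) (x + smul c y))"
    using indecomp_qdv[OF assms(1) B i] by blast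
  then show "scale_basis m B (x + smul c y) y" using B i xy b by (simp add: scale_basis_def)
qed

lemma scale_basis_shift:
  assumes "indecomp val n Hm B" "scale_basis m B x y" "qdv m w" "w \<noteq> 0"
  obtains c where "scale_basis m B (x + smul c y) y" "qdv (qnu val w - m) c" "qnorm c * qnorm (h x y) = qnorm w"
    "h (x + smul c y) (x + smul c y) = h x x + (w - qconj w) + c * h y y * qconj c"
proof -
  note b = assms(2)[unfolded scale_basis_def]
  define c where "c = qconj (qinv (h x y) * w)"
  have w: "h x y * qconj c = w" using b by (simp add: c_def)
  have Nc: "qnorm c * qnorm (h x y) = qnorm w" using arg_cong[OF w, of qnorm] by (simp add: qnorm_mult mult.commute)
  have "qdv (qnu val w - m + qnu val (h x y)) w" using b assms(4) by (simp add: qdv_iff)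
  then have cq: "qdv (qnu val w - m) c" unfolding c_def qdv_qconj using b qdv_qinvL by blast
  have c0: "qdv 0 c" using assms(3,4) qdv_iff[of w m] by (intro qdv_mono[OF cq]) simp
  show thesis
    by (rule that[OF scale_basis_change(1)[OF assms(1,2) c0] cq Nc scale_basis_change(2)[OF assms(1,2) c0, unfolded w]])
qed

text \<open>For even \<open>m\<close> the shift by a power of two times \<open>omega\<close> moves
  the diagonal entry by that power times \<open>i + j + k\<close>, whose valuation is exactly
  \<open>m\<close>. The result would generate the scale and split off.\<close>

lemma scale_basis_odd:
  assumes "indecomp val n Hm B" "scale_basis m B x y"
  obtains e where "m = 2 * e + 1"
proof -
  have "odd m"
  proof
    assume "even m"
    define e where "e = m div 2"
    have m: "m = 2 * e" using \<open>even m\<close> by (simp add: e_def)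
    note b = assms(2)[unfolded scale_basis_def]
    define w where "w = qof (2 powi e) * omega"
    have Nw: "qnorm w = 2 powi m" by (simp add: w_def qnorm_mult omega powi_sq m)
    have w: "qdv m w" "w \<noteq> 0" using power_int_2_val[of m] Nw by (auto simp: qdv_def dv_def)
    obtain c where c: "scale_basis m B (x + smul c y) y" "qdv (qnu val w - m) c"
      "h (x + smul c y) (x + smul c y) = h x x + (w - qconj w) + c * h y y * qconj c"
      by (rule scale_basis_shift[OF assms w])
    have "qnu val w = m" using Nw power_int_2_val by (simp add: qnu_def)
    then have c0: "qdv 0 c" using c(2) by simp
    have "qdv (m + 1) (c * h y y * qconj c)"
      using qdv_mult[OF qdv_mult[OF c0, of "m + 1" "h y y"], of 0 "qconj c"] b c0 by simp
    then have "qdv (m + 1) (h (x + smul c y) (x + smul c y) - h x x - c * h y y * qconj c)"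
      using b c(1) unfolding scale_basis_def by (intro qdv_diff) auto
    then have "qdv (m + 1) (w - qconj w)" unfolding c(3) by (simp add: algebra_simps)
    moreover have "w - qconj w = qof (2 powi e) * Quat 0 1 1 1"
      by (simp add: w_def omega_def Quat_ops qof_def)
    ultimately have "dv (m + 1) (2 powi m * 3)" by (simp add: qdv_def qnorm_mult powi_sq m)
    then show False by (simp add: dv_powi_scale dv_num)
  qed
  then show thesis using that by (metis oddE)
qed

end


section \<open>Two independent norm groups from an indecomposable plane\<close>

context Q2_field
begin

lemma dv1_add: "dv 0 x \<Longrightarrow> dv 0 y \<Longrightarrow> dv 1 (x + y) \<longleftrightarrow> (dv 1 x \<longleftrightarrow> dv 1 y)"
  using un_add_un[of x y] dv_add[of 1 x y] un_add[of x y] un_add[of y x] un_or_dv un_not_dv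
  by (metis add.commute)

lemma odds_val:
  assumes i: "dv 0 p" "dv 0 q" "dv 0 s"
  shows "odds p q s = 1 \<Longrightarrow> dv 2 (p\<^sup>2 + q\<^sup>2 + s\<^sup>2 - 1) \<and> p\<^sup>2 + q\<^sup>2 + s\<^sup>2 \<noteq> 0 \<and> val (p\<^sup>2 + q\<^sup>2 + s\<^sup>2) = 0"
    and "odds p q s = 2 \<Longrightarrow> p\<^sup>2 + q\<^sup>2 + s\<^sup>2 \<noteq> 0 \<and> val (p\<^sup>2 + q\<^sup>2 + s\<^sup>2) = 1"
proof -
  define N where "N = p\<^sup>2 + q\<^sup>2 + s\<^sup>2"
  have d: "dv 2 (N - of_nat (odds p q s))" unfolding N_def by (rule odds_norm[OF i])
  show "dv 2 (p\<^sup>2 + q\<^sup>2 + s\<^sup>2 - 1) \<and> p\<^sup>2 + q\<^sup>2 + s\<^sup>2 \<noteq> 0 \<and> val (p\<^sup>2 + q\<^sup>2 + s\<^sup>2) = 0" if "odds p q s = 1"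
    using d that un_of_dv2[of N] unfolding N_def[symmetric] by (simp add: un_def)
  show "p\<^sup>2 + q\<^sup>2 + s\<^sup>2 \<noteq> 0 \<and> val (p\<^sup>2 + q\<^sup>2 + s\<^sup>2) = 1" if "odds p q s = 2"
  proof -
    have d2: "dv 2 (N - 2)" using d that by simp
    have "dv 1 N" using dv_add[OF dv_mono[OF d2, of 1], of 2] by (simp add: dv_num)
    moreover have "\<not> dv 2 N" using dv_diff[OF _ d2, of N] by (auto simp: dv_num)
    moreover from this have "N \<noteq> 0" by auto
    ultimately show ?thesis unfolding N_def[symmetric] using val_eq_dv[of N 1] by simp
  qed
qed

lemma conj_vec:
  fixes c :: "'k quat"
  obtains P Q R where "c * Quat 0 p q s * qconj c = Quat 0 P Q R" "P\<^sup>2 + Q\<^sup>2 + R\<^sup>2 = (qnorm c)\<^sup>2 * (p\<^sup>2 + q\<^sup>2 + s\<^sup>2)"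
proof -
  have "pure (Quat 0 p q s)" by (simp add: pure_iff)
  then have "pure (c * Quat 0 p q s * qconj c)" by (rule pure_conj)
  then obtain P Q R where eq: "c * Quat 0 p q s * qconj c = Quat 0 P Q R" by (rule pureE)
  have "qnorm (c * Quat 0 p q s * qconj c) = (qnorm c)\<^sup>2 * (p\<^sup>2 + q\<^sup>2 + s\<^sup>2)"
    by (simp add: qnorm_mult power2_eq_square)
  then show thesis using that[OF eq] unfolding eq by simp
qed

end

context decomposed_lattice
begin

text \<open>Here \<open>M = 2 * e + 1\<close>, one less than the general bound tolerates. With one
  odd coordinate the unit part is 1 modulo 4, with two the valuation is odd, and either sharper
  bound suffices.\<close>

lemma binary_norms:
  assumes r: "r < length Ls" "B = Ls ! r" and sc: "\<And>u v. u \<in> B \<Longrightarrow> v \<in> B \<Longrightarrow> qdv (2 * e + 1) (h u v)"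
    and s: "s \<in> B" "h s s = qof (2 powi (e + 1)) * Quat 0 p q t" and i: "dv 0 p" "dv 0 q" "dv 0 t" and mx: "mixed p q t"
    and nz: "x\<^sup>2 + qnorm (h s s) * y\<^sup>2 \<noteq> 0"
  shows "x\<^sup>2 + qnorm (h s s) * y\<^sup>2 \<in> Hgrp n Hm L"
proof -
  define N where "N = p\<^sup>2 + q\<^sup>2 + t\<^sup>2"
  have "(2::'k) powi (2 * (e + 1)) = 2 powi (2 * e) * 4" by (simp add: distrib_left power_int_add)
  then have g: "qnorm (h s s) / 4 = 2 powi (2 * e) * N" unfolding s(2) by (simp add: qnorm_mult powi_sq N_def)
  have o: "odds p q t = 1 \<or> odds p q t = 2" using odds_mixed[OF i] mx by blast
  have N: "N \<noteq> 0" using o odds_val[OF i] unfolding N_def by blast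
  show ?thesis
  proof (rule norms_in_Hgrp[OF omodule_L _ _ _ _ nz])
    show "s \<in> L" using comp_sub[OF r(1)] s(1) r(2) by blast
    show "h s s \<noteq> 0" using g N by auto
    show "qdv (2 * e + 1) (h z s)" if z: "z \<in> L" for z
    proof -
      obtain z' where "z' \<in> B" "h z s = h z' s" using comp_proj[OF r(1) z] s(1) r(2) by metis
      then show ?thesis using sc s(1) by simp
    qed
    show "\<not> dv (2 * e + 1 + 1) (r\<^sup>2 + qnorm (h s s) / 4)" for r
    proof (cases "odds p q t = 1")
      case True
      then have "dv 2 (N - 1)" using odds_val(1)[OF i] unfolding N_def by blast
      from sum3_bound_1mod4[OF g this, of r] show ?thesis by (simp add: add.assoc)
    next
      case False
      then have "val N = 1" using o odds_val(2)[OF i] unfolding N_def by blast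
      then have "val (qnorm (h s s) / 4) = 2 * e + 1" "qnorm (h s s) / 4 \<noteq> 0"
        unfolding g using N by (simp_all add: val_mult power_int_2_val)
      then show ?thesis using sum3_bound_odd[of "qnorm (h s s) / 4" r] by simp
    qed
  qed
qed

text \<open>If both diagonal patterns have three equal parities, moving \<open>h x x\<close> by a
  multiple of \<open>i\<close> spoils the pattern in one coordinate, while the term from
  \<open>h y y\<close> still has three equal parities.\<close>

lemma scale_basis_mixed:
  assumes ind: "indecomp val n Hm B" and sb: "scale_basis (2 * e + 1) B x y"
  obtains x y p q t where "scale_basis (2 * e + 1) B x y" "h x x = qof (2 powi (e + 1)) * Quat 0 p q t"
    "dv 0 p" "dv 0 q" "dv 0 t" "mixed p q t"
proof -
  have sb': "scale_basis (2 * e + 1) B y x" using sb by (rule scale_basis_swap)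
  have d: "qdv (2 * (e + 1)) (h x x)" "qdv (2 * (e + 1)) (h y y)"
    using sb unfolding scale_basis_def by (simp_all add: distrib_left add.assoc)
  obtain p q t where P: "h x x = qof (2 powi (e + 1)) * Quat 0 p q t" "dv 0 p" "dv 0 q" "dv 0 t"
    by (rule pure_normal[OF pure_h d(1)])
  obtain p' q' t' where P': "h y y = qof (2 powi (e + 1)) * Quat 0 p' q' t'" "dv 0 p'" "dv 0 q'" "dv 0 t'"
    by (rule pure_normal[OF pure_h d(2)])
  show thesis
  proof (cases "mixed p q t \<or> mixed p' q' t'")
    case True
    then show ?thesis using that[OF sb P] that[OF sb' P'] by blast
  next
    case False
    define w :: "'k quat" where "w = qof (2 powi e) * Quat 1 1 0 0"
    have Nw: "qnorm w = 2 powi (2 * e) * 2" by (simp add: w_def qnorm_mult powi_sq)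
    then have w: "w \<noteq> 0" "qnu val w = 2 * e + 1" by (auto simp: qnu_def val_mult power_int_2_val)
    have "w - qconj w = qof (2 powi e) * (qof 2 * Quat 0 1 0 0)" by (simp add: w_def Quat_ops qof_def)
    also have "\<dots> = qof (2 powi (e + 1)) * Quat 0 1 0 0" by (simp add: power_int_add qof_simps mult.assoc)
    finally have ww: "w - qconj w = qof (2 powi (e + 1)) * Quat 0 1 0 0" .
    obtain c where c: "scale_basis (2 * e + 1) B (x + smul c y) y" "qdv (qnu val w - (2 * e + 1)) c"
      "qnorm c * qnorm (h x y) = qnorm w"
      "h (x + smul c y) (x + smul c y) = h x x + (w - qconj w) + c * h y y * qconj c"
      using scale_basis_shift[OF ind sb _ w(1)] w by (metis order_refl qdv_iff)
    have b: "h x y \<noteq> 0" "qnu val (h x y) = 2 * e + 1" using sb unfolding scale_basis_def by blast+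
    have c0: "c \<noteq> 0" using c(3) w by auto
    have "val (qnorm c) + qnu val (h x y) = qnu val w" using arg_cong[OF c(3), of val] c0 b(1) by (simp add: val_mult qnu_def)
    then have uc: "un (qnorm c)" using b(2) w(2) c0 by (simp add: un_def)
    obtain P1 Q1 R1 where C: "c * Quat 0 p' q' t' * qconj c = Quat 0 P1 Q1 R1"
      "P1\<^sup>2 + Q1\<^sup>2 + R1\<^sup>2 = (qnorm c)\<^sup>2 * (p'\<^sup>2 + q'\<^sup>2 + t'\<^sup>2)" by (rule conj_vec)
    have NB: "dv 0 (p'\<^sup>2 + q'\<^sup>2 + t'\<^sup>2)" using P' by (intro dv_add dv_power0)
    have "dv (2 * 0) (P1\<^sup>2 + Q1\<^sup>2 + R1\<^sup>2)" unfolding C using dv_mult0[OF dv_power0[OF un_dv[OF uc]] NB] by simp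
    then have iC: "dv 0 P1" "dv 0 Q1" "dv 0 R1" using three_squares_dv by blast+
    \<comment> \<open>Conjugation by \<open>c\<close> of unit norm keeps the sum of squares at 0 or
      at 3 modulo 4, and these residues force three even or three odd coordinates.\<close>
    have same: "(dv 1 P1 \<longleftrightarrow> dv 1 Q1) \<and> (dv 1 P1 \<longleftrightarrow> dv 1 R1)"
    proof (cases "dv 1 p' \<and> dv 1 q' \<and> dv 1 t'")
      case True
      then have "dv (2 * 1) (p'\<^sup>2 + q'\<^sup>2 + t'\<^sup>2)" by (intro dv_add) (simp_all only: dv_square)
      then have "dv (2 * 1) (P1\<^sup>2 + Q1\<^sup>2 + R1\<^sup>2)" unfolding C by (rule dv_multR) (rule dv_power0[OF un_dv[OF uc]])
      then show ?thesis using three_squares_dv by blast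
    next
      case F: False
      then have u: "un p'" "un q'" "un t'" using False by (auto simp: mixed_def)
      then have "odds p' q' t' = 3" by (simp add: odds_def un_iff)
      then have "dv 2 (p'\<^sup>2 + q'\<^sup>2 + t'\<^sup>2 - 3)" using odds_norm[OF P'(2-4)] by simp
      moreover have "dv 2 ((qnorm c)\<^sup>2 - 1)" using dv_mono[OF unit_square[of "qnorm c"], of 2] uc by (simp add: un_def)
      ultimately have "dv 2 ((qnorm c)\<^sup>2 * (p'\<^sup>2 + q'\<^sup>2 + t'\<^sup>2 - 3) + 3 * ((qnorm c)\<^sup>2 - 1))"
        by (intro dv_add dv_multR) (simp_all add: dv_power0[OF un_dv[OF uc]] del: dv_2)
      then have "dv 2 ((P1\<^sup>2 + Q1\<^sup>2 + R1\<^sup>2) - 3)" unfolding C by (simp add: algebra_simps)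
      from dv_diff[OF this odds_norm[OF iC]] have "dv 2 (of_nat (odds P1 Q1 R1) - 3)" by simp
      moreover have "odds P1 Q1 R1 \<in> {0, 1, 2, 3}" by (auto simp: odds_def)
      ultimately have "odds P1 Q1 R1 = 3" using dv_minus[of 2 3] dv_minus[of 2 2] dv_minus[of 2 1] by (auto simp: dv_num)
      then show ?thesis by (auto simp: odds_def split: if_splits)
    qed
    have sameA: "(dv 1 p \<longleftrightarrow> dv 1 q) \<and> (dv 1 p \<longleftrightarrow> dv 1 t)"
      using False P(2-4) by (auto simp: mixed_def un_iff)
    have i': "dv 0 (p + 1 + P1)" "dv 0 (q + Q1)" "dv 0 (t + R1)" using P(2-4) iC by (simp_all add: dv_add)
    have "dv 1 (p + 1 + P1) \<longleftrightarrow> \<not> dv 1 (q + Q1)"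
      using same sameA P(2-4) iC dv1_add[of "p + 1" P1] dv1_add[of p 1] dv1_add[of q Q1] dv_add[of 0 p 1] by auto
    then have "mixed (p + 1 + P1) (q + Q1) (t + R1)" using i' by (auto simp: mixed_def un_iff)
    moreover have "h (x + smul c y) (x + smul c y) = qof (2 powi (e + 1)) * Quat 0 (p + 1 + P1) (q + Q1) (t + R1)"
    proof -
      have "c * h y y * qconj c = qof (2 powi (e + 1)) * (c * Quat 0 p' q' t' * qconj c)"
        unfolding P'(1) using qof_commute[of c "2 powi (e + 1)"] by (simp flip: mult.assoc)
      then show ?thesis unfolding c(4) ww P(1) C(1) by (simp add: Quat_ops flip: distrib_left)
    qed
    ultimately show ?thesis using that c(1) i' by blast
  qed
qed

text \<open>The component contains two vectors with mixed patterns, one with a single odd coordinate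
  and one with two. Their norms have valuations of opposite parity and hence different
  classes.\<close>

lemma Hgrp_binary_component:
  assumes r: "r < length Ls" and B: "free_rank val (Ls ! r) 2" "indecomp val n Hm (Ls ! r)"
  shows "Hgrp n Hm L = {c. c \<noteq> 0}"
proof -
  define B where "B = Ls ! r"
  obtain bs where bs: "length bs = 2" "dindep bs" "B = ospan val bs" using B(1) unfolding free_rank_def B_def by blast
  obtain x0 y0 where xy: "bs = [x0, y0]" using bs(1) by (auto simp: numeral_2_eq_2 length_Suc_conv)
  have ind: "indecomp val n Hm B" using B(2) by (simp add: B_def)
  have "h x0 x0 \<noteq> 0 \<or> h x0 y0 \<noteq> 0 \<or> h y0 y0 \<noteq> 0"
  proof (rule ccontr)
    assume z: "\<not> ?thesis"
    have x0: "x0 \<in> B" unfolding bs(3) xy ospan_2 by (intro exI[of _ 1] exI[of _ 0]) (simp add: smul_simps)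
    have "x0 = 0"
    proof (rule nondeg_comp[OF r])
      show "x0 \<in> Ls ! r" using x0 by (simp add: B_def)
      fix v assume "v \<in> Ls ! r"
      then obtain c d where "v = smul c x0 + smul d y0" unfolding B_def[symmetric] bs(3) xy ospan_2 by blast
      then show "h x0 v = 0" using z by (simp add: hform_linear)
    qed
    then have "smul 1 x0 + smul 0 y0 = 0" by (simp add: smul_simps)
    then show False using dindep_2[OF bs(2)[unfolded xy]] by fastforce
  qed
  then obtain m where "scale_basis m B x0 y0" using scale_basis_exists[OF ind bs(3)[unfolded xy] bs(2)[unfolded xy]] by blast
  moreover from this obtain e where "m = 2 * e + 1" using scale_basis_odd[OF ind] by blast
  ultimately have "scale_basis (2 * e + 1) B x0 y0" by simp
  then obtain x y p q t where sb: "scale_basis (2 * e + 1) B x y" and P: "h x x = qof (2 powi (e + 1)) * Quat 0 p q t"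
    "dv 0 p" "dv 0 q" "dv 0 t" "mixed p q t" by (rule scale_basis_mixed[OF ind])
  note b = sb[unfolded scale_basis_def]
  have d: "qdv (2 * (e + 1)) (h y y)" using b by (simp add: distrib_left add.assoc)
  obtain p' q' t' where P': "h y y = qof (2 powi (e + 1)) * Quat 0 p' q' t'" "dv 0 p'" "dv 0 q'" "dv 0 t'"
    by (rule pure_normal[OF pure_h d])
  have qb: "qdv (2 * e + 1) (h x y)" "qdv (2 * e + 1) (h y x)" "qdv (2 * e + 1) (h x x)" "qdv (2 * e + 1) (h y y)"
  proof -
    show 1: "qdv (2 * e + 1) (h x y)" using b by (simp add: qdv_iff)
    show "qdv (2 * e + 1) (h y x)" using 1 h_skew[of y x] by simp
    show "qdv (2 * e + 1) (h x x)" "qdv (2 * e + 1) (h y y)" using b qdv_mono[of "2 * e + 1 + 1" _ "2 * e + 1"] by auto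
  qed
  have sc: "qdv (2 * e + 1) (h u v)" if uv: "u \<in> B" "v \<in> B" for u v
  proof -
    have Beq: "B = ospan val [x, y]" using b by blast
    obtain c d where u: "qdv 0 c" "qdv 0 d" "u = smul c x + smul d y" using uv(1) unfolding Beq ospan_2 by blast
    obtain c' d' where v: "qdv 0 c'" "qdv 0 d'" "v = smul c' x + smul d' y" using uv(2) unfolding Beq ospan_2 by blast
    have *: "qdv (2 * e + 1) (a * z * qconj a')" if "qdv 0 a" "qdv 0 a'" "qdv (2 * e + 1) z" for a a' z
      using qdv_mult[OF qdv_mult[OF that(1,3)], of 0 "qconj a'"] that(2) by simp
    have "h u v = c * h x x * qconj c' + c * h x y * qconj d' + d * h y x * qconj c' + d * h y y * qconj d'"
      unfolding u(3) v(3) hform_linear by (simp add: algebra_simps)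
    then show ?thesis using qb u v * by (simp add: qdv_add)
  qed
  \<comment> \<open>\<open>w - qconj w\<close> flips all three parities. The valuation of
    \<open>w\<close> exceeds that of the scale by one, so \<open>c\<close> lies in the prime ideal
    and the term from \<open>h y y\<close> adds even coordinates only.\<close>
  define w :: "'k quat" where "w = qof (2 powi e) * Quat 1 1 1 1"
  have Nw: "qnorm w = 2 powi (2 * e) * 4" by (simp add: w_def qnorm_mult powi_sq)
  then have w: "w \<noteq> 0" "qnu val w = 2 * e + 2" by (auto simp: qnu_def val_mult power_int_2_val)
  have "w - qconj w = qof (2 powi e) * (qof 2 * Quat 0 1 1 1)" by (simp add: w_def Quat_ops qof_def)
  also have "\<dots> = qof (2 powi (e + 1)) * Quat 0 1 1 1" by (simp add: power_int_add qof_simps mult.assoc)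
  finally have ww: "w - qconj w = qof (2 powi (e + 1)) * Quat 0 1 1 1" .
  have wq: "qdv (2 * e + 1) w" using w by (simp add: qdv_iff)
  obtain c where c: "scale_basis (2 * e + 1) B (x + smul c y) y" "qdv (qnu val w - (2 * e + 1)) c"
    "h (x + smul c y) (x + smul c y) = h x x + (w - qconj w) + c * h y y * qconj c"
    by (rule scale_basis_shift[OF ind sb wq w(1)])
  have c1: "dv 1 (qnorm c)" using c(2) w(2) by (simp add: qdv_def)
  obtain P1 Q1 R1 where C: "c * Quat 0 p' q' t' * qconj c = Quat 0 P1 Q1 R1"
    "P1\<^sup>2 + Q1\<^sup>2 + R1\<^sup>2 = (qnorm c)\<^sup>2 * (p'\<^sup>2 + q'\<^sup>2 + t'\<^sup>2)" by (rule conj_vec)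
  have NB: "dv 0 (p'\<^sup>2 + q'\<^sup>2 + t'\<^sup>2)" using P' by (intro dv_add dv_power0)
  have "dv (2 * 1) ((qnorm c)\<^sup>2)" using c1 dv_square by blast
  then have "dv (2 * 1) (P1\<^sup>2 + Q1\<^sup>2 + R1\<^sup>2)" unfolding C using NB by (rule dv_multL)
  then have iC: "dv 1 P1" "dv 1 Q1" "dv 1 R1" using three_squares_dv by blast+
  define s where "s = x + smul c y"
  have hs: "h s s = qof (2 powi (e + 1)) * Quat 0 (p + 1 + P1) (q + 1 + Q1) (t + 1 + R1)"
  proof -
    have "c * h y y * qconj c = qof (2 powi (e + 1)) * (c * Quat 0 p' q' t' * qconj c)"
      unfolding P'(1) using qof_commute[of c "2 powi (e + 1)"] by (simp flip: mult.assoc)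
    then show ?thesis unfolding s_def c(3) ww P(1) C(1) by (simp add: Quat_ops flip: distrib_left)
  qed
  have i: "dv 0 (p + 1 + P1)" "dv 0 (q + 1 + Q1)" "dv 0 (t + 1 + R1)"
    using P(2-4) iC[THEN dv_mono, of 0] by (simp_all add: dv_add)
  have o: "odds p q t = 1 \<or> odds p q t = 2" using odds_mixed[OF P(2-4)] P(5) by blast
  have o': "odds (p + 1 + P1) (q + 1 + Q1) (t + 1 + R1) + odds p q t = 3" using odds_flip[OF P(2-4) iC] .
  then have mx: "mixed (p + 1 + P1) (q + 1 + Q1) (t + 1 + R1)" using o odds_mixed[OF i] by auto
  have xB: "x \<in> B" "s \<in> B"
  proof -
    have "B = ospan val [x, y]" "B = ospan val [s, y]" using b c(1) unfolding scale_basis_def s_def by blast+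
    moreover have "g \<in> ospan val [g, y]" for g
      unfolding ospan_2 by (intro exI[of _ 1] exI[of _ 0]) (simp add: smul_simps)
    ultimately show "x \<in> B" "s \<in> B" by blast+
  qed
  define N1 where "N1 = p\<^sup>2 + q\<^sup>2 + t\<^sup>2"
  define N2 where "N2 = (p + 1 + P1)\<^sup>2 + (q + 1 + Q1)\<^sup>2 + (t + 1 + R1)\<^sup>2"
  have Nx: "qnorm (h x x) = 2 powi (2 * (e + 1)) * N1" "qnorm (h s s) = 2 powi (2 * (e + 1)) * N2"
    unfolding P(1) hs N1_def N2_def by (simp_all add: qnorm_mult powi_sq)
  have NN: "N1 \<noteq> 0 \<and> N2 \<noteq> 0 \<and> val N1 + val N2 = 1"
    using o
  proof
    assume 1: "odds p q t = 1"
    then have "odds (p + 1 + P1) (q + 1 + Q1) (t + 1 + R1) = 2" using o' by simp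
    then show ?thesis using odds_val(1)[OF P(2-4) 1] odds_val(2)[OF i] unfolding N1_def N2_def by simp
  next
    assume 2: "odds p q t = 2"
    then have "odds (p + 1 + P1) (q + 1 + Q1) (t + 1 + R1) = 1" using o' by simp
    then show ?thesis using odds_val(2)[OF P(2-4) 2] odds_val(1)[OF i] unfolding N1_def N2_def by simp
  qed
  have hn: "h x x \<noteq> 0" "h s s \<noteq> 0" using Nx NN qnorm_eq_0 by force+
  show ?thesis
  proof (rule Hgrp_full[OF _ _ _ binary_norms[OF r B_def sc xB(1) P] binary_norms[OF r B_def sc xB(2) hs i mx]])
    show "sum3 (qnorm (h x x))" "sum3 (qnorm (h s s))" using pure_sum3[OF pure_h] hn by blast+
    show "qnorm (h x x) * qnorm (h s s) \<noteq> z\<^sup>2" for z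
    proof (rule not_square_odd)
      show "qnorm (h x x) * qnorm (h s s) \<noteq> 0" using hn by simp
      have "val (qnorm (h x x) * qnorm (h s s)) = 2 * (2 * (e + 1)) + (val N1 + val N2)"
        unfolding Nx using NN by (simp add: val_mult power_int_2_val)
      then show "odd (val (qnorm (h x x) * qnorm (h s s)))" using NN by simp
    qed
  qed
qed

end


section \<open>Upper bounds for orthogonal lattices\<close>

locale diagonal_lattice = decomposed_lattice val n Hm L Ls for val :: "'k::field_char_0 \<Rightarrow> int" and n Hm L Ls +
  assumes rank1: "\<And>r. r < length Ls \<Longrightarrow> free_rank val (Ls ! r) 1"
begin

abbreviation m :: nat where "m \<equiv> length Ls"

definition g :: "nat \<Rightarrow> 'k vec" where "g r = (SOME x. gen val (Ls ! r) x)"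

definition a :: "nat \<Rightarrow> 'k quat" where "a r = h (g r) (g r)"

lemma gen_g: "r < m \<Longrightarrow> gen val (Ls ! r) (g r)"
proof -
  assume "r < m"
  then obtain bs where bs: "length bs = 1" "dindep bs" "Ls ! r = ospan val bs" using rank1 unfolding free_rank_def by metis
  then obtain b where b: "bs = [b]" by (auto simp: length_Suc_conv)
  have "b \<noteq> 0" using bs(2) dindep_1 unfolding b by blast
  then have "gen val (Ls ! r) b" using bs b unfolding gen_def vec_folds by simp
  then show ?thesis unfolding g_def by (rule someI[of "gen val (Ls ! r)"])
qed

lemma a_facts: "r < m \<Longrightarrow> a r \<noteq> 0" "pure (a r)"
  using gen_facts(2)[OF _ gen_g] unfolding a_def by auto

lemma g_L: "r < m \<Longrightarrow> g r \<in> L" using comp_sub gen_facts(1) gen_g by blast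
lemma g_V: "r < m \<Longrightarrow> V (g r)" using gen_facts(3) gen_g by blast

lemma g_orth: "r < m \<Longrightarrow> s < m \<Longrightarrow> r \<noteq> s \<Longrightarrow> h (g r) (g s) = 0"
  using orth gen_facts(1) gen_g by blast

lemma L_expand: "z \<in> L \<Longrightarrow> \<exists>c. z = (\<Sum>r<m. smul (c r) (g r))"
proof -
  assume "z \<in> L"
  then obtain f where f: "z = (\<Sum>r<m. f r)" "\<forall>r<m. f r \<in> Ls ! r" unfolding L_iff by blast
  have "\<exists>c. f r = smul c (g r)" if "r < m" for r using gen_facts(5)[OF that gen_g[OF that]] f(2) that by blast
  then obtain c where "\<forall>r<m. f r = smul (c r) (g r)" by metis
  then show ?thesis unfolding f by (intro exI[of _ c] sum.cong) auto
qed

lemma h_comb: "s < m \<Longrightarrow> h (\<Sum>r<m. smul (c r) (g r)) (g s) = c s * a s"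
proof -
  assume s: "s < m"
  have "h (\<Sum>r<m. smul (c r) (g r)) (g s) = (\<Sum>r<m. if r = s then c s * a s else 0)"
    unfolding hform_sum hform_linear using g_orth s by (intro sum.cong) (auto simp: a_def)
  then show ?thesis using s by simp
qed

lemma expand: assumes "V x" shows "x = (\<Sum>r<m. smul (h x (g r) * qinv (a r)) (g r))"
proof -
  let ?y = "\<Sum>r<m. smul (h x (g r) * qinv (a r)) (g r)"
  have y: "V ?y" using g_V by (intro inV_sum) auto
  have d: "h (x - ?y) (g s) = 0" if "s < m" for s
    using h_comb[OF that] a_facts(1)[OF that] by (simp add: hform_linear mult.assoc qinv_left)
  have "x - ?y = 0"
  proof (rule nondeg_L)
    show "V (x - ?y)" using assms y by simp
    fix z assume "z \<in> L"
    then obtain c where z: "z = (\<Sum>r<m. smul (c r) (g r))" using L_expand by blast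
    have "h (x - ?y) z = (\<Sum>r<m. h (x - ?y) (g r) * qconj (c r))" unfolding z hform_sum hform_linear ..
    also have "\<dots> = 0" using d by (intro sum.neutral) auto
    finally show "h (x - ?y) z = 0" .
  qed
  then show ?thesis by simp
qed

lemma isom_eqI:
  assumes f: "isom f" and fixed: "\<And>r. r < m \<Longrightarrow> f (g r) = g r" and x: "V x"
  shows "f x = x"
proof -
  have "f x = f (\<Sum>r<m. smul (h x (g r) * qinv (a r)) (g r))" using expand[OF x] by simp
  also have "\<dots> = (\<Sum>r<m. smul (h x (g r) * qinv (a r)) (g r))"
    unfolding isom_sum[OF f] isomD(2)[OF f] using fixed by (intro sum.cong) auto
  also have "\<dots> = x" using expand[OF x] by simp
  finally show ?thesis .
qed

text \<open>Multiplication by \<open>\<eta>\<close> along a generator \<open>x\<close> with \<open>h x x = b\<close> is trivial or a simple rotation preserving the lattice.\<close>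

definition twist :: "('k \<Rightarrow> bool) \<Rightarrow> 'k quat \<Rightarrow> 'k quat \<Rightarrow> bool" where
  "twist G b \<eta> \<longleftrightarrow> \<eta> = 1 \<or>
     (\<exists>\<sigma>. \<sigma> \<noteq> 0 \<and> \<sigma> - qconj \<sigma> = b \<and> qnu val \<sigma> \<le> qnu val b \<and> \<eta> = qconj \<sigma> * qinv \<sigma> \<and> G (qnorm \<sigma>))"

lemma twist_word:
  assumes "k < m" "twist G (a k) \<eta>" "G 1"
  obtains W where "valid_word W" "G (spin W)" "comp_rots n Hm W ` L = L" "comp_rots n Hm W (g k) = smul \<eta> (g k)"
    "\<And>r. r < m \<Longrightarrow> r \<noteq> k \<Longrightarrow> comp_rots n Hm W (g r) = g r"
proof (cases "\<eta> = 1")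
  case True
  then show ?thesis using that[of "[]"] assms(3) by (simp add: smul_simps)
next
  case False
  then obtain \<sigma> where \<sigma>: "\<sigma> \<noteq> 0" "\<sigma> - qconj \<sigma> = a k" "qnu val \<sigma> \<le> qnu val (a k)" "\<eta> = qconj \<sigma> * qinv \<sigma>" "G (qnorm \<sigma>)"
    using assms(2) unfolding twist_def by blast
  have v: "valid_rot n Hm (g k, \<sigma>)" using \<sigma> g_V[OF assms(1)] by (simp add: valid_rot_iff a_def)
  show ?thesis
  proof (rule that[of "[(g k, \<sigma>)]"])
    show "valid_word [(g k, \<sigma>)]" using v by simp
    show "G (spin [(g k, \<sigma>)])" using \<sigma> by simp
    have "rot n Hm (g k) \<sigma> ` L = L"
      using rot_stabilizes[OF omodule_L g_L[OF assms(1)] v gen_proj_dv[OF assms(1) gen_g[OF assms(1)]]] \<sigma>(3) by (simp add: a_def)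
    then show "comp_rots n Hm [(g k, \<sigma>)] ` L = L" by (simp add: image_def)
    have "1 - a k * qinv \<sigma> = \<eta>" using \<sigma> by (simp add: \<sigma>(2)[symmetric] left_diff_distrib qinv_right)
    then show "comp_rots n Hm [(g k, \<sigma>)] (g k) = smul \<eta> (g k)"
      by (simp add: rot_eq a_def[symmetric] smul_simps flip: \<open>1 - a k * qinv \<sigma> = \<eta>\<close>)
    show "comp_rots n Hm [(g k, \<sigma>)] (g r) = g r" if "r < m" "r \<noteq> k" for r
      using g_orth[OF that(1) assms(1) that(2)] by (simp add: rot_eq smul_simps)
  qed
qed

text \<open>The vector \<open>g k - y\<close> pairs to zero with earlier generators, to \<sigma>
  with \<open>g k\<close>, and into the ideal of \<open>a r\<close> with a later \<open>g r\<close>.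
  The bound by the later \<open>a j\<close> therefore makes the rotation integral on the
  lattice.\<close>

lemma step_rotation:
  assumes k: "k < m" and y: "y \<in> L" "h y y = a k" "\<And>i. i < k \<Longrightarrow> h y (g i) = 0"
    and \<sigma>: "\<sigma> = h (g k) (g k - y)" "\<sigma> \<noteq> 0" "\<And>j. k < j \<Longrightarrow> j < m \<Longrightarrow> qnu val \<sigma> \<le> qnu val (a j)"
  shows "valid_rot n Hm (g k - y, \<sigma>)" "rot n Hm (g k - y) \<sigma> ` L = L" "rot n Hm (g k - y) \<sigma> (g k) = y"
    "\<And>i. i < k \<Longrightarrow> rot n Hm (g k - y) \<sigma> (g i) = g i"
proof -
  define s where "s = g k - y"
  have s: "s \<in> L" using omoduleD(5)[OF omodule_L g_L[OF k] y(1)] by (simp add: s_def)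
  have "\<sigma> - qconj \<sigma> = h (g k) s + h s (g k)" unfolding \<sigma>(1) s_def[symmetric] h_qconj by simp
  also have "\<dots> = h s s" using y(2) by (simp add: s_def hform_linear a_def)
  finally have v: "valid_rot n Hm (s, \<sigma>)" using \<sigma>(2) omoduleD(2)[OF omodule_L s] by (simp add: valid_rot_iff)
  then show "valid_rot n Hm (g k - y, \<sigma>)" by (simp add: s_def)
  have low: "h (g i) s = 0" if "i < k" for i
    using y(3)[OF that] g_orth[of i k] k that h_zero_sym[of y "g i"] by (simp add: s_def hform_linear)
  have gs: "qdv (qnu val \<sigma>) (h (g r) s)" if r: "r < m" for r
  proof -
    consider "r < k" | "r = k" | "k < r" by linarith
    then show ?thesis
    proof cases
      case 3
      have "qdv (qnu val (a r)) (h s (g r))" using gen_proj_dv[OF r gen_g[OF r] s] by (simp add: a_def)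
      then have "qdv (qnu val \<sigma>) (h s (g r))" using \<sigma>(3)[OF 3 r] by (rule qdv_mono)
      then show ?thesis unfolding h_skew[of "g r" s] by simp
    qed (use low \<sigma> in \<open>auto simp: s_def qdv_iff\<close>)
  qed
  have M: "qdv (qnu val \<sigma>) (h z s)" if z: "z \<in> L" for z
  proof -
    have "h z s = h (\<Sum>r<m. smul (h z (g r) * qinv (a r)) (g r)) s" using expand[OF omoduleD(2)[OF omodule_L z]] by simp
    also have "\<dots> = (\<Sum>r<m. (h z (g r) * qinv (a r)) * h (g r) s)" by (simp only: hform_sum hform_linear)
    also have "qdv (qnu val \<sigma>) \<dots>"
    proof (rule qdv_sum)
      fix r assume "r \<in> {..<m}"
      then have r: "r < m" by simp
      have "qdv 0 (h z (g r) * qinv (a r))"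
        using gen_proj_dv[OF r gen_g[OF r] z] a_facts(1)[OF r] by (simp add: qdv_qinv a_def)
      then show "qdv (qnu val \<sigma>) (h z (g r) * qinv (a r) * h (g r) s)" using qdv_mult gs[OF r] by fastforce
    qed
    finally show ?thesis .
  qed
  show "rot n Hm (g k - y) \<sigma> ` L = L" using rot_stabilizes[OF omodule_L s v M order_refl] by (simp add: s_def)
  show "rot n Hm (g k - y) \<sigma> (g k) = y"
    unfolding rot_eq \<sigma>(1)[symmetric] using \<sigma>(2) by (simp add: qinv_right smul_simps)
  show "rot n Hm (g k - y) \<sigma> (g i) = g i" if "i < k" for i
    unfolding rot_eq using low[OF that] by (simp add: s_def smul_simps)
qed

text \<open>Downward induction from \<open>k = m\<close>, where all generators are fixed. The
  premise \<open>main\<close> isolates the arithmetic of one step: \<open>l\<close> is the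
  coefficient of \<open>g k\<close> in its image, \<open>Y\<close> the form value of the part in the
  later components, and \<open>G\<close> the admissible norms.\<close>

lemma stabilizer_words:
  assumes G1: "G 1" and Gm: "\<And>c d. G c \<Longrightarrow> G d \<Longrightarrow> G (c * d)"
    and main: "\<And>k l Y. k < m \<Longrightarrow> qdv 0 l \<Longrightarrow> pure Y \<Longrightarrow> a k = l * a k * qconj l + Y \<Longrightarrow>
        (\<And>M. (\<And>j. k < j \<Longrightarrow> j < m \<Longrightarrow> M \<le> qnu val (a j)) \<Longrightarrow> qdv M Y) \<Longrightarrow>
        \<exists>\<eta>. twist G (a k) \<eta> \<and> 1 - l * \<eta> \<noteq> 0 \<and> (\<forall>j. k < j \<longrightarrow> j < m \<longrightarrow> qnu val (a k) + qnu val (1 - l * \<eta>) \<le> qnu val (a j)) \<and>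
          G (qnorm (a k) * qnorm (1 - l * \<eta>))"
    and k: "k \<le> m" and f: "isom f" "f ` L \<subseteq> L" "\<And>i. i < k \<Longrightarrow> f (g i) = g i"
  shows "\<exists>rs. valid_word rs \<and> (\<forall>x. V x \<longrightarrow> comp_rots n Hm rs x = f x) \<and> G (spin rs)"
  using k f
proof (induction k arbitrary: f rule: inc_induct)
  case base
  then show ?case using isom_eqI[of f] G1 by (intro exI[of _ "[]"]) auto
next
  case (step k)
  have k: "k < m" by fact
  note f = step.prems
  define y where "y = f (g k)"
  have yL: "y \<in> L" using f(2) g_L[OF k] by (auto simp: y_def)
  have yV: "V y" using omoduleD(2)[OF omodule_L yL] .
  have ylow: "h y (g i) = 0" if "i < k" for i
    using isomD(3)[OF f(1), of "g k" "g i"] f(3)[OF that] g_orth[of k i] k that by (simp add: y_def)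
  define c where "c r = h y (g r) * qinv (a r)" for r
  have c0: "qdv 0 (c r)" if "r < m" for r
    using gen_proj_dv[OF that gen_g[OF that] yL] a_facts(1)[OF that] by (simp add: qdv_qinv a_def c_def)
  have ye: "y = (\<Sum>r<m. smul (c r) (g r))" using expand[OF yV] by (simp add: c_def)
  have clow: "c r = 0" if "r < k" for r using ylow[OF that] by (simp add: c_def)
  define l where "l = c k"
  define Y where "Y = (\<Sum>r\<in>{..<m}-{k}. c r * a r * qconj (c r))"
  have "h y (g r) = c r * a r" if "r < m" for r using h_comb[OF that, of c] ye by simp
  then have hgy: "h (g r) y = a r * qconj (c r)" if "r < m" for r
    using that a_facts(2)[of r] by (subst h_skew) (simp add: qconj_mult pure_def)
  have "h (\<Sum>r<m. smul (c r) (g r)) y = (\<Sum>r<m. c r * a r * qconj (c r))"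
    unfolding hform_sum hform_linear using hgy by (intro sum.cong) (auto simp: mult.assoc)
  then have "h y y = (\<Sum>r<m. c r * a r * qconj (c r))" using ye by simp
  also have "\<dots> = l * a k * qconj l + Y" unfolding Y_def l_def using k by (intro sum.remove) auto
  finally have yy: "h y y = l * a k * qconj l + Y" .
  have hyy: "h y y = a k" using isomD(3)[OF f(1)] by (simp add: y_def a_def)
  have aX: "a k = l * a k * qconj l + Y" using yy hyy by simp
  then have "Y = a k - l * a k * qconj l" by (simp add: algebra_simps)
  then have pX: "pure Y" using pure_diff[OF a_facts(2) pure_conj[OF a_facts(2)]] by simp
  have qX: "qdv M Y" if M: "\<And>j. k < j \<Longrightarrow> j < m \<Longrightarrow> M \<le> qnu val (a j)" for M
    unfolding Y_def
  proof (rule qdv_sum)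
    fix r assume r: "r \<in> {..<m} - {k}"
    show "qdv M (c r * a r * qconj (c r))"
    proof (cases "r < k")
      case True then show ?thesis using clow by simp
    next
      case False
      then have "k < r" "r < m" using r by auto
      then have "qdv M (a r)" using M a_facts(1) by (simp add: qdv_iff)
      then show ?thesis using qdv_mult[OF qdv_mult[OF c0[OF \<open>r < m\<close>]], of M "a r" 0 "qconj (c r)"] c0[OF \<open>r < m\<close>] by simp
    qed
  qed
  obtain \<eta> where \<eta>: "twist G (a k) \<eta>" "1 - l * \<eta> \<noteq> 0" "G (qnorm (a k) * qnorm (1 - l * \<eta>))"
    "\<And>j. k < j \<Longrightarrow> j < m \<Longrightarrow> qnu val (a k) + qnu val (1 - l * \<eta>) \<le> qnu val (a j)"
    using main[OF k c0[OF k, folded l_def] pX aX qX] by blast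
  obtain W where W: "valid_word W" "G (spin W)" "comp_rots n Hm W ` L = L" "comp_rots n Hm W (g k) = smul \<eta> (g k)"
    "\<And>r. r < m \<Longrightarrow> r \<noteq> k \<Longrightarrow> comp_rots n Hm W (g r) = g r"
    using twist_word[OF k \<eta>(1) G1] by blast
  note iW = comp_rots_isom[OF W(1)]
  define z where "z = comp_rots n Hm W y"
  define d where "d r = (if r = k then l * \<eta> else c r)" for r
  have "z = (\<Sum>r<m. smul (c r) (comp_rots n Hm W (g r)))"
    unfolding z_def by (subst ye) (simp only: isom_sum[OF iW] isomD(2)[OF iW])
  also have "\<dots> = (\<Sum>r<m. smul (d r) (g r))"
    using W(4,5) by (intro sum.cong) (auto simp: d_def l_def smul_smul)
  finally have z: "z = (\<Sum>r<m. smul (d r) (g r))" .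
  have zL: "z \<in> L" using W(3) yL by (auto simp: z_def)
  have zz: "h z z = a k" using isomD(3)[OF iW] hyy by (simp add: z_def)
  have zg: "h z (g r) = d r * a r" if "r < m" for r using h_comb[OF that, of d] z by simp
  have zlow: "h z (g i) = 0" if "i < k" for i using zg[of i] that k clow[OF that] by (simp add: d_def)
  define \<sigma> where "\<sigma> = h (g k) (g k - z)"
  have "h (g k) z = a k * qconj (l * \<eta>)"
    using zg[OF k] a_facts(2)[of k] by (subst h_skew) (simp add: qconj_mult pure_def d_def)
  \<comment> \<open>The valuation and the norm of \<sigma> split into the contributions of
    \<open>a k\<close> and \<open>1 - l * \<eta>\<close>, which are the two quantities controlled by
    \<open>main\<close>.\<close>
  then have \<sigma>: "\<sigma> = a k * qconj (1 - l * \<eta>)" by (simp add: \<sigma>_def hform_linear right_diff_distrib flip: a_def)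
  have \<sigma>0: "\<sigma> \<noteq> 0" using \<eta>(2) a_facts(1)[OF k] by (simp add: \<sigma> del: qconj_simps)
  have "qnu val \<sigma> = qnu val (a k) + qnu val (1 - l * \<eta>)"
    unfolding \<sigma> using \<eta>(2) a_facts(1)[OF k] by (subst qnu_mult) (simp_all del: qconj_simps)
  then have \<sigma>j: "qnu val \<sigma> \<le> qnu val (a j)" if "k < j" "j < m" for j using \<eta>(4)[OF that] by simp
  have G\<sigma>: "G (qnorm \<sigma>)" using \<eta>(3) unfolding \<sigma> qnorm_mult qnorm_simps .
  let ?s = "g k - z"
  have R: "valid_rot n Hm (?s, \<sigma>)" "rot n Hm ?s \<sigma> ` L = L" "rot n Hm ?s \<sigma> (g k) = z"
    "\<And>i. i < k \<Longrightarrow> rot n Hm ?s \<sigma> (g i) = g i"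
    using step_rotation[OF k zL zz zlow \<sigma>_def \<sigma>0 \<sigma>j] by blast+
  define f2 where "f2 x = rot n Hm ?s (- qconj \<sigma>) (comp_rots n Hm W (f x))" for x
  have v': "valid_rot n Hm (?s, - qconj \<sigma>)" using valid_rot_inverse[OF R(1)] .
  have i2: "isom f2" unfolding f2_def by (intro isom_comp[OF rot_isom[OF v']] isom_comp[OF iW f(1)])
  have inv: "rot n Hm ?s (- qconj \<sigma>) (rot n Hm ?s \<sigma> x) = x" for x using rot_inverse[OF R(1)] .
  have L2: "f2 ` L \<subseteq> L"
  proof (rule image_subsetI)
    fix x assume "x \<in> L"
    then have "comp_rots n Hm W (f x) \<in> L" using f(2) W(3) by blast
    then obtain u where "u \<in> L" "comp_rots n Hm W (f x) = rot n Hm ?s \<sigma> u" using R(2) by blast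
    then show "f2 x \<in> L" using inv by (simp add: f2_def)
  qed
  have fix2: "f2 (g i) = g i" if "i < Suc k" for i
  proof (cases "i = k")
    case True
    have "f2 (g k) = rot n Hm ?s (- qconj \<sigma>) z" by (simp add: f2_def z_def y_def)
    then show ?thesis using inv[of "g k"] R(3) True by simp
  next
    case False
    then have i: "i < k" using that by simp
    have "f2 (g i) = rot n Hm ?s (- qconj \<sigma>) (g i)"
      using f(3)[OF i] W(5)[of i] i k by (simp add: f2_def)
    then show ?thesis using inv[of "g i"] R(4)[OF i] by simp
  qed
  obtain rs where rs: "valid_word rs" "\<And>x. V x \<Longrightarrow> comp_rots n Hm rs x = f2 x" "G (spin rs)"
    using step.IH[OF i2 L2 fix2] by blast
  show ?case
  proof (intro exI[of _ "inv_word W @ (?s, \<sigma>) # rs"] conjI allI impI)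
    show "valid_word (inv_word W @ (?s, \<sigma>) # rs)" using valid_inv_word[OF W(1)] R(1) rs(1) by auto
    show "G (spin (inv_word W @ (?s, \<sigma>) # rs))" using Gm W(2) G\<sigma> rs(3) by simp
    fix x assume "V x"
    then show "comp_rots n Hm (inv_word W @ (?s, \<sigma>) # rs) x = f x"
      using rs(2) rot_inverse'[OF R(1)] comp_inv_word[OF W(1)] by (simp add: f2_def)
  qed
qed

text \<open>The given word and the constructed one act alike on the space, so their quotient is a
  word for the identity and their spinor norms differ by a square.\<close>

theorem Hgrp_upper:
  assumes G1: "G 1" and Gm: "\<And>c d. G c \<Longrightarrow> G d \<Longrightarrow> G (c * d)" and Gs: "\<And>c y. G c \<Longrightarrow> y \<noteq> 0 \<Longrightarrow> G (c * y\<^sup>2)"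
    and main: "\<And>k l Y. k < m \<Longrightarrow> qdv 0 l \<Longrightarrow> pure Y \<Longrightarrow> a k = l * a k * qconj l + Y \<Longrightarrow>
        (\<And>M. (\<And>j. k < j \<Longrightarrow> j < m \<Longrightarrow> M \<le> qnu val (a j)) \<Longrightarrow> qdv M Y) \<Longrightarrow>
        \<exists>\<eta>. twist G (a k) \<eta> \<and> 1 - l * \<eta> \<noteq> 0 \<and> (\<forall>j. k < j \<longrightarrow> j < m \<longrightarrow> qnu val (a k) + qnu val (1 - l * \<eta>) \<le> qnu val (a j)) \<and>
          G (qnorm (a k) * qnorm (1 - l * \<eta>))"
    and c: "c \<in> Hgrp n Hm L"
  shows "G c"
proof -
  obtain rs y where rs: "valid_word rs" "comp_rots n Hm rs ` L = L" "c = spin rs * y\<^sup>2" "y \<noteq> 0"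
    using c unfolding Hgrp_iff by blast
  note i = comp_rots_isom[OF rs(1)]
  obtain rs' where rs': "valid_word rs'" "\<And>x. V x \<Longrightarrow> comp_rots n Hm rs' x = comp_rots n Hm rs x" "G (spin rs')"
  proof -
    have "\<exists>rs'. valid_word rs' \<and> (\<forall>x. V x \<longrightarrow> comp_rots n Hm rs' x = comp_rots n Hm rs x) \<and> G (spin rs')"
      by (rule stabilizer_words[where k = 0, OF G1 Gm _ _ i], assumption, assumption, rule main, assumption+)
        (use rs(2) in auto)
    then show thesis using that by blast
  qed
  obtain z where z: "z \<noteq> 0" "spin (inv_word rs' @ rs) = z\<^sup>2"
  proof (rule spinor_norm_trivial)
    show "valid_word (inv_word rs' @ rs)" using valid_inv_word[OF rs'(1)] rs(1) by auto
    show "comp_rots n Hm (inv_word rs' @ rs) x = x" if "V x" for x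
      using comp_inv_word[OF rs'(1), of x] rs'(2)[OF that] by simp
  qed
  have 0: "spin rs' \<noteq> 0" using spin_nonzero[OF rs'(1)] .
  have "spin rs' * spin rs = z\<^sup>2" using z(2) by simp
  then have "spin rs = z\<^sup>2 / spin rs'" using 0 by (simp add: field_simps)
  also have "\<dots> = spin rs' * (z / spin rs')\<^sup>2" using 0 by (simp add: power2_eq_square)
  finally have "c = spin rs' * (z / spin rs' * y)\<^sup>2"
    unfolding rs(3) by (simp only: power_mult_distrib mult.assoc)
  then show ?thesis using Gs[OF rs'(3), of "z / spin rs' * y"] z(1) 0 rs(4) by simp
qed

end


section \<open>Components that nearly preserve their own line: the ramified case\<close>

context Q2_field
begin

text \<open>Of the two square roots the one congruent to 1 modulo 4 is taken, so that
  \<open>1 + e\<close> is exactly twice a unit.\<close>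

lemma unit_root:
  assumes "dv 3 (N - 1)"
  obtains e where "N = e\<^sup>2" "e \<noteq> 0" "val e = 0" "1 + e \<noteq> 0" "val (1 + e) = 1"
proof -
  obtain e where e: "N = e\<^sup>2" "e \<noteq> 0" "val e = 0" using square_1_mod_8[OF assms] .
  then obtain t where t: "e = 1 + 2 * t" "dv 0 t" by (auto elim: unit_odd)
  have v: "2 * u \<noteq> 0" "val (2 * u) = 1" if "un u" for u using that by (simp_all add: un_def val_mult)
  from t(2) show thesis
  proof (cases rule: dv_0_cases)
    case (1 v)
    have u: "un (1 + 2 * v)" using odd_unit[OF 1(2)] by (simp add: un_def)
    have eq: "1 + e = 2 * (1 + 2 * v)" using t 1 by simp
    have "1 + e \<noteq> 0" "val (1 + e) = 1" unfolding eq by (rule v[OF u])+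
    then show ?thesis by (rule that[OF e])
  next
    case (2 v)
    have "un (1 + 2 * v)" using odd_unit[OF 2(2)] by (simp add: un_def)
    then have u: "un (- (1 + 2 * v))" unfolding un_def val_minus neg_equal_0_iff_equal .
    have eq: "1 + - e = 2 * (- (1 + 2 * v))" using t 2 by simp
    have "1 + - e \<noteq> 0" "val (1 + - e) = 1" unfolding eq by (rule v[OF u])+
    then show ?thesis using that[of "- e"] e by simp
  qed
qed

text \<open>Splitting \<open>l = z + w\<close> along \<open>K = k(A)\<close> and its orthogonal complement, where \<open>l A l\<^sup>* = A - Y\<close> and \<open>Y\<close> is small:
\<open>N(z) - N(w) = 1 - \<kappa>\<close> and \<open>4 N(A) N(z) N(w) = N(Y - \<kappa> A)\<close>, so \<open>N(w)\<close> is small and \<open>N(z)\<close> is close to \<open>1\<close>.\<close>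

lemma unitary_approx:
  fixes p q s x1 x2 x3 l0 l1 l2 l3 :: 'k
  defines "N0 \<equiv> p\<^sup>2 + q\<^sup>2 + s\<^sup>2" and "D \<equiv> (l1 * p + l2 * q + l3 * s) / (p\<^sup>2 + q\<^sup>2 + s\<^sup>2)"
  assumes eq: "Quat 0 p q s = Quat l0 l1 l2 l3 * Quat 0 p q s * qconj (Quat l0 l1 l2 l3) + Quat 0 x1 x2 x3"
    and i: "dv 0 p" "dv 0 q" "dv 0 s" and N0: "N0 \<noteq> 0" "val N0 = \<epsilon>" and x: "dv (3 + 2 * \<epsilon>) x1" "dv (3 + 2 * \<epsilon>) x2" "dv (3 + 2 * \<epsilon>) x3"
    and \<epsilon>: "\<epsilon> = 0 \<or> \<epsilon> = 1"
  obtains e where "l0\<^sup>2 + D\<^sup>2 * N0 = e\<^sup>2" "e \<noteq> 0" "val e = 0" "1 + e \<noteq> 0" "val (1 + e) = 1"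
    "dv (4 + \<epsilon>) (l1\<^sup>2 + l2\<^sup>2 + l3\<^sup>2 - D\<^sup>2 * N0)"
proof -
  define d where "d = l1 * p + l2 * q + l3 * s"
  define L2 where "L2 = l1\<^sup>2 + l2\<^sup>2 + l3\<^sup>2"
  have D: "D * N0 = d" using N0 by (simp add: D_def d_def N0_def)
  \<comment> \<open>The projection of \<open>l\<close> to \<open>k(A)\<close> is
    \<open>z = l0 + D A\<close>; \<open>Nz\<close> is its norm and \<open>Nw\<close> that of the
    remainder.\<close>
  define Nz where "Nz = l0\<^sup>2 + D\<^sup>2 * N0"
  define Nw where "Nw = L2 - D\<^sup>2 * N0"
  have DN: "D\<^sup>2 * N0 * N0 = d\<^sup>2" using D by (simp add: power2_eq_square mult_ac flip: D)
  obtain u1 u2 u3 where u: "Quat l0 l1 l2 l3 * Quat 0 p q s * qconj (Quat l0 l1 l2 l3) = Quat 0 u1 u2 u3"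
    "u1\<^sup>2 + u2\<^sup>2 + u3\<^sup>2 = (qnorm (Quat l0 l1 l2 l3))\<^sup>2 * N0" unfolding N0_def by (rule conj_vec)
  have u1: "u1 * p + u2 * q + u3 * s = (l0\<^sup>2 - L2) * N0 + 2 * d\<^sup>2"
  proof -
    have "Quat l0 l1 l2 l3 * Quat 0 p q s * qconj (Quat l0 l1 l2 l3) =
      Quat 0 ((l0\<^sup>2 - L2) * p + 2 * d * l1 + 2 * l0 * (l2 * s - l3 * q))
        ((l0\<^sup>2 - L2) * q + 2 * d * l2 + 2 * l0 * (l3 * p - l1 * s))
        ((l0\<^sup>2 - L2) * s + 2 * d * l3 + 2 * l0 * (l1 * q - l2 * p))"
      unfolding L2_def d_def by (simp add: Quat_ops power2_eq_square algebra_simps)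
    then have us: "u1 = (l0\<^sup>2 - L2) * p + 2 * d * l1 + 2 * l0 * (l2 * s - l3 * q)"
      "u2 = (l0\<^sup>2 - L2) * q + 2 * d * l2 + 2 * l0 * (l3 * p - l1 * s)"
      "u3 = (l0\<^sup>2 - L2) * s + 2 * d * l3 + 2 * l0 * (l1 * q - l2 * p)" unfolding u(1) by simp_all
    have "u1 * p + u2 * q + u3 * s = (l0\<^sup>2 - L2) * N0 + 2 * d * (l1 * p + l2 * q + l3 * s)"
      unfolding us N0_def by (simp add: power2_eq_square algebra_simps)
    then show ?thesis unfolding d_def by (simp add: power2_eq_square)
  qed
  have xu: "x1 = p - u1" "x2 = q - u2" "x3 = s - u3" using eq unfolding u(1) by (simp_all add: Quat_ops)
  define \<kappa> where "\<kappa> = (x1 * p + x2 * q + x3 * s) / N0"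
  have k0: "\<kappa> * N0 = x1 * p + x2 * q + x3 * s" using N0 by (simp add: \<kappa>_def)
  also have "\<dots> = N0 - (u1 * p + u2 * q + u3 * s)" unfolding xu N0_def by (simp add: power2_eq_square algebra_simps)
  also have "\<dots> = (1 - (l0\<^sup>2 - L2 + 2 * D\<^sup>2 * N0)) * N0" unfolding u1 using DN by (simp add: algebra_simps)
  finally have "\<kappa> = 1 - (l0\<^sup>2 - L2 + 2 * D\<^sup>2 * N0)" using N0 by simp
  then have zw: "Nz - Nw = 1 - \<kappa>" by (simp add: Nz_def Nw_def)
  have Nl: "qnorm (Quat l0 l1 l2 l3) = Nz + Nw" by (simp add: Nz_def Nw_def L2_def)
  have "x1\<^sup>2 + x2\<^sup>2 + x3\<^sup>2 = N0 - 2 * (u1 * p + u2 * q + u3 * s) + (u1\<^sup>2 + u2\<^sup>2 + u3\<^sup>2)"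
    unfolding xu N0_def by (simp add: power2_eq_square algebra_simps)
  also have "u1 * p + u2 * q + u3 * s = N0 - \<kappa> * N0"
    using \<open>x1 * p + x2 * q + x3 * s = N0 - (u1 * p + u2 * q + u3 * s)\<close> k0 by simp
  finally have "x1\<^sup>2 + x2\<^sup>2 + x3\<^sup>2 - \<kappa>\<^sup>2 * N0 = N0 * ((Nz + Nw)\<^sup>2 - (1 - \<kappa>)\<^sup>2)"
    unfolding u(2) Nl by (simp add: power2_eq_square algebra_simps)
  also have "\<dots> = (4 * N0) * (Nz * Nw)" unfolding zw[symmetric] by (simp add: power2_eq_square algebra_simps)
  finally have key: "x1\<^sup>2 + x2\<^sup>2 + x3\<^sup>2 - \<kappa>\<^sup>2 * N0 = (4 * N0) * (Nz * Nw)" .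
  have "dv (3 + 2 * \<epsilon>) (\<kappa> * N0)" unfolding k0 using x i by (intro dv_add dv_multL)
  then have \<kappa>: "dv (3 + \<epsilon>) \<kappa>" using dv_scaleR[OF N0(1)] N0(2) by (simp add: add.commute)
  have "dv (2 * (3 + \<epsilon>)) (x1\<^sup>2 + x2\<^sup>2 + x3\<^sup>2 - \<kappa>\<^sup>2 * N0)"
  proof (intro dv_diff dv_add)
    show "dv (2 * (3 + \<epsilon>)) (x1\<^sup>2)" "dv (2 * (3 + \<epsilon>)) (x2\<^sup>2)" "dv (2 * (3 + \<epsilon>)) (x3\<^sup>2)"
      unfolding dv_square using x[THEN dv_mono, of "3 + \<epsilon>"] \<epsilon> by auto
    have "dv (2 * (3 + \<epsilon>)) (\<kappa>\<^sup>2)" unfolding dv_square by (rule \<kappa>)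
    moreover have "dv 0 N0" using N0 \<epsilon> by (auto simp: dv_def)
    ultimately show "dv (2 * (3 + \<epsilon>)) (\<kappa>\<^sup>2 * N0)" by (rule dv_multL)
  qed
  then have "dv (2 * (3 + \<epsilon>) - (2 + \<epsilon>)) (Nz * Nw)"
    unfolding key using dv_scale[of "4 * N0" "2 * (3 + \<epsilon>)" "Nz * Nw"] N0 by (simp add: val_mult)
  then have zwdv: "dv (4 + \<epsilon>) (Nz * Nw)" by (simp add: algebra_simps)
  have k3: "dv 3 \<kappa>" using \<kappa> \<epsilon> dv_mono by fastforce
  have Nz: "Nz = Nw + 1 + (- \<kappa>)" using zw by (simp add: algebra_simps)
  have k1: "dv 1 (- \<kappa>)" using dv_mono[OF k3] by simp
  \<comment> \<open>\<open>Nz\<close> and \<open>Nw\<close> differ by an integral amount, so neither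
    can fail to be integral without the other, which contradicts the divisibility of their
    product.\<close>
  have iw: "dv 0 Nw"
  proof (rule ccontr)
    assume n: "\<not> dv 0 Nw"
    have "dv 0 (1 + - \<kappa>)" using dv_mono[OF k1, of 0] by (intro dv_add) simp_all
    then have "\<not> dv 0 Nz" using dv_diff[of 0 Nz "1 + - \<kappa>"] n Nz by auto
    with n have "Nz \<noteq> 0" "Nw \<noteq> 0" "val Nz < 0" "val Nw < 0" by (auto simp: dv_def)
    then show False using zwdv \<epsilon> by (auto simp: dv_def val_mult)
  qed
  have Nw3: "Nw = (l1 - D * p)\<^sup>2 + (l2 - D * q)\<^sup>2 + (l3 - D * s)\<^sup>2"
  proof -
    have "(l1 - D * p)\<^sup>2 + (l2 - D * q)\<^sup>2 + (l3 - D * s)\<^sup>2 = L2 - 2 * D * d + D\<^sup>2 * N0"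
      unfolding L2_def d_def N0_def by (simp add: power2_eq_square algebra_simps)
    also have "\<dots> = Nw" unfolding Nw_def D[symmetric] by (simp add: power2_eq_square algebra_simps)
    finally show ?thesis by simp
  qed
  \<comment> \<open>If \<open>Nw\<close> were a unit, \<open>Nz\<close> would be divisible by 8 and
    \<open>- Nw\<close> would be 1 modulo 8, hence a square. But \<open>Nw\<close> is a sum of three
    squares and four squares are anisotropic.\<close>
  have w1: "dv 1 Nw"
  proof (rule ccontr)
    assume n: "\<not> dv 1 Nw"
    then have w: "Nw \<noteq> 0" "val Nw = 0" using iw odd_not_dv by blast+
    have "dv (4 + \<epsilon>) Nz" using zwdv dv_scaleR[OF w(1), of "4 + \<epsilon>" Nz] w(2) by simp
    then have "dv 3 Nz" using \<epsilon> dv_mono by fastforce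
    then have "dv 3 (- (Nz + \<kappa>))" using k3 by (subst dv_minus) (intro dv_add)
    moreover have "- (Nz + \<kappa>) = - Nw - 1" using Nz by simp
    ultimately obtain y where y: "- Nw = y\<^sup>2" "y \<noteq> 0" using square_1_mod_8 by metis
    then have "(l1 - D * p)\<^sup>2 + (l2 - D * q)\<^sup>2 + (l3 - D * s)\<^sup>2 + y\<^sup>2 = 0" unfolding Nw3[symmetric] y(1)[symmetric] by simp
    then show False using four_squares_0 y(2) by blast
  qed
  have "un Nz" unfolding Nz using parity_flip(1)[OF iw k1] w1 by simp
  then have w: "dv (4 + \<epsilon>) Nw" using zwdv dv_scale[of Nz "4 + \<epsilon>" Nw] by (simp add: un_def)
  then have "dv 3 Nw" using \<epsilon> dv_mono by fastforce
  then have "dv 3 (Nz - 1)" unfolding Nz using dv_diff[OF _ k3] by simp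
  from unit_root[OF this] show thesis using that w unfolding Nz_def Nw_def L2_def by metis
qed

end

context diagonal_lattice
begin

lemma twist_half:
  assumes b: "pure b" "b \<noteq> 0" and G: "G (r\<^sup>2 + qnorm b / 4)" and \<sigma>: "\<sigma> = qof r + qof (1/2) * b"
  shows "\<sigma> \<noteq> 0" "twist G b (qconj \<sigma> * qinv \<sigma>)"
proof -
  have N: "qnorm \<sigma> = r\<^sup>2 + qnorm b / 4"
    using b(1) by (simp add: \<sigma> qnorm_qof_add qnorm_mult power_divide pure_iff)
  have "sum3 (qnorm b / 4)" using b by (intro sum3_quarter pure_sum3)
  from sum3_bound[OF this, of r] have "\<not> qdv (qnu val b + 1) \<sigma>"
    using b by (simp add: qdv_def N qnu_def val_divide add.commute)
  then have s: "\<sigma> \<noteq> 0" "qnu val \<sigma> \<le> qnu val b" unfolding not_qdv_iff by blast+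
  then show "\<sigma> \<noteq> 0" "twist G b (qconj \<sigma> * qinv \<sigma>)"
    unfolding twist_def using half_pure[OF b(1), of r] G N \<sigma> by auto
qed

text \<open>With \<open>z\<close> the projection of \<open>l\<close> to \<open>k(b)\<close> and
  \<open>e\<close> a root of its norm, \<eta> is minus the conjugate of \<open>z\<close> divided by
  \<open>e\<close>. Then \<open>1 - l * \<eta>\<close> has norm \<open>(1 + e)\<^sup>2 + Nw\<close>,
  in which the first term dominates because \<open>1 + e\<close> is twice a unit.\<close>

lemma ramified_step:
  assumes b: "b = qof (2 powi E) * Quat 0 p q s" "b \<noteq> 0" and i: "dv 0 p" "dv 0 q" "dv 0 s"
    and \<epsilon>: "qnu val b = 2 * E + \<epsilon>" "\<epsilon> = 0 \<or> \<epsilon> = 1"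
    and Y: "b = l * b * qconj l + Y" "pure Y" "qdv (2 * (E + (3 + 2 * \<epsilon>))) Y"
    and Gb: "\<And>r. G (r\<^sup>2 + qnorm b / 4)" and Gs: "\<And>c y. G c \<Longrightarrow> y \<noteq> 0 \<Longrightarrow> G (c * y\<^sup>2)" and Gt: "\<And>t. dv (2 + \<epsilon>) t \<Longrightarrow> G (1 + t)"
  shows "\<exists>\<eta>. twist G b \<eta> \<and> 1 - l * \<eta> \<noteq> 0 \<and> qnu val (1 - l * \<eta>) = 2 \<and> G (qnorm (1 - l * \<eta>))"
proof -
  define N0 where "N0 = p\<^sup>2 + q\<^sup>2 + s\<^sup>2"
  have Nb: "qnorm b = 2 powi (2 * E) * N0" by (simp add: b(1) qnorm_mult powi_sq N0_def)
  have N0: "N0 \<noteq> 0" using b(2) Nb by auto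
  have vN0: "val N0 = \<epsilon>" using \<epsilon>(1) N0 unfolding qnu_def Nb by (simp add: val_mult power_int_2_val)
  have pb: "pure b" unfolding b(1) by (simp add: pure_iff)
  obtain l0 l1 l2 l3 where l: "l = Quat l0 l1 l2 l3" by (cases l)
  obtain y1 y2 y3 where y: "Y = qof (2 powi (E + (3 + 2 * \<epsilon>))) * Quat 0 y1 y2 y3" "dv 0 y1" "dv 0 y2" "dv 0 y3"
    by (rule pure_normal[OF Y(2,3)])
  define f where "f = (2::'k) powi (3 + 2 * \<epsilon>)"
  have fd: "dv (3 + 2 * \<epsilon>) (f * x)" if "dv 0 x" for x using that unfolding f_def dv_powi_scale by simp
  have Y0: "Y = qof (2 powi E) * Quat 0 (f * y1) (f * y2) (f * y3)"
    unfolding y(1) by (simp add: qof_mult_Quat f_def mult.assoc flip: powi_mult)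
  let ?A = "Quat 0 p q s"
  have "qof (2 powi E) * ?A = qof (2 powi E) * (l * ?A * qconj l + Quat 0 (f * y1) (f * y2) (f * y3))"
    using Y(1) unfolding b(1) Y0 distrib_left using qof_commute[of l "2 powi E"] by (simp flip: mult.assoc)
  then have "qof (2 powi E) * (?A - (l * ?A * qconj l + Quat 0 (f * y1) (f * y2) (f * y3))) = 0"
    by (simp only: right_diff_distrib diff_self)
  then have A: "?A = Quat l0 l1 l2 l3 * ?A * qconj (Quat l0 l1 l2 l3) + Quat 0 (f * y1) (f * y2) (f * y3)"
    unfolding l by (simp only: quat_mult_eq_0 qof_eq_0) simp
  define D where "D = (l1 * p + l2 * q + l3 * s) / N0"
  obtain e where e: "l0\<^sup>2 + D\<^sup>2 * N0 = e\<^sup>2" "e \<noteq> 0" "val e = 0" "1 + e \<noteq> 0" "val (1 + e) = 1"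
    and w: "dv (4 + \<epsilon>) (l1\<^sup>2 + l2\<^sup>2 + l3\<^sup>2 - D\<^sup>2 * N0)"
    using unitary_approx[OF A i N0[unfolded N0_def] vN0[unfolded N0_def] fd[OF y(2)] fd[OF y(3)] fd[OF y(4)] \<epsilon>(2)]
    unfolding D_def N0_def by metis
  define Nw where "Nw = l1\<^sup>2 + l2\<^sup>2 + l3\<^sup>2 - D\<^sup>2 * N0"
  define z where "z = Quat l0 (D * p) (D * q) (D * s)"
  have Nz: "qnorm z = e\<^sup>2" unfolding e(1)[symmetric] z_def N0_def by (simp add: power_mult_distrib algebra_simps)
  have DN: "D * N0 = l1 * p + l2 * q + l3 * s" using N0 by (simp add: D_def)
  have "qre (l * qconj z) = l0\<^sup>2 + D * (l1 * p + l2 * q + l3 * s)"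
    by (simp add: l z_def Quat_ops power2_eq_square algebra_simps)
  then have re: "qre (l * qconj z) = e\<^sup>2" unfolding DN[symmetric] e(1)[symmetric] by (simp add: power2_eq_square)
  have Nl: "qnorm l = e\<^sup>2 + Nw" unfolding e(1)[symmetric] by (simp add: l Nw_def)
  define \<eta> where "\<eta> = qof (- 1 / e) * qconj z"
  have inv: "qof (1 / e) * qof e = (1 :: 'k quat)" "qof (- 1 / e) = - (qof (1 / e) :: 'k quat)"
    using e(2) unfolding qof_simps(3,4)[symmetric] by (simp_all add: qof_simps(6))
  have "l * \<eta> = - (qof (1 / e) * (l * qconj z))"
    unfolding \<eta>_def inv(2) using qof_commute[of l "1 / e"] by (simp flip: mult.assoc)
  then have "1 - l * \<eta> = qof (1 / e) * (qof e + l * qconj z)" by (simp add: distrib_left inv(1))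
  then have "qnorm (1 - l * \<eta>) = (1 / e)\<^sup>2 * (e\<^sup>2 + 2 * e * e\<^sup>2 + (e\<^sup>2 + Nw) * e\<^sup>2)"
    by (simp only: qnorm_mult qnorm_qof_add re Nl Nz qnorm_simps)
  also have "\<dots> = (1 + e)\<^sup>2 + Nw" using e(2) by (simp add: field_simps power2_eq_square)
  finally have N\<eta>: "qnorm (1 - l * \<eta>) = (1 + e)\<^sup>2 + Nw" .
  \<comment> \<open>The square has valuation two, so the exponent \<open>4 + \<epsilon>\<close> for
    \<open>Nw\<close> drops to \<open>2 + \<epsilon>\<close>, which is the depth appearing in the
    premise on \<open>G (1 + t)\<close>.\<close>
  define t where "t = Nw / (1 + e)\<^sup>2"
  have tw: "(1 + e)\<^sup>2 * t = Nw" using e(4) by (simp add: t_def)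
  have t: "dv (2 + \<epsilon>) t"
    using w dv_scale[of "(1 + e)\<^sup>2" "4 + \<epsilon>" t] e(4,5) unfolding tw Nw_def[symmetric] by (simp add: val_power)
  have N': "qnorm (1 - l * \<eta>) = (1 + t) * (1 + e)\<^sup>2" unfolding N\<eta> tw[symmetric] by (simp add: algebra_simps)
  have "un (1 + t)" using un_add[OF un_1, of t] dv_mono[OF t, of 1] \<epsilon>(2) by auto
  then have "1 - l * \<eta> \<noteq> 0" "qnu val (1 - l * \<eta>) = 2"
    using N' e(4,5) by (auto simp: qnu_def un_def val_mult val_power)
  moreover have "G (qnorm (1 - l * \<eta>))" unfolding N' using Gt[OF t] e(4) by (rule Gs)
  moreover have "twist G b \<eta>"
  proof (cases "D = 0")
    case True
    \<comment> \<open>Here \<open>z\<close> is a scalar and \<eta> is 1 or -1: the identity, or the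
      twist by half of \<open>b\<close>. The general formula below would divide by
      \<open>D = 0\<close>.\<close>
    then have z: "z = qof l0" "l0\<^sup>2 = e\<^sup>2" using e(1) by (simp_all add: z_def qof_def)
    then consider "l0 = e" | "l0 = - e" by (auto simp: power2_eq_iff)
    then show ?thesis
    proof cases
      case 1
      define \<sigma> where "\<sigma> = qof 0 + qof (1/2) * b"
      have tw: "\<sigma> \<noteq> 0" "twist G b (qconj \<sigma> * qinv \<sigma>)" using twist_half[where G = G and b = b and \<sigma> = \<sigma>, OF pb b(2) Gb \<sigma>_def] by blast+
      have "qconj \<sigma> = - \<sigma>" using pb qof_commute[of b "1/2"] by (simp add: \<sigma>_def qconj_mult pure_def qof_simps(5))
      then have "qconj \<sigma> * qinv \<sigma> = - 1" using tw(1) by (simp add: qinv_right)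
      moreover have "\<eta> = - 1" unfolding \<eta>_def z(1) 1 qconj_simps inv(2) using inv(1) by simp
      ultimately show ?thesis using tw(2) by simp
    next
      case 2
      then have "\<eta> = 1" unfolding \<eta>_def z(1) inv(2) qconj_simps using inv(1) by (simp add: qof_simps(3))
      then show ?thesis by (simp add: twist_def)
    qed
  next
    case False
    \<comment> \<open>Hilbert 90: the norm-one element \<eta> of \<open>k(b)\<close> is
      \<open>qconj \<sigma> * qinv \<sigma>\<close> for \<sigma> proportional to
      \<open>z - qof e\<close>. The factor \<open>s0\<close> normalises the pure part of \<sigma> to
      half of \<open>b\<close>.\<close>
    define s0 where "s0 = 2 powi E / (2 * D)"
    define \<sigma> where "\<sigma> = qof (s0 * (l0 - e)) + qof (1/2) * b"
    have \<sigma>: "\<sigma> = qof s0 * (z - qof e)"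
      using False by (simp add: \<sigma>_def b(1) s0_def z_def qof_def Quat_ops)
    have tw: "\<sigma> \<noteq> 0" "twist G b (qconj \<sigma> * qinv \<sigma>)" using twist_half[where G = G and b = b and \<sigma> = \<sigma>, OF pb b(2) Gb \<sigma>_def] by blast+
    have "\<eta> * \<sigma> = qof (- 1 / e) * (qof s0 * (qconj z * (z - qof e)))"
      unfolding \<eta>_def \<sigma> using qof_commute[of "qconj z" s0] by (simp add: mult.assoc) (simp flip: mult.assoc)
    also have "qconj z * (z - qof e) = qof e * (qof e - qconj z)"
      unfolding right_diff_distrib qconj_mult_self Nz power2_eq_square qof_simps(4) qof_commute[of "qconj z" e] ..
    also have "qof (- 1 / e) * (qof s0 * (qof e * (qof e - qconj z))) = qof s0 * (qconj z - qof e)"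
    proof -
      have "qof s0 * (qof e * u) = qof e * (qof s0 * u)" for u
        using qof_commute[of "qof s0" e] by (simp flip: mult.assoc)
      then have "qof (1 / e) * (qof s0 * (qof e * u)) = qof s0 * u" for u
        using inv(1) by (simp flip: mult.assoc)
      then show ?thesis unfolding inv(2) by (simp add: algebra_simps)
    qed
    also have "\<dots> = qconj \<sigma>" unfolding \<sigma> qconj_mult qconj_simps by (rule qof_commute[symmetric])
    finally have "\<eta> = qconj \<sigma> * qinv \<sigma>" using tw(1) by (metis mult.assoc mult.right_neutral qinv_right)
    then show ?thesis using tw(2) by simp
  qed
  ultimately show ?thesis by blast
qed

end


section \<open>Norm forms and lattices with distant or unramified components\<close>

context Q2_field
begin

definition norm_form :: "'k \<Rightarrow> 'k \<Rightarrow> bool" where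
  "norm_form c0 c \<longleftrightarrow> c \<noteq> 0 \<and> (\<exists>x y. c = x\<^sup>2 + c0 * y\<^sup>2)"

lemma norm_form_mult: "norm_form c0 c \<Longrightarrow> norm_form c0 d \<Longrightarrow> norm_form c0 (c * d)"
proof -
  assume "norm_form c0 c" "norm_form c0 d"
  then obtain x y z w where c: "c \<noteq> 0" "c = x\<^sup>2 + c0 * y\<^sup>2" and d: "d \<noteq> 0" "d = z\<^sup>2 + c0 * w\<^sup>2"
    unfolding norm_form_def by blast
  have "c * d = (x * z - c0 * y * w)\<^sup>2 + c0 * (x * w + y * z)\<^sup>2"
    unfolding c(2) d(2) by (simp add: power2_eq_square algebra_simps)
  then show ?thesis using c(1) d(1) unfolding norm_form_def by auto
qed

lemma norm_form_square: "y \<noteq> 0 \<Longrightarrow> norm_form c0 (y\<^sup>2)"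
  unfolding norm_form_def by (intro conjI exI[of _ y] exI[of _ 0]) auto

lemma norm_form_scaled: "c0 \<noteq> 0 \<Longrightarrow> y \<noteq> 0 \<Longrightarrow> norm_form c0 (c0 * y\<^sup>2)"
  unfolding norm_form_def by (intro conjI exI[of _ 0] exI[of _ y]) auto

lemma unit_quotient_square:
  assumes "un b" "dv 3 (a - b)" obtains w where "a = b * w\<^sup>2" "w \<noteq> 0"
proof -
  have b: "b \<noteq> 0" "val b = 0" using assms(1) by (auto simp: un_def)
  have "b * (a / b - 1) = a - b" using b by (simp add: field_simps)
  then have "dv 3 (b * (a / b - 1))" using assms(2) by simp
  then have "dv 3 (a / b - 1)" using b dv_scale[of b 3] by simp
  then obtain w where "a / b = w\<^sup>2" "w \<noteq> 0" by (rule square_1_mod_8)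
  then show thesis using that[of w] b by (simp add: field_simps)
qed

lemma one_plus_even_class:
  assumes "dv 2 t" obtains w where "w \<noteq> 0" "1 + t = w\<^sup>2 \<or> 1 + t = 5 * w\<^sup>2"
proof -
  have "t = 4 * (t / 4)" by simp
  then obtain v where v: "t = 4 * v" "dv 0 v" using assms dv_4[of 2] by (metis diff_self)
  from v(2) show thesis
  proof (cases rule: dv_0_cases)
    case (1 s)
    have "t = 8 * s" using v(1) 1(1) by simp
    then have "dv 3 (1 + t - 1)" using 1(2) by simp
    then show ?thesis using square_1_mod_8 that by metis
  next
    case (2 s)
    have "1 + t - 5 = 8 * s" using v(1) 2(1) by simp
    then have d: "dv 3 (1 + t - 5)" using 2(2) by simp
    have "un 5" by (simp add: un_def)
    from this d obtain w where "1 + t = 5 * w\<^sup>2" "w \<noteq> 0" by (rule unit_quotient_square)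
    then show ?thesis using that by blast
  qed
qed

end

context diagonal_lattice
begin

lemma mu_gap: "Suc r < m \<Longrightarrow> mu val n Hm Ls \<le> ereal (real_of_int (qnu val (a (Suc r)) - qnu val (a r)))"
proof -
  assume r: "Suc r < m"
  have "consec val Ls r (Suc r)" unfolding consec_def using r rank1 by auto
  then have "qnu val (a (Suc r)) - qnu val (a r) \<in> {qnu val (h x' x') - qnu val (h x x) | r r' x x'.
      consec val Ls r r' \<and> gen val (Ls!r) x \<and> gen val (Ls!r') x'}"
    unfolding a_def using gen_g[of r] gen_g[of "Suc r"] r by fastforce
  then show ?thesis unfolding mu_def by (rule INF_lower)
qed

lemma gap_extend:
  assumes d: "0 \<le> d" and gap: "\<And>r. Suc r < m \<Longrightarrow> d \<le> qnu val (a (Suc r)) - qnu val (a r)"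
    and k: "k < j" "j < m"
  shows "qnu val (a k) + d \<le> qnu val (a j)"
  using k
proof (induction j)
  case (Suc j)
  show ?case
  proof (cases "k = j")
    case True then show ?thesis using gap[of j] Suc.prems by simp
  next
    case False
    then show ?thesis using gap[of j] Suc d by simp
  qed
qed simp

lemma scale_dv: assumes r: "r < m" and z: "z \<in> scale n Hm (Ls ! r)" shows "qdv (qnu val (a r)) z"
proof -
  obtain ps where ps: "z = qsum ps (\<lambda>(x, y). h x y)" "set ps \<subseteq> Ls ! r \<times> Ls ! r" using z unfolding scale_def by blast
  have v: "qdv (qnu val (a r)) (h x y)" if "x \<in> Ls ! r" "y \<in> Ls ! r" for x y
  proof -
    obtain c where c: "qdv 0 c" "y = smul c (g r)" using gen_facts(5)[OF r gen_g[OF r]] \<open>y \<in> Ls ! r\<close> by blast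
    have "qdv (qnu val (a r)) (h x (g r))" using gen_proj_dv[OF r gen_g[OF r] comp_sub[OF r that(1)]] by (simp add: a_def)
    then have "qdv (qnu val (a r) + 0) (h x (g r) * qconj c)" using c(1) by (intro qdv_mult) simp_all
    then show ?thesis by (simp add: c(2) hform_linear)
  qed
  show ?thesis unfolding ps(1) using ps(2)
  proof (induction ps)
    case (Cons p ps)
    then show ?case using v unfolding qsum_def by (auto simp: quat_folds intro!: qdv_add)
  qed (simp add: qsum_def quat_folds)
qed

lemma scale_gap:
  assumes "scale n Hm (Ls ! Suc r) \<subseteq> scale n Hm (Ls ! r)" "Suc r < m"
  shows "0 \<le> qnu val (a (Suc r)) - qnu val (a r)"
proof -
  have "g (Suc r) \<in> Ls ! Suc r" using gen_facts(1) gen_g assms(2) by blast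
  then have "a (Suc r) \<in> scale n Hm (Ls ! Suc r)"
    unfolding scale_def a_def by (intro CollectI exI[of _ "[(g (Suc r), g (Suc r))]"]) (simp add: qsum_def quat_folds)
  then have "qdv (qnu val (a r)) (a (Suc r))" using assms by (intro scale_dv) auto
  then show ?thesis using a_facts(1)[OF assms(2)] by (simp add: qdv_iff)
qed

text \<open>With \<open>qnu val (a k) = 2 * E + \<epsilon>\<close> a gap of
  \<open>6 + 3 * \<epsilon>\<close> places the later components, and with them \<open>Y\<close>, at
  valuation \<open>2 * E + 6 + 4 * \<epsilon>\<close>, precisely the depth that
  \<open>ramified_step\<close> requires.\<close>

lemma upper_ramified:
  assumes c0: "c0 \<noteq> 0" and N: "\<And>k. k < m \<Longrightarrow> \<exists>y. y \<noteq> 0 \<and> qnorm (a k) = c0 * y\<^sup>2"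
    and \<epsilon>: "\<epsilon> = 0 \<or> \<epsilon> = 1" "\<And>k. k < m \<Longrightarrow> \<exists>E. qnu val (a k) = 2 * E + \<epsilon>"
    and gap: "\<And>r. Suc r < m \<Longrightarrow> 6 + 3 * \<epsilon> \<le> qnu val (a (Suc r)) - qnu val (a r)"
    and Gt: "\<And>t. dv (2 + \<epsilon>) t \<Longrightarrow> norm_form c0 (1 + t)"
    and c: "c \<in> Hgrp n Hm L"
  shows "norm_form c0 c"
proof (rule Hgrp_upper[where G = "norm_form c0", OF _ norm_form_mult _ _ c])
  show "norm_form c0 1" using norm_form_square[of 1] by simp
  show Gs: "norm_form c0 (c * y\<^sup>2)" if "norm_form c0 c" "y \<noteq> 0" for c y
    using norm_form_mult[OF that(1) norm_form_square[OF that(2)]] .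
  fix k l Y
  assume k: "k < m" and Y: "pure Y" "a k = l * a k * qconj l + Y"
    and qY: "\<And>M. (\<And>j. k < j \<Longrightarrow> j < m \<Longrightarrow> M \<le> qnu val (a j)) \<Longrightarrow> qdv M Y"
  have k': "qnu val (a k) + (6 + 3 * \<epsilon>) \<le> qnu val (a j)" if "k < j" "j < m" for j
    by (rule gap_extend[OF _ gap that]) (use \<epsilon>(1) in auto)
  obtain E where E: "qnu val (a k) = 2 * E + \<epsilon>" using \<epsilon>(2)[OF k] by blast
  have "qdv (2 * E) (a k)" using a_facts(1)[OF k] E \<epsilon>(1) by (auto simp: qdv_iff)
  then obtain p q s where A: "a k = qof (2 powi E) * Quat 0 p q s" "dv 0 p" "dv 0 q" "dv 0 s"
    using pure_normal[OF a_facts(2)] by metis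
  have dY: "qdv (2 * (E + (3 + 2 * \<epsilon>))) Y"
  proof (rule qY)
    show "2 * (E + (3 + 2 * \<epsilon>)) \<le> qnu val (a j)" if "k < j" "j < m" for j using k'[OF that] E \<epsilon>(1) by auto
  qed
  obtain y where y: "y \<noteq> 0" "qnorm (a k) = c0 * y\<^sup>2" using N[OF k] by blast
  \<comment> \<open>Every \<sigma> of a twist has such a norm; it is nonzero because minus the norm
    of a pure quaternion is not a square.\<close>
  have Gb: "norm_form c0 (r\<^sup>2 + qnorm (a k) / 4)" for r
  proof -
    have "sum3 (qnorm (a k) / 4)" using a_facts k by (intro sum3_quarter pure_sum3)
    from sum3_not_neg_square[OF this, of r] have "r\<^sup>2 + qnorm (a k) / 4 \<noteq> 0" unfolding add_eq_0_iff .
    moreover have "qnorm (a k) / 4 = c0 * (y / 2)\<^sup>2" by (simp add: y(2) power_divide)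
    ultimately show ?thesis unfolding norm_form_def by metis
  qed
  obtain \<eta> where \<eta>: "twist (norm_form c0) (a k) \<eta>" "1 - l * \<eta> \<noteq> 0" "qnu val (1 - l * \<eta>) = 2" "norm_form c0 (qnorm (1 - l * \<eta>))"
    using ramified_step[where G = "norm_form c0", OF A(1) a_facts(1)[OF k] A(2-4) E \<epsilon>(1) Y(2,1) dY Gb Gs Gt] by blast
  have "norm_form c0 (qnorm (a k))" unfolding y(2) using c0 y(1) by (rule norm_form_scaled)
  then have "norm_form c0 (qnorm (a k) * qnorm (1 - l * \<eta>))" using \<eta>(4) by (rule norm_form_mult)
  moreover have "qnu val (a k) + qnu val (1 - l * \<eta>) \<le> qnu val (a j)" if "k < j" "j < m" for j
    using k'[OF that] \<eta>(3) \<epsilon>(1) by auto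
  ultimately show "\<exists>\<eta>. twist (norm_form c0) (a k) \<eta> \<and> 1 - l * \<eta> \<noteq> 0 \<and>
      (\<forall>j. k < j \<longrightarrow> j < m \<longrightarrow> qnu val (a k) + qnu val (1 - l * \<eta>) \<le> qnu val (a j)) \<and>
      norm_form c0 (qnorm (a k) * qnorm (1 - l * \<eta>))"
    using \<eta>(1,2) by blast
qed

lemma ramified_Hgrp:
  assumes r: "r < m" "gen val (Ls ! r) x"
    and N: "\<And>k. k < m \<Longrightarrow> \<exists>y. y \<noteq> 0 \<and> qnorm (a k) = qnorm (h x x) * y\<^sup>2"
    and \<epsilon>: "\<epsilon> = 0 \<or> \<epsilon> = 1" "\<And>k. k < m \<Longrightarrow> \<exists>E. qnu val (a k) = 2 * E + \<epsilon>"
    and gap: "\<And>r. Suc r < m \<Longrightarrow> 6 + 3 * \<epsilon> \<le> qnu val (a (Suc r)) - qnu val (a r)"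
    and Gt: "\<And>t. dv (2 + \<epsilon>) t \<Longrightarrow> norm_form (qnorm (h x x)) (1 + t)"
  shows "Hgrp n Hm L = normgrp (h x x)"
proof -
  have eq: "c \<in> normgrp (h x x) \<longleftrightarrow> norm_form (qnorm (h x x)) c" for c
    using normgrp_iff[OF pure_h] unfolding norm_form_def .
  have "qnorm (h x x) \<noteq> 0" using gen_facts(2)[OF r] by simp
  then have "c \<in> Hgrp n Hm L \<Longrightarrow> norm_form (qnorm (h x x)) c" for c
    using upper_ramified[OF _ N \<epsilon> gap Gt] by blast
  moreover have "norm_form (qnorm (h x x)) c \<Longrightarrow> c \<in> Hgrp n Hm L" for c
    unfolding norm_form_def using gen_norms[OF r] by metis
  ultimately show ?thesis using eq by blast
qed

lemma Hgrp_distant_unit_classes: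
  assumes r: "r < m" "gen val (Ls ! r) x"
    and c0: "c0 = 1 \<or> c0 = 5"
    and A: "\<And>r x. r < m \<Longrightarrow> gen val (Ls ! r) x \<Longrightarrow> \<exists>y. y \<noteq> 0 \<and> qnorm (h x x) = c0 * y\<^sup>2"
    and mu: "ereal (real_of_int 6) \<le> mu val n Hm Ls"
  shows "Hgrp n Hm L = normgrp (h x x)"
proof (rule ramified_Hgrp[where \<epsilon> = 0, OF r])
  obtain y0 where y0: "y0 \<noteq> 0" "qnorm (h x x) = c0 * y0\<^sup>2" using A[OF r] by blast
  have c00: "c0 \<noteq> 0" "val c0 = 0" using c0 by auto
  show "\<exists>y. y \<noteq> 0 \<and> qnorm (a k) = qnorm (h x x) * y\<^sup>2" if k: "k < m" for k
  proof -
    obtain y where "y \<noteq> 0" "qnorm (a k) = c0 * y\<^sup>2" using A[OF k gen_g[OF k]] unfolding a_def by blast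
    then show ?thesis using y0 by (intro exI[of _ "y / y0"]) (simp add: power_divide)
  qed
  show "\<exists>E. qnu val (a k) = 2 * E + 0" if k: "k < m" for k
  proof -
    obtain y where "y \<noteq> 0" "qnorm (a k) = c0 * y\<^sup>2" using A[OF k gen_g[OF k]] unfolding a_def by blast
    then show ?thesis using c00 by (intro exI[of _ "val y"]) (simp add: qnu_def val_mult val_power)
  qed
  show "6 + 3 * 0 \<le> qnu val (a (Suc r)) - qnu val (a r)" if "Suc r < m" for r
    using order_trans[OF mu mu_gap[OF that]] by (simp del: of_int_diff)
  show "norm_form (qnorm (h x x)) (1 + t)" if t: "dv (2 + 0) t" for t
  proof -
    obtain w where w: "w \<noteq> 0" "1 + t = w\<^sup>2 \<or> 1 + t = 5 * w\<^sup>2" using t by (auto elim: one_plus_even_class)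
    \<comment> \<open>Since \<open>1 + t\<close> is known modulo 4 only, its class may be that of 5,
      which is represented as \<open>1 + 2\<^sup>2\<close> for \<open>c0 = 1\<close> and as
      \<open>5 * 1\<^sup>2\<close> for \<open>c0 = 5\<close>.\<close>
    have "norm_form (qnorm (h x x)) 5" unfolding norm_form_def y0(2) using c0
    proof
      assume "c0 = 1"
      then have "(5::'k) = 1\<^sup>2 + c0 * y0\<^sup>2 * (2 / y0)\<^sup>2" using y0(1) by (simp add: power_divide)
      then show "5 \<noteq> (0::'k) \<and> (\<exists>x y. 5 = x\<^sup>2 + c0 * y0\<^sup>2 * y\<^sup>2)" by (metis zero_neq_numeral)
    next
      assume "c0 = 5"
      then have "(5::'k) = 0\<^sup>2 + c0 * y0\<^sup>2 * (1 / y0)\<^sup>2" using y0(1) by (simp add: power_divide)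
      then show "5 \<noteq> (0::'k) \<and> (\<exists>x y. 5 = x\<^sup>2 + c0 * y0\<^sup>2 * y\<^sup>2)" by (metis zero_neq_numeral)
    qed
    then show ?thesis using w norm_form_mult[OF _ norm_form_square[OF w(1)]] norm_form_square[OF w(1)] by metis
  qed
qed simp

lemma Hgrp_distant_prime_classes:
  assumes r: "r < m" "gen val (Ls ! r) x"
    and \<pi>: "\<pi> \<noteq> 0" "val \<pi> = 1"
    and A: "\<And>r x. r < m \<Longrightarrow> gen val (Ls ! r) x \<Longrightarrow> \<exists>y. y \<noteq> 0 \<and> qnorm (h x x) = \<pi> * y\<^sup>2"
    and mu: "ereal (real_of_int 8) < mu val n Hm Ls"
  shows "Hgrp n Hm L = normgrp (h x x)"
proof (rule ramified_Hgrp[where \<epsilon> = 1, OF r])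
  obtain y0 where y0: "y0 \<noteq> 0" "qnorm (h x x) = \<pi> * y0\<^sup>2" using A[OF r] by blast
  show "\<exists>y. y \<noteq> 0 \<and> qnorm (a k) = qnorm (h x x) * y\<^sup>2" if k: "k < m" for k
  proof -
    obtain y where "y \<noteq> 0" "qnorm (a k) = \<pi> * y\<^sup>2" using A[OF k gen_g[OF k]] unfolding a_def by blast
    then show ?thesis using y0 by (intro exI[of _ "y / y0"]) (simp add: power_divide)
  qed
  show "\<exists>E. qnu val (a k) = 2 * E + 1" if k: "k < m" for k
  proof -
    obtain y where "y \<noteq> 0" "qnorm (a k) = \<pi> * y\<^sup>2" using A[OF k gen_g[OF k]] unfolding a_def by blast
    then show ?thesis using \<pi> by (intro exI[of _ "val y"]) (simp add: qnu_def val_mult val_power)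
  qed
  \<comment> \<open>Differences of valuations are integers, so exceeding 8 means being at least
    9.\<close>
  show "6 + 3 * 1 \<le> qnu val (a (Suc r)) - qnu val (a r)" if "Suc r < m" for r
    using order.strict_trans2[OF mu mu_gap[OF that]] by (simp del: of_int_diff)
  show "norm_form (qnorm (h x x)) (1 + t)" if t: "dv (2 + 1) t" for t
  proof -
    obtain w where "1 + t = w\<^sup>2" "w \<noteq> 0" using t square_1_mod_8[of "1 + t"] by auto
    then show ?thesis using norm_form_square by simp
  qed
qed simp

text \<open>Here \<open>b\<close> squares to \<open>5 * y\<^sup>2\<close>, so \<open>k(b)\<close> is
  the unramified quadratic field. Its residue field has norm-one elements besides 1, hence some
  \<eta> makes \<open>1 - l * \<eta>\<close> a unit.\<close>

lemma unramified_step: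
  assumes b: "pure b" "y \<noteq> 0" "qnorm b = - 5 * y\<^sup>2" and l: "qdv 0 l" and G: "G = (\<lambda>c. c \<noteq> 0 \<and> even (val c))"
  shows "\<exists>\<eta>. twist G b \<eta> \<and> 1 - l * \<eta> \<noteq> 0 \<and> qnu val (1 - l * \<eta>) = 0"
proof (cases "qdv 1 (1 - l)")
  case False
  then have "1 - l \<noteq> 0" "qnu val (1 - l) \<le> 0" using not_qdv_iff[of 0 "1 - l"] by simp_all
  moreover have "qdv 0 (1 - l)" using l by (intro qdv_diff) simp_all
  ultimately show ?thesis by (intro exI[of _ 1]) (simp add: twist_def qdv_iff)
next
  case True
  have nb: "qnorm b \<noteq> 0" unfolding b(3) using b(2) by simp
  then have b0: "b \<noteq> 0" by simp
  have vb: "qnu val b = 2 * val y" unfolding qnu_def b(3) using b(2) by (simp add: val_mult val_power)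
  \<comment> \<open>This is \<open>y\<close> times \<open>(1 + \<surd>5) / 2\<close> with
    \<open>b\<close> as \<open>y \<surd>5\<close>. Its norm is \<open>- (y\<^sup>2)\<close>, so
    \<sigma> has the valuation of \<open>b\<close> and \<open>1 - \<eta> = b * qinv \<sigma>\<close>
    is a unit.\<close>
  define \<sigma> where "\<sigma> = qof (y / 2) + qof (1/2) * b"
  have N: "(y / 2)\<^sup>2 + qnorm b / 4 = - (y\<^sup>2)" unfolding b(3) by (simp add: power_divide)
  have "G ((y / 2)\<^sup>2 + qnorm b / 4)" unfolding N G using b(2) by (simp add: val_power)
  from twist_half[where G = G and \<sigma> = \<sigma>, OF b(1) b0 this \<sigma>_def]
  have \<sigma>: "\<sigma> \<noteq> 0" "twist G b (qconj \<sigma> * qinv \<sigma>)" by blast+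
  define \<eta> where "\<eta> = qconj \<sigma> * qinv \<sigma>"
  have "qnorm \<sigma> = - (y\<^sup>2)" using b(1) unfolding N[symmetric] by (simp add: \<sigma>_def qnorm_qof_add qnorm_mult power_divide pure_iff)
  then have v\<sigma>: "qnu val \<sigma> = 2 * val y" using b(2) by (simp add: qnu_def val_power)
  have "1 - \<eta> = (\<sigma> - qconj \<sigma>) * qinv \<sigma>" using \<sigma>(1) by (simp add: \<eta>_def left_diff_distrib qinv_right)
  also have "\<sigma> - qconj \<sigma> = b" unfolding \<sigma>_def by (rule half_pure[OF b(1)])
  finally have eq: "1 - \<eta> = b * qinv \<sigma>" .
  have "\<not> qdv 1 (1 - \<eta>)" unfolding eq qdv_qinv[OF \<sigma>(1)] using b0 vb v\<sigma> by (simp add: qdv_iff)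
  moreover have d\<eta>: "qdv 0 \<eta>" unfolding \<eta>_def qdv_qinv[OF \<sigma>(1)] using \<sigma>(1) by (simp add: qdv_iff)
  moreover have "1 - \<eta> = (1 - l * \<eta>) - (1 - l) * \<eta>" by (simp add: algebra_simps)
  ultimately have "\<not> qdv (0 + 1) (1 - l * \<eta>)" using qdv_diff[of 1 "1 - l * \<eta>" "(1 - l) * \<eta>"] qdv_mult[OF True d\<eta>] by auto
  then have "1 - l * \<eta> \<noteq> 0 \<and> qnu val (1 - l * \<eta>) \<le> 0" unfolding not_qdv_iff .
  moreover have "qdv 0 (1 - l * \<eta>)" using l d\<eta> by (intro qdv_diff qdv_mult0) simp_all
  ultimately show ?thesis using \<sigma>(2) unfolding \<eta>_def[symmetric] by (intro exI[of _ \<eta>]) (simp add: qdv_iff)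
qed

text \<open>Since \<open>1 - l * \<eta>\<close> is a unit, the later components may have the same
  valuation: the inclusion of the scales, i.e. a gap of at least zero, is the right hypothesis
  here.\<close>

lemma Hgrp_unramified:
  assumes m: "0 < m" and A: "\<And>k. k < m \<Longrightarrow> \<exists>y. y \<noteq> 0 \<and> qnorm (a k) = - 5 * y\<^sup>2"
    and scales: "\<And>r. Suc r < m \<Longrightarrow> scale n Hm (Ls ! Suc r) \<subseteq> scale n Hm (Ls ! r)"
  shows "Hgrp n Hm L = {u * x\<^sup>2 | u x. kunit val u \<and> x \<noteq> 0}"
proof
  define G where "G = (\<lambda>c::'k. c \<noteq> 0 \<and> even (val c))"
  have "G c" if "c \<in> Hgrp n Hm L" for c
  proof (rule Hgrp_upper[where G = G, OF _ _ _ _ that])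
    show "G 1" by (simp add: G_def)
    show "G (c * d)" if "G c" "G d" for c d using that by (simp add: G_def val_mult)
    show "G (c * y\<^sup>2)" if "G c" "y \<noteq> 0" for c y using that by (simp add: G_def val_mult val_power)
    fix k l Y
    assume k: "k < m" and l: "qdv 0 l"
    obtain y where y: "y \<noteq> 0" "qnorm (a k) = - 5 * y\<^sup>2" using A[OF k] by blast
    obtain \<eta> where \<eta>: "twist G (a k) \<eta>" "1 - l * \<eta> \<noteq> 0" "qnu val (1 - l * \<eta>) = 0"
      using unramified_step[OF a_facts(2) y l G_def] by blast
    have "even (val (qnorm (a k)))" unfolding y(2) using y(1) by (simp add: val_mult val_power)
    then have "G (qnorm (a k) * qnorm (1 - l * \<eta>))"
      using \<eta>(2,3) a_facts(1)[OF k] by (simp add: G_def val_mult qnu_def)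
    moreover have "qnu val (a k) + qnu val (1 - l * \<eta>) \<le> qnu val (a j)" if "k < j" "j < m" for j
      using gap_extend[of 0, OF order_refl scale_gap[OF scales] that] \<eta>(3) by simp
    ultimately show "\<exists>\<eta>. twist G (a k) \<eta> \<and> 1 - l * \<eta> \<noteq> 0 \<and>
      (\<forall>j. k < j \<longrightarrow> j < m \<longrightarrow> qnu val (a k) + qnu val (1 - l * \<eta>) \<le> qnu val (a j)) \<and>
      G (qnorm (a k) * qnorm (1 - l * \<eta>))" using \<eta>(1,2) by blast
  qed
  moreover have "\<exists>u x. c = u * x\<^sup>2 \<and> kunit val u \<and> x \<noteq> 0" if "G c" for c
  proof -
    have c: "c \<noteq> 0" "even (val c)" using that by (simp_all add: G_def)
    from c(2) obtain e where e: "val c = 2 * e" by (rule evenE)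
    have p: "(2::'k) powi e \<noteq> 0" "val (2 powi e) = e" using power_int_2_val[of e] by auto
    have "c = c / (2 powi e)\<^sup>2 * (2 powi e)\<^sup>2" using p by simp
    moreover have "kunit val (c / (2 powi e)\<^sup>2)" using e c p by (simp add: kunit_def val_divide val_power)
    ultimately show ?thesis using p by blast
  qed
  ultimately show "Hgrp n Hm L \<subseteq> {u * x\<^sup>2 | u x. kunit val u \<and> x \<noteq> 0}" by blast
  obtain y where y: "y \<noteq> 0" "qnorm (a 0) = - 5 * y\<^sup>2" using A[OF m] by blast
  have nf: "p\<^sup>2 - 5 * q\<^sup>2 \<in> Hgrp n Hm L" if "p\<^sup>2 - 5 * q\<^sup>2 \<noteq> 0" for p q
  proof -
    have "p\<^sup>2 + qnorm (h (g 0) (g 0)) * (q / y)\<^sup>2 = p\<^sup>2 - 5 * q\<^sup>2"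
      using y by (simp add: power_divide flip: a_def)
    then show ?thesis using gen_norms[OF m gen_g[OF m], of p "q / y"] that by simp
  qed
  have cls: "s \<in> Hgrp n Hm L" if "t \<in> Hgrp n Hm L" "dv 3 (s - t)" "un t" for s t
    using that unit_quotient_square[OF that(3,2)] Hgrp_mult_square[OF that(1)] by metis
  have v19: "un (- 19)" using un_of_dv2[of "-19"] dv_4[of 2 "-5"] by simp
  \<comment> \<open>The norms \<open>0 - 5\<close>, \<open>1 - 5 * 2\<^sup>2\<close> and
    \<open>2\<^sup>2 - 5\<close> are congruent to 3, 5 and 7 modulo 8.\<close>
  have H: "r \<in> Hgrp n Hm L" if "r \<in> {1, 3, 5, 7}" for r
    using that
  proof (elim insertE)
    assume r: "r = 1"
    show ?thesis using Hgrp_square[of 1] r by simp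
  next
    assume r: "r = 3"
    have "- 5 \<in> Hgrp n Hm L" using nf[of 0 1] by simp
    moreover have "dv 3 (3 - (- 5))" by (simp add: dv_num)
    ultimately show ?thesis unfolding r by (rule cls) (simp add: un_def)
  next
    assume r: "r = 5"
    have "- 19 \<in> Hgrp n Hm L" using nf[of 1 2] by simp
    moreover have "dv 3 (5 - (- 19))" using dv_8[of 3 3] by simp
    ultimately show ?thesis unfolding r by (rule cls[OF _ _ v19])
  next
    assume r: "r = 7"
    have "- 1 \<in> Hgrp n Hm L" using nf[of 2 1] by simp
    moreover have "dv 3 (7 - (- 1))" by (simp add: dv_num)
    ultimately show ?thesis unfolding r by (rule cls) (simp add: un_def)
  qed simp
  show "{u * x\<^sup>2 | u x. kunit val u \<and> x \<noteq> 0} \<subseteq> Hgrp n Hm L"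
  proof clarify
    fix u x :: 'k assume u: "kunit val u" and x: "x \<noteq> 0"
    then have "u \<noteq> 0" "val u = 0" by (simp_all add: kunit_def)
    then obtain t where t: "u = 1 + 2 * t" "dv 0 t" by (rule unit_odd)
    obtain r z where r: "r \<in> {1,3,5,7}" "1 + 2 * t = r * z\<^sup>2" "z \<noteq> 0" using unit_class[OF t(2)] .
    have "u \<in> Hgrp n Hm L" unfolding t(1) r(2) using H[OF r(1)] r(3) by (rule Hgrp_mult_square)
    then show "u * x\<^sup>2 \<in> Hgrp n Hm L" using x by (rule Hgrp_mult_square)
  qed
qed

end


section \<open>Assembly of the seven cases\<close>

context decomposed_lattice
begin

text \<open>\<open>scount\<close> counts the components of rank two, while indecomposability is
  assumed in the second alternative for a component only; uniqueness of the rank excludes the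
  first.\<close>

lemma free_rank_unique:
  assumes "free_rank val M 1" shows "\<not> free_rank val (M :: 'k vec set) 2"
proof
  assume "free_rank val M 2"
  then obtain bs where bs: "length bs = 2" "dindep bs" "M = ospan val bs" unfolding free_rank_def by blast
  then obtain x y where xy: "bs = [x, y]" by (auto simp: numeral_2_eq_2 length_Suc_conv)
  obtain b where b: "M = ospan val [b]" using assms unfolding free_rank_def by (auto simp: length_Suc_conv)
  note ind = dindep_2[OF bs(2)[unfolded xy]]
  have "x \<in> M" unfolding bs(3) xy ospan_2 by (intro exI[of _ 1] exI[of _ 0]) (simp add: smul_simps)
  then obtain c where c: "x = smul c b" unfolding b ospan_1 by blast
  have "y \<in> M" unfolding bs(3) xy ospan_2 by (intro exI[of _ 0] exI[of _ 1]) (simp add: smul_simps)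
  then obtain d where d: "y = smul d b" unfolding b ospan_1 by blast
  have "c \<noteq> 0" using ind[of 1 0] c by (auto simp: smul_simps)
  then have "smul (- d * qinv c) x + smul 1 y = 0"
    unfolding c d by (simp add: smul_smul smul_simps mult.assoc qinv_left)
  then show False using ind by fastforce
qed

lemma Aset_single:
  assumes "Aset val n Hm Ls = {sqc c}" "r < length Ls" "gen val (Ls ! r) x"
  shows "\<exists>y. y \<noteq> 0 \<and> qnorm (h x x) = c * y\<^sup>2"
proof -
  have "sqc (qnorm (h x x)) \<in> Aset val n Hm Ls" using assms(2,3) unfolding Aset_def by blast
  then have "sqc (qnorm (h x x)) = sqc c" using assms(1) by simp
  moreover have "qnorm (h x x) \<in> sqc (qnorm (h x x))" unfolding sqc_def by (intro CollectI exI[of _ 1]) simp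
  ultimately show ?thesis unfolding sqc_def by auto
qed

end

theorem theorem1:
  fixes val :: "'k::field_char_0 \<Rightarrow> int"
    and n :: nat
    and Hm :: "nat \<Rightarrow> nat \<Rightarrow> 'k quat"
    and L :: "'k vec set"
    and Ls :: "'k vec set list"
  assumes Q2: "is_Q2 val"
    and skew: "skew_herm n Hm"
    and nd: "nondeg n Hm"
    and lat: "is_lattice val n L"
    and dec: "orth_decomp n Hm L Ls"
    and comps: "\<forall>r<length Ls. free_rank val (Ls!r) 1 \<or>
                   (free_rank val (Ls!r) 2 \<and> indecomp val n Hm (Ls!r))"
    and scales: "\<forall>r. Suc r < length Ls \<longrightarrow> scale n Hm (Ls!Suc r) \<subseteq> scale n Hm (Ls!r)"
  shows
   "(card (Aset val n Hm Ls) > 1 \<longrightarrow> Hgrp n Hm L = {c. c \<noteq> 0})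
  \<and> (scount val Ls = 0 \<and> Aset val n Hm Ls = {sqc (- 5)} \<longrightarrow>
       Hgrp n Hm L = {u * x^2 | u x. kunit val u \<and> x \<noteq> 0})
  \<and> (\<forall>u. (\<exists>w. kunit val w \<and> (u = - (w^2) \<or> u = - 5 * w^2)) \<and>
          scount val Ls = 0 \<and> Aset val n Hm Ls = {sqc (- u)} \<and>
          0 \<le> mu val n Hm Ls \<and> mu val n Hm Ls < ereal (real_of_int (qnu val (qof 8)))
       \<longrightarrow> Hgrp n Hm L = {c. c \<noteq> 0})
  \<and> (\<forall>u. (\<exists>w. kunit val w \<and> (u = - (w^2) \<or> u = - 5 * w^2)) \<and>
          scount val Ls = 0 \<and> Aset val n Hm Ls = {sqc (- u)} \<and>
          mu val n Hm Ls \<ge> ereal (real_of_int (qnu val (qof 8)))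
       \<longrightarrow> (\<forall>r x. r < length Ls \<and> gen val (Ls!r) x \<longrightarrow>
              Hgrp n Hm L = normgrp (hform n Hm x x)))
  \<and> (\<forall>\<pi>. \<pi> \<noteq> 0 \<and> val \<pi> = 1 \<and>
          scount val Ls = 0 \<and> Aset val n Hm Ls = {sqc \<pi>} \<and>
          0 \<le> mu val n Hm Ls \<and> mu val n Hm Ls \<le> ereal (real_of_int (qnu val (qof 16)))
       \<longrightarrow> Hgrp n Hm L = {c. c \<noteq> 0})
  \<and> (\<forall>\<pi>. \<pi> \<noteq> 0 \<and> val \<pi> = 1 \<and>
          scount val Ls = 0 \<and> Aset val n Hm Ls = {sqc \<pi>} \<and>
          mu val n Hm Ls > ereal (real_of_int (qnu val (qof 16)))
       \<longrightarrow> (\<forall>r x. r < length Ls \<and> gen val (Ls!r) x \<longrightarrow>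
              Hgrp n Hm L = normgrp (hform n Hm x x)))
  \<and> (scount val Ls \<noteq> 0 \<longrightarrow> Hgrp n Hm L = {c. c \<noteq> 0})"
proof -
  interpret decomposed_lattice val n Hm L Ls
    by unfold_locales (use assms in auto)
  have diag: "diagonal_lattice val n Hm L Ls" if "scount val Ls = 0"
  proof unfold_locales
    show "free_rank val (Ls ! r) 1" if "r < length Ls" for r
      using comps that \<open>scount val Ls = 0\<close> unfolding scount_def by auto
  qed
  have nu: "qnu val (qof 8) = 6" "qnu val (qof 16) = 8"
    using val_power[of 2 6] val_power[of 2 8] by (simp_all add: qnu_def)
  have u_class: "\<exists>c0. (c0 = 1 \<or> c0 = 5) \<and> (\<forall>r x. r < length Ls \<longrightarrow> gen val (Ls ! r) x \<longrightarrow> (\<exists>y. y \<noteq> 0 \<and> qnorm (h x x) = c0 * y\<^sup>2))"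
    if u: "\<exists>w. kunit val w \<and> (u = - (w^2) \<or> u = - 5 * w^2)" and A: "Aset val n Hm Ls = {sqc (- u)}" for u
  proof -
    obtain w where w: "w \<noteq> 0" "u = - (w^2) \<or> u = - 5 * w^2" using u by (auto simp: kunit_def)
    \<comment> \<open>Units of non-minimal defect are -1 or -5 up to unit squares, so the common
      class of the norms is 1 or 5.\<close>
    define c0 :: 'k where "c0 = (if u = - (w^2) then 1 else 5)"
    have u': "- u = c0 * w\<^sup>2" using w(2) by (auto simp: c0_def)
    have "\<exists>y. y \<noteq> 0 \<and> qnorm (h x x) = c0 * y\<^sup>2" if r: "r < length Ls" "gen val (Ls ! r) x" for r x
    proof -
      obtain y where "y \<noteq> 0" "qnorm (h x x) = - u * y\<^sup>2" using Aset_single[OF A r] by blast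
      then show ?thesis using w(1) unfolding u' by (intro exI[of _ "w * y"]) (simp add: power_mult_distrib)
    qed
    then show ?thesis by (intro exI[of _ c0]) (simp add: c0_def)
  qed
  show ?thesis
  proof (intro conjI impI allI; (elim conjE)?)
    assume "card (Aset val n Hm Ls) > 1"
    then show "Hgrp n Hm L = {c. c \<noteq> 0}" by (rule Hgrp_distinct_classes)
  next
    assume s: "scount val Ls = 0" and A: "Aset val n Hm Ls = {sqc (- 5)}"
    interpret diagonal_lattice val n Hm L Ls by (rule diag[OF s])
    have "Aset val n Hm Ls \<noteq> {}" using A by simp
    then have "0 < length Ls" unfolding Aset_def by auto
    then show "Hgrp n Hm L = {u * x^2 | u x. kunit val u \<and> x \<noteq> 0}"
      by (rule Hgrp_unramified) (use Aset_single[OF A _ gen_g] scales in \<open>auto simp: a_def\<close>)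
  next
    fix u assume u: "\<exists>w. kunit val w \<and> (u = - (w^2) \<or> u = - 5 * w^2)" "Aset val n Hm Ls = {sqc (- u)}"
      and mu: "0 \<le> mu val n Hm Ls" "mu val n Hm Ls < ereal (real_of_int (qnu val (qof 8)))"
    obtain c0 where "c0 = 1 \<or> c0 = 5"
      "\<And>r x. r < length Ls \<Longrightarrow> gen val (Ls ! r) x \<Longrightarrow> \<exists>y. y \<noteq> 0 \<and> qnorm (h x x) = c0 * y\<^sup>2"
      using u_class[OF u] by blast
    then have "\<exists>y. y \<noteq> 0 \<and> (qnorm (h x x) = y\<^sup>2 \<or> qnorm (h x x) = 5 * y\<^sup>2)"
      if "r < length Ls" "gen val (Ls ! r) x" for r x using that by fastforce
    then show "Hgrp n Hm L = {c. c \<noteq> 0}" using mu unfolding nu(1) by (rule Hgrp_close_unit_classes)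
  next
    fix u r x assume u: "\<exists>w. kunit val w \<and> (u = - (w^2) \<or> u = - 5 * w^2)" "Aset val n Hm Ls = {sqc (- u)}"
      and mu: "ereal (real_of_int (qnu val (qof 8))) \<le> mu val n Hm Ls"
      and r: "r < length Ls" "gen val (Ls ! r) x" and s: "scount val Ls = 0"
    interpret diagonal_lattice val n Hm L Ls by (rule diag[OF s])
    obtain c0 where "c0 = 1 \<or> c0 = 5"
      "\<And>r x. r < length Ls \<Longrightarrow> gen val (Ls ! r) x \<Longrightarrow> \<exists>y. y \<noteq> 0 \<and> qnorm (h x x) = c0 * y\<^sup>2"
      using u_class[OF u] by blast
    then show "Hgrp n Hm L = normgrp (hform n Hm x x)"
      using mu unfolding nu(1) by (rule Hgrp_distant_unit_classes[OF r])
  next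
    fix \<pi> assume \<pi>: "\<pi> \<noteq> 0" "val \<pi> = 1" and A: "Aset val n Hm Ls = {sqc \<pi>}"
      and mu: "0 \<le> mu val n Hm Ls" "mu val n Hm Ls \<le> ereal (real_of_int (qnu val (qof 16)))"
    \<comment> \<open>The closed bound 8 is handed on as the strict bound 9, because a pair of
      components is extracted from a strict inequality for the infimum.\<close>
    have "ereal (real_of_int 8) < ereal (real_of_int 9)" by simp
    then have "mu val n Hm Ls < ereal (real_of_int 9)" using mu(2) unfolding nu(2) by (rule order.strict_trans1[rotated])
    from Hgrp_close_prime_classes[OF \<pi> Aset_single[OF A] mu(1) this] show "Hgrp n Hm L = {c. c \<noteq> 0}" .
  next
    fix \<pi> r x assume \<pi>: "\<pi> \<noteq> 0" "val \<pi> = 1" and A: "Aset val n Hm Ls = {sqc \<pi>}"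
      and mu: "ereal (real_of_int (qnu val (qof 16))) < mu val n Hm Ls"
      and r: "r < length Ls" "gen val (Ls ! r) x" and s: "scount val Ls = 0"
    interpret diagonal_lattice val n Hm L Ls by (rule diag[OF s])
    show "Hgrp n Hm L = normgrp (hform n Hm x x)"
      using Hgrp_distant_prime_classes[OF r \<pi> Aset_single[OF A] mu[unfolded nu(2)]] .
  next
    assume "scount val Ls \<noteq> 0"
    then have "{r. r < length Ls \<and> free_rank val (Ls ! r) 2} \<noteq> {}" unfolding scount_def by (metis card.empty)
    then obtain r where r: "r < length Ls" "free_rank val (Ls ! r) 2" by blast
    then have "indecomp val n Hm (Ls ! r)" using comps free_rank_unique by blast
    with r show "Hgrp n Hm L = {c. c \<noteq> 0}" by (rule Hgrp_binary_component)
  qed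
qed

end
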